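(* Let $p>1$, $q>\max\{p-1,1\}$, $V\in L^1_{loc}(\Omega\times[0,+\infty))$ with $V>0$ a.e. in $\Omega\times(0,+\infty)$, and $u_0\in L^1_{loc}(\Omega)$ with $u_0\ge 0$ a.e. in $\Omega$. Assume that there exist constants $\theta_1\ge 1$, $\theta_2\ge 1$, $C_0\ge 0$, $C>0$, $\delta_0\in(0,1)$ and $\varepsilon_0>0$ such that, with $E_\delta:=\{(x,t)\in\Omega\times[0,+\infty): d(x)^{-\theta_2}+t^{\theta_1}\le\delta^{-\theta_2}\}$ for $\delta>0$, both of the following hold: (i) for some $0<s_2<\frac{1}{q-1}$, $$\int_{E_{\delta/2}\setminus E_{\delta}} t^{(\theta_1-1)\left(\frac{q}{q-1}-\varepsilon\right)}V^{-\frac{1}{q-1}+\varepsilon}\,dx\,dt\le C\,\delta^{-\frac{q}{q-1}\theta_2-C_0\varepsilon}\,|\log\delta|^{s_2}$$ for every $\delta\in(0,\delta_0)$ and every $\varepsilon\in(0,\varepsilon_0)$; (ii) for some $0<s_4<\frac{p-1}{q-p+1}$, $$\int_{E_{\delta/2}\setminus E_{\delta}} d(x)^{-(\theta_2+1)p\left(\frac{q}{q-p+1}-\varepsilon\right)}V^{-\frac{p-1}{q-p+1}+\varepsilon}\,dx\,dt\le C\,\delta^{-\frac{pq}{q-p+1}\theta_2-C_0\varepsilon}\,|\log\delta|^{s_4}$$ for every $\delta\in(0,\delta_0)$ and every $\varepsilon\in(0,\varepsilon_0)$. If $u$ is a nonnegative weak solution of $$\begin{cases}\partial_t u-\operatorname{div}(|\nabla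 u|^{p-2}\nabla u)\ge V u^q&\text{in }\Omega\times(0,+\infty),\\ u=0&\text{on }\partial\Omega\times(0,+\infty),\\ u=u_0&\text{in }\Omega\times\{0\},\end{cases}$$ then $u=0$ a.e. in $\Omega\times[0,+\infty)$.
   Context: $\Omega\subset\mathbb{R}^N$, $N\ge 3$, is an open bounded connected set, and $d(x):=\operatorname{dist}(x,\partial\Omega)$ for $x\in\overline\Omega$. Weak solution: a function $u\in W^{1,p}_{loc}(\Omega\times[0,+\infty))\cap L^q_{loc}(\Omega\times[0,+\infty),V\,dx\,dt)$ is a weak solution of the problem in the claim if $u\ge 0$ a.e. in $\Omega\times(0,+\infty)$ and for every $\varphi\in\operatorname{Lip}(\Omega\times[0,\infty))$ with $\varphi\ge 0$ and with compact support in $\Omega\times[0,\infty)$ one has $$\int_0^{\infty}\!\int_{\Omega}Vu^q\varphi\,dx\,dt\le\int_0^{\infty}\!\int_{\Omega}|\nabla u|^{p-2}\langle\nabla u,\nabla\varphi\rangle\,dx\,dt-\int_0^{\infty}\!\int_{\Omega}u\,\partial_t\varphi\,dx\,dt-\int_{\Omega}u_0\,\varphi(x,0)\,dx.$$ Here $\nabla$ is the gradient in the $x$ variable. *)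

theory Defs
  imports "HOL-Analysis.Analysis"
begin

text \<open>
  The value \<open>0\<close> at points of non-differentiability is only a totalisation: it is used for
  Lipschitz functions, for which these points form a null set. On the real line, \<open>gradient\<close>
  is the ordinary derivative.
\<close>

definition gradient :: "('b::euclidean_space \<Rightarrow> real) \<Rightarrow> 'b \<Rightarrow> 'b" where
  "gradient f x =
     (if f differentiable (at x)
      then (\<Sum>i\<in>Basis. frechet_derivative f (at x) i *\<^sub>R i) else 0)"

primrec Ck :: "nat \<Rightarrow> ('b::euclidean_space \<Rightarrow> real) \<Rightarrow> bool" where
  "Ck 0 f \<longleftrightarrow> continuous_on UNIV f"
| "Ck (Suc k) f \<longleftrightarrow>
     (\<forall>x. f differentiable (at x)) \<and>
     (\<forall>i\<in>Basis. Ck k (\<lambda>x. frechet_derivative f (at x) i))"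

definition support_on :: "'b::topological_space set \<Rightarrow> ('b \<Rightarrow> real) \<Rightarrow> 'b set" where
  "support_on S f = closure {x \<in> S. f x \<noteq> 0}"

text \<open>\<open>C\<^sub>c\<^sup>\<infinity>(U)\<close>, its elements being extended by \<open>0\<close> to the whole space.\<close>

definition Cc_infinity :: "'b::euclidean_space set \<Rightarrow> ('b \<Rightarrow> real) set" where
  "Cc_infinity U =
     {\<psi>. (\<forall>k. Ck k \<psi>) \<and> compact (support_on UNIV \<psi>) \<and> support_on UNIV \<psi> \<subseteq> U}"

text \<open>
  \<open>L\<^sup>r\<^sub>l\<^sub>o\<^sub>c(S, w dz)\<close> is taken with respect to the compact subsets of \<open>S\<close>, where \<open>S\<close> need not be
  open: for \<open>S = \<Omega> \<times> [0,\<infinity>)\<close> these may touch \<open>t = 0\<close>, but not the lateral boundary.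
\<close>

definition Lp_loc_weighted ::
    "real \<Rightarrow> ('b::euclidean_space \<Rightarrow> real) \<Rightarrow> 'b set \<Rightarrow> ('b \<Rightarrow> 'c::euclidean_space) \<Rightarrow> bool" where
  "Lp_loc_weighted r w S f \<longleftrightarrow>
     set_borel_measurable lebesgue S f \<and>
     (\<forall>K. compact K \<and> K \<subseteq> S \<longrightarrow>
        set_integrable lebesgue K (\<lambda>z. norm (f z) powr r * w z))"

abbreviation Lp_loc ::
    "real \<Rightarrow> 'b::euclidean_space set \<Rightarrow> ('b \<Rightarrow> 'c::euclidean_space) \<Rightarrow> bool" where
  "Lp_loc r S f \<equiv> Lp_loc_weighted r (\<lambda>_. 1) S f"

definition is_weak_gradient ::
    "'b::euclidean_space set \<Rightarrow> ('b \<Rightarrow> real) \<Rightarrow> ('b \<Rightarrow> 'b) \<Rightarrow> bool" where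
  "is_weak_gradient U u G \<longleftrightarrow>
     Lp_loc 1 U u \<and> Lp_loc 1 U G \<and>
     (\<forall>\<psi>\<in>Cc_infinity U.
        (LINT z:U|lebesgue. u z *\<^sub>R gradient \<psi> z) = - (LINT z:U|lebesgue. \<psi> z *\<^sub>R G z))"

abbreviation cyl :: "'a set \<Rightarrow> ('a \<times> real) set" where
  "cyl \<Omega> \<equiv> \<Omega> \<times> {0..}"

abbreviation open_cyl :: "'a set \<Rightarrow> ('a \<times> real) set" where
  "open_cyl \<Omega> \<equiv> \<Omega> \<times> {0<..}"

text \<open>
  \<open>u \<in> W\<^sup>1\<^sup>,\<^sup>p\<^sub>l\<^sub>o\<^sub>c(\<Omega> \<times> [0,\<infinity>))\<close> with space-time weak gradient \<open>G\<close>: the derivatives are taken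
  in the interior, the integrability is required up to \<open>t = 0\<close>. The first component of \<open>G\<close> is
  the gradient in \<open>x\<close>, the second one is the derivative in \<open>t\<close>.
\<close>

definition W1p_loc_grad ::
    "real \<Rightarrow> 'a::euclidean_space set \<Rightarrow> ('a \<times> real \<Rightarrow> real) \<Rightarrow> ('a \<times> real \<Rightarrow> 'a \<times> real) \<Rightarrow> bool" where
  "W1p_loc_grad p \<Omega> u G \<longleftrightarrow>
     is_weak_gradient (open_cyl \<Omega>) u G \<and> Lp_loc p (cyl \<Omega>) u \<and> Lp_loc p (cyl \<Omega>) G"

definition Lip_test :: "'a::euclidean_space set \<Rightarrow> ('a \<times> real \<Rightarrow> real) set" where
  "Lip_test \<Omega> =
     {\<phi>. (\<exists>L. L-lipschitz_on (cyl \<Omega>) \<phi>) \<and> (\<forall>z\<in>cyl \<Omega>. 0 \<le> \<phi> z) \<and>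
         compact (support_on (cyl \<Omega>) \<phi>) \<and> support_on (cyl \<Omega>) \<phi> \<subseteq> cyl \<Omega>}"

text \<open>
  Nonnegative weak solutions of \<open>\<partial>\<^sub>t u - div (|\<nabla>u|\<^sup>p\<^sup>-\<^sup>2 \<nabla>u) \<ge> V u\<^sup>q\<close> with initial value \<open>u\<^sub>0\<close>.
  The lateral boundary condition imposes nothing: test functions vanish near \<open>\<partial>\<Omega>\<close>, so the
  result covers every boundary behaviour. The weak gradient is unique up to a null set, hence
  the choice of \<open>G\<close> is immaterial. Where \<open>\<nabla>u = 0\<close>, the flux is \<open>0\<close>, also if \<open>p < 2\<close>.
\<close>

definition weak_solution ::
    "real \<Rightarrow> real \<Rightarrow> 'a::euclidean_space set \<Rightarrow> ('a \<times> real \<Rightarrow> real) \<Rightarrow> ('a \<Rightarrow> real)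
      \<Rightarrow> ('a \<times> real \<Rightarrow> real) \<Rightarrow> bool" where
  "weak_solution p q \<Omega> V u0 u \<longleftrightarrow>
     (AE z\<in>open_cyl \<Omega> in lebesgue. 0 \<le> u z) \<and>
     Lp_loc_weighted q V (cyl \<Omega>) u \<and>
     (\<exists>G. W1p_loc_grad p \<Omega> u G \<and>
       (\<forall>\<phi>\<in>Lip_test \<Omega>.
          (LINT z:open_cyl \<Omega>|lebesgue. V z * u z powr q * \<phi> z)
          \<le> (LINT (x, t):open_cyl \<Omega>|lebesgue.
                norm (fst (G (x, t))) powr (p - 2) *
                (fst (G (x, t)) \<bullet> gradient (\<lambda>y. \<phi> (y, t)) x))
            - (LINT (x, t):open_cyl \<Omega>|lebesgue. u (x, t) * gradient (\<lambda>s. \<phi> (x, s)) t)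
            - (LINT x:\<Omega>|lebesgue. u0 x * \<phi> (x, 0))))"

abbreviation bdry_dist :: "'a::euclidean_space set \<Rightarrow> 'a \<Rightarrow> real" where
  "bdry_dist \<Omega> x \<equiv> infdist x (frontier \<Omega>)"

definition E_set ::
    "'a::euclidean_space set \<Rightarrow> real \<Rightarrow> real \<Rightarrow> real \<Rightarrow> ('a \<times> real) set" where
  "E_set \<Omega> \<theta>1 \<theta>2 \<delta> =
     {(x, t). (x, t) \<in> cyl \<Omega> \<and>
        bdry_dist \<Omega> x powr (- \<theta>2) + t powr \<theta>1 \<le> \<delta> powr (- \<theta>2)}"

end

theory Submission
  imports Defs
begin

text \<open>
  The proof is the test function method with a negative power of the solution. Put \<open>a = 1 / K\<close> for
  a large integer \<open>K\<close> and test the inequality with \<open>\<phi> ^ n * \<eta> * u powr (- a)\<close>, where \<open>\<phi>\<close> is a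
  cut-off that equals \<open>1\<close> on \<open>E_set\<close> at \<open>2 powr (- K)\<close> and vanishes off \<open>E_set\<close> at \<open>2 powr (- 2 * K)\<close>,
  and \<open>\<eta>\<close> is an increasing function of time that is switched on at time \<open>1 / K\<close>. The negative power
  produces a term \<open>a * norm (\<nabla>u) powr p * u powr (- a - 1)\<close> on the good side. It absorbs the gradient
  of \<open>u\<close> by Young's inequality at the price of a factor \<open>a powr (1 - p)\<close>, and a second application
  absorbs the remaining powers of \<open>u\<close> into \<open>V * u powr (q - a)\<close>. Thus (\<open>capacity_estimate\<close>) the
  integral of \<open>V * u powr (q - a) * \<phi> ^ n * \<eta>\<close> is bounded by an expression in which only the
  derivatives of \<open>\<phi>\<close> and negative powers of \<open>V\<close> occur.

  The cut-off depends on the logarithm of \<open>d(x) powr (- \<theta>2) + t powr \<theta>1\<close> only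
  (\<open>logarithmic_cutoff\<close>). It is spread over the \<open>K\<close> annuli between consecutive sets \<open>E_set\<close> at
  \<open>2 powr (- j)\<close>, for \<open>j\<close> from \<open>K\<close> to \<open>2 * K\<close>, and so its derivatives carry an additional factor
  \<open>1 / K\<close>. In the hypotheses one takes \<open>\<epsilon>\<close> to be \<open>a\<close> divided by \<open>q - 1\<close>, respectively by \<open>q - p + 1\<close>;
  then the factors \<open>\<delta> powr (- C0 * \<epsilon>)\<close> stay bounded, and the logarithm is of the order of \<open>K\<close>. Each
  annulus contributes at most a constant times \<open>K powr (s - Q)\<close>, where \<open>Q\<close> is \<open>q / (q - 1)\<close> for the
  time derivative and \<open>q / (q - p + 1)\<close> for the gradient (\<open>annulus_term_bound\<close>). The sum over the \<open>K\<close>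
  annuli is of the order of \<open>K powr (1 + s - Q)\<close>, and the assumed upper bounds on \<open>s\<close> say precisely
  that \<open>s < Q - 1\<close>. For \<open>K\<close> tending to infinity, Fatou's lemma shows that the integral of
  \<open>V * u powr q\<close> vanishes, and \<open>V\<close> is positive.

  A negative power of a Sobolev function is not a Lipschitz test function. Therefore the weak
  formulation is only tested with reflected mollifiers (\<open>weak_solution_regularised\<close>). This yields,
  point by point, the differential inequality for the averages of \<open>u\<close>, of the flux and of
  \<open>V * u powr q\<close>, which are regular functions. It is multiplied by the desired test function, built
  from the average of \<open>u\<close>, and integrated by parts classically (\<open>mollified_energy\<close>). In the limit of
  vanishing radius (\<open>energy_inequality\<close>) only the \<open>L\<^sup>1\<close> convergence of mollifications is used; the
  product of the averaged flux with the averaged gradient is treated by the monotonicity of the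
  flux and Fatou's lemma.
\<close>

section \<open>Smooth bump functions\<close>

text \<open>
  \<open>Ck\<close> is phrased with \<open>frechet_derivative\<close>; this rule lets the derivative be supplied explicitly.
\<close>

lemma Ck_SucI:
  assumes "\<And>x. (f has_derivative f' x) (at x)"
    and "\<And>i. i \<in> Basis \<Longrightarrow> Ck k (\<lambda>x. f' x i)"
  shows "Ck (Suc k) f"
proof -
  have "frechet_derivative f (at x) = f' x" for x
    using assms(1) by (rule frechet_derivative_at[symmetric])
  then show ?thesis
    using assms by (auto simp: differentiable_def)
qed

lemma Ck_has_derivative:
  assumes "Ck (Suc k) f"
  shows "(f has_derivative frechet_derivative f (at x)) (at x)"
  using assms by (simp add: frechet_derivative_works)

lemma Ck_SucD: "Ck (Suc k) f \<Longrightarrow> Ck k f"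
proof (induction k arbitrary: f)
  case 0
  then show ?case
    by (auto intro!: differentiable_imp_continuous_on simp: differentiable_on_def differentiable_at_withinI)
next
  case (Suc k)
  have "Ck (Suc k) (\<lambda>x. frechet_derivative f (at x) i)" if "i \<in> Basis" for i
    using Suc.prems that by simp
  then have "Ck k (\<lambda>x. frechet_derivative f (at x) i)" if "i \<in> Basis" for i
    using Suc.IH that by blast
  then show ?case
    using Suc.prems unfolding Ck.simps(2) by blast
qed

lemma Ck_const: "Ck k (\<lambda>x. c)"
proof (induction k arbitrary: c)
  case (Suc k)
  show ?case
    by (rule Ck_SucI[where f' = "\<lambda>x v. 0"]) (use Suc in auto)
qed simp

lemma Ck_add: "Ck k f \<Longrightarrow> Ck k g \<Longrightarrow> Ck k (\<lambda>x. f x + g x)"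
proof (induction k arbitrary: f g)
  case 0
  then show ?case by (auto intro: continuous_intros)
next
  case (Suc k)
  show ?case
    by (rule Ck_SucI, rule has_derivative_add[OF Ck_has_derivative Ck_has_derivative])
       (use Suc in auto)
qed

lemma Ck_mult: "Ck k f \<Longrightarrow> Ck k g \<Longrightarrow> Ck k (\<lambda>x. f x * g x)"
proof (induction k arbitrary: f g)
  case 0
  then show ?case by (auto intro: continuous_intros)
next
  case (Suc k)
  have "Ck k f" "Ck k g" using Suc.prems by (auto intro: Ck_SucD)
  show ?case
    by (rule Ck_SucI, rule has_derivative_mult[OF Ck_has_derivative Ck_has_derivative])
       (use Suc \<open>Ck k f\<close> \<open>Ck k g\<close> in \<open>auto intro!: Ck_add\<close>)
qed

text \<open>
  The family is closed under differentiation up to linear combinations, so the smoothness of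
  all its members follows from one induction over the order of differentiation. The exponent \<open>n\<close>
  costs nothing: at \<open>0\<close> the exponential beats every power.
\<close>

definition flat_exp :: "nat \<Rightarrow> real \<Rightarrow> real" where
  "flat_exp n t = (if t > 0 then exp (- 1 / t) / t ^ n else 0)"

lemma flat_exp_tendsto_0: "(flat_exp n \<longlongrightarrow> 0) (at 0)"
proof -
  have "((\<lambda>t::real. inverse t ^ n / exp (inverse t)) \<longlongrightarrow> 0) (at_right 0)"
    by (rule filterlim_compose[OF tendsto_power_div_exp_0 filterlim_inverse_at_top_right])
  moreover have "eventually (\<lambda>t::real. inverse t ^ n / exp (inverse t) = flat_exp n t) (at_right 0)"
    unfolding eventually_at_filter
    by (auto intro!: always_eventually simp: flat_exp_def exp_minus field_simps)
  ultimately have r: "(flat_exp n \<longlongrightarrow> 0) (at_right 0)"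
    by (rule Lim_transform_eventually)
  have "(flat_exp n \<longlongrightarrow> 0) (at_left 0)"
    by (rule Lim_transform_eventually[OF tendsto_const])
       (auto simp: eventually_at_filter flat_exp_def)
  with r show ?thesis
    by (simp add: filterlim_at_split)
qed

text \<open>
  At \<open>t = 0\<close> the difference quotient of \<open>flat_exp n\<close> is \<open>flat_exp (n + 1)\<close>, which tends to \<open>0\<close>.
\<close>

lemma flat_exp_has_derivative:
  "(flat_exp n has_real_derivative flat_exp (n + 2) t - real n * flat_exp (n + 1) t) (at t)"
proof -
  consider "t < 0" | "t = 0" | "t > 0" by linarith
  then show ?thesis
  proof cases
    case 1
    have "((\<lambda>t. 0) has_real_derivative 0) (at t)" by simp
    then have "(flat_exp n has_real_derivative 0) (at t)"
      by (rule has_field_derivative_transform_within_open[where S = "{..<0}"])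
         (use 1 in \<open>auto simp: flat_exp_def\<close>)
    then show ?thesis using 1 by (simp add: flat_exp_def)
  next
    case 2
    have "((\<lambda>h. flat_exp n h / h) \<longlongrightarrow> 0) (at 0)"
      by (rule Lim_transform_eventually[OF flat_exp_tendsto_0[of "Suc n"]])
         (auto simp: eventually_at_filter flat_exp_def)
    then show ?thesis
      using 2 by (simp add: has_field_derivative_iff flat_exp_def[of _ 0])
  next
    case 3
    have "((\<lambda>t. exp (- 1 / t) / t ^ n) has_real_derivative
        (exp (- 1 / t) * (1 / t\<^sup>2) * t ^ n - exp (- 1 / t) * (real n * t ^ (n - 1))) / (t ^ n * t ^ n)) (at t)"
      using 3 by (auto intro!: derivative_eq_intros simp: power2_eq_square)
    moreover have "(exp (- 1 / t) * (1 / t\<^sup>2) * t ^ n - exp (- 1 / t) * (real n * t ^ (n - 1))) / (t ^ n * t ^ n)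
        = flat_exp (n + 2) t - real n * flat_exp (n + 1) t"
      using 3 by (cases n) (auto simp: flat_exp_def field_simps power2_eq_square)
    ultimately have "((\<lambda>t. exp (- 1 / t) / t ^ n) has_real_derivative
        flat_exp (n + 2) t - real n * flat_exp (n + 1) t) (at t)"
      by metis
    then show ?thesis
      by (rule has_field_derivative_transform_within_open[where S = "{0<..}"])
         (use 3 in \<open>auto simp: flat_exp_def\<close>)
  qed
qed

lemma continuous_flat_exp: "continuous_on S (flat_exp n)"
  by (intro continuous_at_imp_continuous_on ballI DERIV_isCont[OF flat_exp_has_derivative])

lemma continuous_flat_exp_compose [continuous_intros]:
  "continuous_on S f \<Longrightarrow> continuous_on S (\<lambda>x. flat_exp n (f x))"
  by (rule continuous_on_compose2[OF continuous_flat_exp[of UNIV]]) auto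

lemma flat_exp_inner_has_derivative:
  "((\<lambda>y. flat_exp n (c - (z - y) \<bullet> (z - y))) has_derivative
     (\<lambda>v. 2 * ((z - y) \<bullet> v) * (flat_exp (n + 2) (c - (z - y) \<bullet> (z - y))
            - real n * flat_exp (n + 1) (c - (z - y) \<bullet> (z - y))))) (at y)"
proof -
  have "((\<lambda>y. c - (z - y) \<bullet> (z - y)) has_derivative (\<lambda>v. 2 * ((z - y) \<bullet> v))) (at y)"
    by (auto intro!: derivative_eq_intros simp: inner_commute)
  from has_derivative_compose[OF this flat_exp_has_derivative[THEN has_field_derivative_imp_has_derivative]]
  show ?thesis by (simp add: mult_ac)
qed

text \<open>
  The composition with a quadratic polynomial is smooth because its partial derivatives are
  linear functions times members of the same family with one order of smoothness less to prove.
\<close>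

lemma Ck_flat_exp_inner:
  fixes z :: "'b::euclidean_space"
  shows "Ck k (\<lambda>y. flat_exp n (c - (z - y) \<bullet> (z - y)))"
proof (induction k arbitrary: n)
  case 0
  show ?case
    by (auto intro!: continuous_intros)
next
  case (Suc k)
  have lin: "Ck k (\<lambda>y. (z - y) \<bullet> i)" for i :: 'b
  proof (cases k)
    case (Suc j)
    have "Ck (Suc j) (\<lambda>y. (z - y) \<bullet> i)"
      by (rule Ck_SucI[where f' = "\<lambda>y v. - (v \<bullet> i)"])
         (auto intro!: derivative_eq_intros Ck_const)
    with Suc show ?thesis by simp
  qed (auto intro!: continuous_intros)
  have eq: "(\<lambda>y. 2 * ((z - y) \<bullet> i) * (flat_exp (n + 2) (c - (z - y) \<bullet> (z - y))
            - real n * flat_exp (n + 1) (c - (z - y) \<bullet> (z - y))))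
     = (\<lambda>y. (2 * ((z - y) \<bullet> i)) * (flat_exp (n + 2) (c - (z - y) \<bullet> (z - y))
            + (- real n) * flat_exp (n + 1) (c - (z - y) \<bullet> (z - y))))" for i by auto
  show ?case
    by (rule Ck_SucI[OF flat_exp_inner_has_derivative])
       (unfold eq, intro Ck_mult Ck_add Ck_const lin Suc)
qed

definition bump_mass :: "'b::euclidean_space itself \<Rightarrow> real \<Rightarrow> real" where
  "bump_mass T r = (\<integral>y. flat_exp 0 (r\<^sup>2 - y \<bullet> y) \<partial>(lborel :: 'b measure))"

text \<open>
  The mollifier of radius \<open>r\<close>: smooth, nonnegative, of total mass one and supported in the
  ball of radius \<open>r\<close>.
\<close>

definition kern :: "real \<Rightarrow> 'b::euclidean_space \<Rightarrow> real" where
  "kern r y = flat_exp 0 (r\<^sup>2 - y \<bullet> y) / bump_mass TYPE('b) r"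

text \<open>
  The gradient of \<open>kern r\<close>, in closed form (see \<open>kern_has_derivative\<close>).
\<close>

definition kgrad :: "real \<Rightarrow> 'b::euclidean_space \<Rightarrow> 'b" where
  "kgrad r y = (- 2 * flat_exp 2 (r\<^sup>2 - y \<bullet> y) / bump_mass TYPE('b) r) *\<^sub>R y"

lemma flat_exp_ball_zero:
  assumes "r > 0" "norm y \<ge> r"
  shows "flat_exp n (r\<^sup>2 - y \<bullet> y) = 0"
proof -
  have "r\<^sup>2 \<le> (norm y)\<^sup>2"
    using assms by (intro power_mono) auto
  then show ?thesis
    by (simp add: flat_exp_def dot_square_norm)
qed

lemma integrable_continuous_compact_support:
  fixes f :: "'b::euclidean_space \<Rightarrow> 'c::{banach, second_countable_topology}"
  assumes "continuous_on UNIV f" "compact S" "\<And>x. x \<notin> S \<Longrightarrow> f x = 0"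
  shows "integrable lborel f"
proof -
  have "integrable lborel (\<lambda>x. indicator S x *\<^sub>R f x)"
    by (intro borel_integrable_compact assms continuous_on_subset[OF assms(1)]) auto
  moreover have "(\<lambda>x. indicator S x *\<^sub>R f x) = f"
    using assms(3) by (auto simp: fun_eq_iff indicator_def)
  ultimately show ?thesis by simp
qed

lemma bump_integrable:
  "r > 0 \<Longrightarrow> integrable lborel (\<lambda>y::'b::euclidean_space. flat_exp 0 (r\<^sup>2 - y \<bullet> y))"
  by (rule integrable_continuous_compact_support[where S = "cball 0 r"])
     (auto intro!: continuous_intros flat_exp_ball_zero)

text \<open>
  On the ball of half the radius the bump is bounded below by a positive constant.
\<close>

lemma bump_mass_pos:
  assumes "r > 0"
  shows "bump_mass TYPE('b::euclidean_space) r > 0"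
proof -
  let ?c = "exp (- 1 / (r\<^sup>2 - (r/2)\<^sup>2))"
  have "0 < ?c * measure lborel (ball (0::'b) (r / 2))"
    using assms content_ball_pos[of "r/2" "0::'b"] by simp
  also have "\<dots> = (\<integral>y. ?c * indicator (ball (0::'b) (r / 2)) y \<partial>lborel)"
    by simp
  also have "\<dots> \<le> bump_mass TYPE('b) r"
    unfolding bump_mass_def
  proof (intro integral_mono bump_integrable assms)
    show "integrable lborel (\<lambda>y. ?c * indicator (ball (0::'b) (r / 2)) y)"
      using emeasure_lborel_ball_finite[of "0::'b" "r/2"]
      by (auto simp: top.not_eq_extremum intro!: integrable_real_indicator integrable_mult_right)
    fix y :: 'b
    have "y \<bullet> y \<le> (r/2)\<^sup>2" if "norm y < r / 2"
      using that by (auto simp: dot_square_norm intro!: power_mono)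
    moreover have "(r/2)\<^sup>2 < r\<^sup>2" using assms by (simp add: power_divide)
    ultimately show "?c * indicator (ball 0 (r / 2)) y \<le> flat_exp 0 (r\<^sup>2 - y \<bullet> y)"
      by (auto simp: indicator_def flat_exp_def intro!: divide_left_mono mult_pos_pos frac_le)
  qed
  finally show ?thesis .
qed

lemma kern_nonneg: "r > 0 \<Longrightarrow> 0 \<le> kern r (y::'b::euclidean_space)"
  using bump_mass_pos[of r, where 'b = 'b] by (simp add: kern_def flat_exp_def)

lemma kern_zero: "r > 0 \<Longrightarrow> norm y \<ge> r \<Longrightarrow> kern r y = 0"
  and kgrad_zero: "r > 0 \<Longrightarrow> norm y \<ge> r \<Longrightarrow> kgrad r y = 0"
  by (simp_all add: kern_def kgrad_def flat_exp_ball_zero)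

lemma kern_continuous [continuous_intros]: "continuous_on S f \<Longrightarrow> continuous_on S (\<lambda>x. kern r (f x))"
  by (cases "bump_mass TYPE('b) r = 0")
     (auto simp: kern_def divide_inverse intro!: continuous_intros)

lemma kgrad_continuous [continuous_intros]: "continuous_on S f \<Longrightarrow> continuous_on S (\<lambda>x. kgrad r (f x))"
  by (auto simp: kgrad_def divide_inverse intro!: continuous_intros)

lemma kern_integral: "r > 0 \<Longrightarrow> (\<integral>y. kern r (y::'b::euclidean_space) \<partial>lborel) = 1"
  using bump_mass_pos[of r, where 'b = 'b] by (simp add: kern_def bump_mass_def)

lemma kern_integrable: "r > 0 \<Longrightarrow> integrable lborel (kern r)"
  unfolding kern_def by (intro integrable_divide bump_integrable)

lemma kern_has_derivative: "(kern r has_derivative (\<lambda>v. kgrad r y \<bullet> v)) (at y)"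
proof -
  have "((\<lambda>y. flat_exp 0 (r\<^sup>2 - y \<bullet> y) / c) has_derivative
      (\<lambda>v. ((- 2 * flat_exp 2 (r\<^sup>2 - y \<bullet> y) / c) *\<^sub>R y) \<bullet> v)) (at y)" for c
    using has_derivative_mult_left[OF flat_exp_inner_has_derivative[of 0 "r\<^sup>2" 0 y], of "inverse c"]
    by (simp add: divide_inverse numeral_2_eq_2 mult_ac)
  then show ?thesis unfolding kern_def[abs_def] kgrad_def .
qed

lemma kern_uminus: "kern r (- y) = kern r y"
  by (simp add: kern_def)

text \<open>
  Reflected and translated kernels are the only test functions that are ever inserted into the
  definition of the weak gradient.
\<close>

lemma kern_Cc_infinity:
  assumes "r > 0" "cball z r \<subseteq> U"
  shows "(\<lambda>y. kern r (z - y)) \<in> Cc_infinity U"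
proof -
  have "closure {y. kern r (z - y) \<noteq> 0} \<subseteq> cball z r"
    by (rule closure_minimal) (use kern_zero[OF \<open>r > 0\<close>] in \<open>force simp: dist_norm\<close>)+
  moreover from this have "compact (closure {y. kern r (z - y) \<noteq> 0})"
    by (meson bounded_cball bounded_subset closed_closure compact_eq_bounded_closed)
  moreover have "Ck k (\<lambda>y. kern r (z - y))" for k
    using Ck_mult[OF Ck_flat_exp_inner[of k 0 "r\<^sup>2" z] Ck_const[of k "inverse (bump_mass TYPE('a) r)"]]
    by (simp add: kern_def divide_inverse)
  ultimately show ?thesis
    using assms(2) by (auto simp: Cc_infinity_def support_on_def)
qed

section \<open>Mollification\<close>

text \<open>
  Points at distance less than one either both lie in a slightly larger ball, where compactness
  applies, or both lie where the function vanishes.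
\<close>

lemma uniformly_continuous_compact_support:
  fixes f :: "'b::euclidean_space \<Rightarrow> 'c::real_normed_vector"
  assumes cont: "continuous_on UNIV f" and zero: "\<And>x. norm x \<ge> r \<Longrightarrow> f x = 0"
  shows "uniformly_continuous_on UNIV f"
  unfolding uniformly_continuous_on_def
proof (intro allI impI)
  fix e :: real assume "e > 0"
  have "uniformly_continuous_on (cball 0 (r + 1)) f"
    by (intro compact_uniformly_continuous continuous_on_subset[OF cont]) auto
  then obtain d where d: "d > 0"
    "\<And>x y. norm x \<le> r + 1 \<Longrightarrow> norm y \<le> r + 1 \<Longrightarrow> dist y x < d \<Longrightarrow> dist (f y) (f x) < e"
    using \<open>e > 0\<close> unfolding uniformly_continuous_on_def by (auto simp: Ball_def)
  have "dist (f y) (f x) < e" if "dist y x < min d 1" for x y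
  proof (cases "norm x \<ge> r \<and> norm y \<ge> r")
    case False
    have "norm y \<le> norm x + dist y x" "norm x \<le> norm y + dist y x"
      by norm+
    with False that show ?thesis by (intro d) auto
  qed (use zero \<open>e > 0\<close> in simp)
  then show "\<exists>d>0. \<forall>x\<in>UNIV. \<forall>x'\<in>UNIV. dist x' x < d \<longrightarrow> dist (f x') (f x) < e"
    using d(1) by (intro exI[of _ "min d 1"]) auto
qed

lemma bounded_continuous_compact_support:
  fixes f :: "'b::euclidean_space \<Rightarrow> 'c::real_normed_vector"
  assumes "continuous_on UNIV f" "compact S" "\<And>x. x \<notin> S \<Longrightarrow> f x = 0"
  obtains M where "0 < M" "\<And>x. norm (f x) \<le> M"
proof -
  have "compact (f ` S)"
    by (intro compact_continuous_image assms continuous_on_subset[OF assms(1)]) auto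
  then obtain M where "0 < M" "\<forall>y\<in>f ` S. norm y \<le> M"
    using bounded_pos compact_imp_bounded by metis
  then have "norm (f x) \<le> M" for x
    using assms(3)[of x] by (cases "x \<in> S") auto
  with \<open>0 < M\<close> show thesis by (rule that)
qed

lemma kern_continuous_UNIV: "continuous_on UNIV (kern r)"
  and kgrad_continuous_UNIV: "continuous_on UNIV (kgrad r)"
  using kern_continuous[OF continuous_on_id] kgrad_continuous[OF continuous_on_id] by simp_all

lemma kern_uniformly_continuous: "r > 0 \<Longrightarrow> uniformly_continuous_on UNIV (kern r)"
  by (rule uniformly_continuous_compact_support[OF kern_continuous_UNIV kern_zero])

lemma kgrad_uniformly_continuous: "r > 0 \<Longrightarrow> uniformly_continuous_on UNIV (kgrad r)"
  by (rule uniformly_continuous_compact_support[OF kgrad_continuous_UNIV kgrad_zero])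

lemma kern_bounded:
  assumes "r > 0"
  obtains M where "0 < M" "\<And>x. norm (kern r (x::'b::euclidean_space)) \<le> M"
proof (rule bounded_continuous_compact_support[OF kern_continuous_UNIV compact_cball])
  show "kern r x = 0" if "x \<notin> cball 0 r" for x :: 'b
    using kern_zero[OF assms, of x] that by simp
qed (rule that)

lemma kgrad_bounded:
  assumes "r > 0"
  obtains M where "0 < M" "\<And>x. norm (kgrad r (x::'b::euclidean_space)) \<le> M"
proof (rule bounded_continuous_compact_support[OF kgrad_continuous_UNIV compact_cball])
  show "kgrad r x = 0" if "x \<notin> cball 0 r" for x :: 'b
    using kgrad_zero[OF assms, of x] that by simp
qed (rule that)

lemma integral_norm_le_integral:
  fixes f :: "'x \<Rightarrow> 'c::{banach, second_countable_topology}"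
  assumes "integrable M f" "integrable M g" "\<And>x. norm (f x) \<le> g x"
  shows "norm (\<integral>x. f x \<partial>M) \<le> (\<integral>x. g x \<partial>M)"
  by (rule order_trans[OF integral_norm_bound]) (intro integral_mono integrable_norm assms)

text \<open>
  Stated for a bilinear product since two kinds of convolution occur: a scalar kernel with a
  vector-valued function, and the vector-valued gradient kernel with a scalar function.
\<close>

lemma integrable_bilinear_conv:
  fixes prod :: "'c::{banach, second_countable_topology} \<Rightarrow> 'd::{banach, second_countable_topology}
      \<Rightarrow> 'e::{banach, second_countable_topology}" and k :: "'b::euclidean_space \<Rightarrow> 'c"
  assumes "bounded_bilinear prod" "continuous_on UNIV k" "\<And>x. norm (k x) \<le> M" "integrable lborel f"
  shows "integrable lborel (\<lambda>w. prod (k (z - w)) (f w))"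
proof -
  interpret bounded_bilinear prod by fact
  obtain K where K: "K > 0" "\<And>a b. norm (prod a b) \<le> norm a * norm b * K"
    using pos_bounded by auto
  have [measurable]: "f \<in> borel_measurable borel"
    using assms(4) by (simp add: borel_measurable_integrable)
  have [measurable]: "k \<in> borel_measurable borel"
    by (intro borel_measurable_continuous_onI assms)
  have [measurable]: "(\<lambda>w. prod (k (z - w)) (f w)) \<in> borel_measurable borel"
    using borel_measurable_continuous_on[where f = "\<lambda>x. prod (fst x) (snd x)"
        and g = "\<lambda>w. (k (z - w), f w)" and M = borel]
      continuous_on[OF continuous_on_fst[OF continuous_on_id] continuous_on_snd[OF continuous_on_id]]
    by simp
  show ?thesis
  proof (rule Bochner_Integration.integrable_bound)
    show "integrable lborel (\<lambda>w. M * K * norm (f w))"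
      using assms(4) by simp
    show "AE w in lborel. norm (prod (k (z - w)) (f w)) \<le> norm (M * K * norm (f w))"
    proof (rule AE_I2)
      fix w
      have "0 \<le> M" using assms(3)[of 0] norm_ge_zero order_trans by blast
      have "norm (prod (k (z - w)) (f w)) \<le> norm (k (z - w)) * norm (f w) * K"
        by (rule K)
      also have "\<dots> \<le> M * norm (f w) * K"
        by (intro mult_right_mono assms) (use K in auto)
      finally show "norm (prod (k (z - w)) (f w)) \<le> norm (M * K * norm (f w))"
        using \<open>0 \<le> M\<close> K(1) by (simp add: abs_mult mult_ac)
    qed
  qed simp
qed

lemma continuous_on_bilinear_conv:
  fixes prod :: "'c::{banach, second_countable_topology} \<Rightarrow> 'd::{banach, second_countable_topology}
      \<Rightarrow> 'e::{banach, second_countable_topology}" and k :: "'b::euclidean_space \<Rightarrow> 'c"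
  assumes "bounded_bilinear prod" "uniformly_continuous_on UNIV k" "\<And>x. norm (k x) \<le> M"
    "integrable lborel f"
  shows "continuous_on UNIV (\<lambda>z. \<integral>w. prod (k (z - w)) (f w) \<partial>lborel)"
  unfolding continuous_on_iff
proof (intro ballI allI impI)
  interpret bounded_bilinear prod by fact
  note int = integrable_bilinear_conv[OF assms(1) uniformly_continuous_imp_continuous[OF assms(2)] assms(3,4)]
  fix z :: 'b and e :: real assume "e > 0"
  obtain K where K: "K > 0" "\<And>a b. norm (prod a b) \<le> norm a * norm b * K"
    using pos_bounded by auto
  define N where "N = (\<integral>w. norm (f w) \<partial>lborel)"
  have "N \<ge> 0" by (simp add: N_def)
  define \<eta> where "\<eta> = e / (K * (N + 1))"
  have "\<eta> > 0" using \<open>e > 0\<close> K \<open>N \<ge> 0\<close> by (simp add: \<eta>_def)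
  then obtain d where d: "d > 0" "\<And>x y. dist y x < d \<Longrightarrow> dist (k y) (k x) < \<eta>"
    using assms(2) unfolding uniformly_continuous_on_def by (metis UNIV_I)
  have "dist (\<integral>w. prod (k (y - w)) (f w) \<partial>lborel) (\<integral>w. prod (k (z - w)) (f w) \<partial>lborel) < e"
    if "dist y z < d" for y
  proof -
    have "norm (\<integral>w. prod (k (y - w)) (f w) - prod (k (z - w)) (f w) \<partial>lborel)
       \<le> (\<integral>w. \<eta> * K * norm (f w) \<partial>lborel)"
    proof (rule integral_norm_le_integral)
      fix w
      have "norm (prod (k (y - w) - k (z - w)) (f w)) \<le> norm (k (y - w) - k (z - w)) * norm (f w) * K"
        by (rule K)
      also have "\<dots> \<le> \<eta> * norm (f w) * K"
        using d(2)[of "y - w" "z - w"] that K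
        by (intro mult_right_mono) (auto simp: dist_norm)
      finally show "norm (prod (k (y - w)) (f w) - prod (k (z - w)) (f w)) \<le> \<eta> * K * norm (f w)"
        by (simp add: diff_left mult_ac)
    qed (use int assms(4) in auto)
    also have "\<dots> = \<eta> * K * N" by (simp add: N_def)
    also have "\<dots> < e"
    proof -
      have "\<eta> * K * N = e * (N / (N + 1))"
        using K(1) \<open>N \<ge> 0\<close> by (simp add: \<eta>_def)
      also have "\<dots> < e * 1"
        using \<open>e > 0\<close> \<open>N \<ge> 0\<close> by (intro mult_strict_left_mono) auto
      finally show ?thesis by simp
    qed
    finally show ?thesis
      using int by (simp add: dist_norm)
  qed
  with d(1) show "\<exists>d>0. \<forall>x'\<in>UNIV. dist x' z < d \<longrightarrow>
      dist (\<integral>w. prod (k (x' - w)) (f w) \<partial>lborel) (\<integral>w. prod (k (z - w)) (f w) \<partial>lborel) < e"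
    by blast
qed

definition smooth_avg :: "real \<Rightarrow> ('b::euclidean_space \<Rightarrow> 'c::{banach, second_countable_topology}) \<Rightarrow> 'b \<Rightarrow> 'c" where
  "smooth_avg r f z = (\<integral>w. kern r (z - w) *\<^sub>R f w \<partial>lborel)"

definition smooth_avg_grad :: "real \<Rightarrow> ('b::euclidean_space \<Rightarrow> real) \<Rightarrow> 'b \<Rightarrow> 'b" where
  "smooth_avg_grad r f z = (\<integral>w. f w *\<^sub>R kgrad r (z - w) \<partial>lborel)"

lemma bounded_bilinear_scaleR_flip: "bounded_bilinear (\<lambda>x (c::real). c *\<^sub>R (x::'c::real_normed_vector))"
  by (rule bounded_bilinear.flip[OF bounded_bilinear_scaleR])

lemma smooth_avg_integrable:
  fixes f :: "'b::euclidean_space \<Rightarrow> 'c::{banach, second_countable_topology}"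
  assumes "r > 0" "integrable lborel f"
  shows "integrable lborel (\<lambda>w. kern r (z - w) *\<^sub>R f w)"
proof -
  obtain M where "\<And>x::'b. norm (kern r x) \<le> M" using kern_bounded[OF assms(1)] by blast
  from integrable_bilinear_conv[OF bounded_bilinear_scaleR kern_continuous_UNIV this assms(2)]
  show ?thesis .
qed

lemma smooth_avg_grad_integrable:
  fixes f :: "'b::euclidean_space \<Rightarrow> real"
  assumes "r > 0" "integrable lborel f"
  shows "integrable lborel (\<lambda>w. f w *\<^sub>R kgrad r (z - w))"
proof -
  obtain M where "\<And>x::'b. norm (kgrad r x) \<le> M" using kgrad_bounded[OF assms(1)] by blast
  from integrable_bilinear_conv[OF bounded_bilinear_scaleR_flip kgrad_continuous_UNIV this assms(2)]
  show ?thesis .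
qed

lemma smooth_avg_continuous:
  fixes f :: "'b::euclidean_space \<Rightarrow> 'c::{banach, second_countable_topology}"
  assumes "r > 0" "integrable lborel f"
  shows "continuous_on UNIV (smooth_avg r f)"
proof -
  obtain M where "\<And>x::'b. norm (kern r x) \<le> M" using kern_bounded[OF assms(1)] by blast
  from continuous_on_bilinear_conv[OF bounded_bilinear_scaleR kern_uniformly_continuous[OF assms(1)] this assms(2)]
  show ?thesis unfolding smooth_avg_def[abs_def] .
qed

lemma smooth_avg_grad_continuous:
  fixes f :: "'b::euclidean_space \<Rightarrow> real"
  assumes "r > 0" "integrable lborel f"
  shows "continuous_on UNIV (smooth_avg_grad r f)"
proof -
  obtain M where "\<And>x::'b. norm (kgrad r x) \<le> M" using kgrad_bounded[OF assms(1)] by blast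
  from continuous_on_bilinear_conv[OF bounded_bilinear_scaleR_flip kgrad_uniformly_continuous[OF assms(1)] this assms(2)]
  show ?thesis unfolding smooth_avg_grad_def[abs_def] .
qed

text \<open>
  The gradient of the kernel is uniformly continuous, hence the error of the linearisation of
  \<open>kern r\<close> is small uniformly in the point, and it can be integrated against \<open>f\<close>.
\<close>

lemma smooth_avg_has_derivative:
  assumes r: "r > 0" and f: "integrable lborel f"
  shows "(smooth_avg r f has_derivative (\<lambda>v. smooth_avg_grad r f z \<bullet> v)) (at z)"
  unfolding has_derivative_at_alt
proof (intro conjI allI impI)
  show "bounded_linear (\<lambda>v. smooth_avg_grad r f z \<bullet> v)"
    by (rule bounded_linear_inner_right)
  fix e :: real assume "e > 0"
  define N where "N = (\<integral>w. norm (f w) \<partial>lborel)"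
  have "N \<ge> 0" by (simp add: N_def)
  define \<eta> where "\<eta> = e / (N + 1)"
  have "\<eta> > 0" using \<open>e > 0\<close> \<open>N \<ge> 0\<close> by (simp add: \<eta>_def)
  then obtain d where d: "d > 0" "\<And>x y::'a. dist y x < d \<Longrightarrow> dist (kgrad r y) (kgrad r x) < \<eta>"
    using kgrad_uniformly_continuous[OF r] unfolding uniformly_continuous_on_def by (metis UNIV_I)
  have lin: "norm (kern r b - kern r a - kgrad r a \<bullet> (b - a)) \<le> norm (b - a) * \<eta>"
    if "dist b a < d" for a b :: 'a
  proof (rule differentiable_bound_linearization[where S = "ball a d" and f' = "\<lambda>x v. kgrad r x \<bullet> v"])
    show "a + t *\<^sub>R (b - a) \<in> ball a d" if "t \<in> {0..1}" for t
    proof -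
      have "norm (t *\<^sub>R (b - a)) \<le> norm (b - a)"
        using that by (auto intro!: mult_left_le_one_le)
      with \<open>dist b a < d\<close> show ?thesis by (simp add: dist_norm norm_minus_commute)
    qed
    show "onorm ((\<lambda>v. kgrad r x \<bullet> v) - (\<lambda>v. kgrad r a \<bullet> v)) \<le> \<eta>" if "x \<in> ball a d" for x
      unfolding fun_diff_def
    proof (rule onorm_bound)
      show "0 \<le> \<eta>" using \<open>\<eta> > 0\<close> by simp
      fix v
      have "\<bar>(kgrad r x - kgrad r a) \<bullet> v\<bar> \<le> norm (kgrad r x - kgrad r a) * norm v"
        by (rule Cauchy_Schwarz_ineq2)
      also have "\<dots> \<le> \<eta> * norm v"
        using d(2)[of x a] that by (intro mult_right_mono) (auto simp: dist_norm norm_minus_commute)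
      finally show "norm (kgrad r x \<bullet> v - kgrad r a \<bullet> v) \<le> \<eta> * norm v"
        by (simp add: inner_diff_left)
    qed
  qed (use d in \<open>auto intro: has_derivative_at_withinI kern_has_derivative\<close>)
  have "norm (smooth_avg r f y - smooth_avg r f z - smooth_avg_grad r f z \<bullet> (y - z)) \<le> e * norm (y - z)"
    if "norm (y - z) < d" for y
  proof -
    have i1: "integrable lborel (\<lambda>w. kern r (x - w) * f w)" for x
      using smooth_avg_integrable[OF r f, of x] by simp
    have i2: "integrable lborel (\<lambda>w. f w * (kgrad r (z - w) \<bullet> (y - z)))"
      using integrable_inner_left[OF smooth_avg_grad_integrable[OF r f, of z], of "y - z"] by simp
    have "smooth_avg_grad r f z \<bullet> (y - z) = (\<integral>w. f w * (kgrad r (z - w) \<bullet> (y - z)) \<partial>lborel)"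
      unfolding smooth_avg_grad_def
      using integral_inner_left[OF smooth_avg_grad_integrable[OF r f, of z], of "y - z"] by simp
    then have "smooth_avg r f y - smooth_avg r f z - smooth_avg_grad r f z \<bullet> (y - z) =
       (\<integral>w. kern r (y - w) * f w - kern r (z - w) * f w - f w * (kgrad r (z - w) \<bullet> (y - z)) \<partial>lborel)"
      using i1 i2 by (simp add: smooth_avg_def)
    also have "norm \<dots> \<le> (\<integral>w. norm (y - z) * \<eta> * norm (f w) \<partial>lborel)"
    proof (rule integral_norm_le_integral)
      fix w
      have "norm (kern r (y - w) - kern r (z - w) - kgrad r (z - w) \<bullet> (y - z)) * norm (f w)
         \<le> norm (y - z) * \<eta> * norm (f w)"
        using lin[of "y - w" "z - w"] that by (intro mult_right_mono) (auto simp: dist_norm)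
      then show "norm (kern r (y - w) * f w - kern r (z - w) * f w - f w * (kgrad r (z - w) \<bullet> (y - z)))
          \<le> norm (y - z) * \<eta> * norm (f w)"
        by (simp add: abs_mult[symmetric] algebra_simps)
    qed (use i1 i2 f in auto)
    also have "\<dots> = norm (y - z) * (\<eta> * N)" by (simp add: N_def)
    also have "\<dots> \<le> norm (y - z) * e"
      using \<open>e > 0\<close> \<open>N \<ge> 0\<close> by (intro mult_left_mono) (auto simp: \<eta>_def field_simps)
    finally show ?thesis by (simp add: mult.commute)
  qed
  with d(1) show "\<exists>d>0. \<forall>y. norm (y - z) < d \<longrightarrow>
     norm (smooth_avg r f y - smooth_avg r f z - smooth_avg_grad r f z \<bullet> (y - z)) \<le> e * norm (y - z)"
    by blast
qed

lemma kern_reflect: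
  fixes z :: "'b::euclidean_space"
  assumes "r > 0"
  shows "integrable lborel (\<lambda>w. kern r (z - w))" "(\<integral>w. kern r (z - w) \<partial>lborel) = 1"
proof -
  have m [measurable]: "kern r \<in> borel_measurable (borel :: 'b measure)"
    by (intro borel_measurable_continuous_onI kern_continuous_UNIV)
  have eq: "(lborel :: 'b measure) = distr lborel borel ((+) z)"
    by (simp add: lborel_distr_plus)
  show "integrable lborel (\<lambda>w. kern r (z - w))"
    by (subst eq, subst integrable_distr_eq) (auto simp: kern_uminus kern_integrable assms)
  show "(\<integral>w. kern r (z - w) \<partial>lborel) = 1"
    by (subst eq, subst integral_distr) (auto simp: kern_uminus kern_integral assms)
qed

text \<open>
  By Fubini: the kernel has mass one, so averaging does not increase the \<open>L\<^sup>1\<close> norm.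
\<close>

lemma smooth_avg_L1_bound:
  fixes f :: "'b::euclidean_space \<Rightarrow> 'c::{banach, second_countable_topology}"
  assumes r: "r > 0" and f: "integrable lborel f"
  shows "integrable lborel (smooth_avg r f)"
    and "(\<integral>z. norm (smooth_avg r f z) \<partial>lborel) \<le> (\<integral>z. norm (f z) \<partial>lborel)"
proof -
  let ?F = "\<lambda>(w, z). kern r (z - w) *\<^sub>R f w"
  have [measurable]: "f \<in> borel_measurable borel"
    using f by (simp add: borel_measurable_integrable)
  have [measurable]: "kern r \<in> borel_measurable (borel :: 'b measure)"
    by (intro borel_measurable_continuous_onI kern_continuous_UNIV)
  have shift: "integrable lborel (\<lambda>z. kern r (z - w))" "(\<integral>z. kern r (z - w) \<partial>lborel) = 1" for w :: 'b
    using kern_reflect[OF r, of w] kern_uminus[of r "_ - w"] by simp_all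
  have nrm: "(\<integral>z. norm (kern r (z - w) *\<^sub>R f w) \<partial>lborel) = norm (f w)" for w
    using shift[of w] by (simp add: kern_nonneg[OF r])
  have F: "integrable (lborel \<Otimes>\<^sub>M lborel) ?F"
  proof (rule lborel_pair.Fubini_integrable)
    show "integrable lborel (\<lambda>w. \<integral>z. norm (?F (w, z)) \<partial>lborel)"
      using f by (simp only: prod.case nrm integrable_norm)
    show "AE w in lborel. integrable lborel (\<lambda>z. ?F (w, z))"
      using shift by simp
  qed measurable
  have F': "integrable (lborel \<Otimes>\<^sub>M lborel) (\<lambda>(z, w). kern r (z - w) *\<^sub>R f w)"
    using lborel_pair.integrable_product_swap[OF F] by simp
  show "integrable lborel (smooth_avg r f)"
    using lborel_pair.integrable_fst'[OF F'] by (simp add: smooth_avg_def[abs_def])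
  have F'': "integrable (lborel \<Otimes>\<^sub>M lborel) (\<lambda>(z, w). norm (kern r (z - w) *\<^sub>R f w))"
    using integrable_norm[OF F'] by (simp add: split_beta')
  have "(\<integral>z. norm (smooth_avg r f z) \<partial>lborel) \<le> (\<integral>z. (\<integral>w. norm (kern r (z - w) *\<^sub>R f w) \<partial>lborel) \<partial>lborel)"
    using lborel_pair.integrable_fst'[OF F'']
    by (intro integral_mono) (auto simp: smooth_avg_def intro!: integrable_norm \<open>integrable lborel (smooth_avg r f)\<close>[unfolded smooth_avg_def[abs_def]] integral_norm_bound[THEN order_trans])
  also have "\<dots> = (\<integral>w. (\<integral>z. norm (kern r (z - w) *\<^sub>R f w) \<partial>lborel) \<partial>lborel)"
    by (rule lborel_pair.Fubini_integral[OF F'', symmetric])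
  also have "\<dots> = (\<integral>z. norm (f z) \<partial>lborel)" by (simp only: nrm)
  finally show "(\<integral>z. norm (smooth_avg r f z) \<partial>lborel) \<le> (\<integral>z. norm (f z) \<partial>lborel)" .
qed

lemma smooth_avg_add:
  assumes "r > 0" "integrable lborel f" "integrable lborel g"
  shows "smooth_avg r (\<lambda>x. f x + g x) z = smooth_avg r f z + smooth_avg r g z"
  using smooth_avg_integrable[OF assms(1,2)] smooth_avg_integrable[OF assms(1,3)]
  by (simp add: smooth_avg_def scaleR_add_right)

lemma smooth_avg_diff:
  assumes "r > 0" "integrable lborel f" "integrable lborel g"
  shows "smooth_avg r (\<lambda>x. f x - g x) z = smooth_avg r f z - smooth_avg r g z"
  using smooth_avg_integrable[OF assms(1,2)] smooth_avg_integrable[OF assms(1,3)]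
  by (simp add: smooth_avg_def scaleR_diff_right)

text \<open>
  The functions whose mollifications converge to them in \<open>L\<^sup>1\<close>. Since averaging is an
  \<open>L\<^sup>1\<close> contraction, this class is closed under \<open>L\<^sup>1\<close> limits. It contains the continuous functions
  with compact support, hence the indicators of closed sets of finite measure, hence, by inner
  regularity, those of measurable sets, and finally all integrable functions.
\<close>

definition L1_approximated :: "('b::euclidean_space \<Rightarrow> 'c::{banach, second_countable_topology}) \<Rightarrow> bool" where
  "L1_approximated f \<longleftrightarrow>
     integrable lborel f \<and> ((\<lambda>r. \<integral>z. norm (smooth_avg r f z - f z) \<partial>lborel) \<longlongrightarrow> 0) (at_right 0)"

text \<open>
  Closedness under \<open>L\<^sup>1\<close> limits, by the contraction property and the triangle inequality.
\<close>

lemma L1_approximatedI: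
  assumes f: "integrable lborel f"
    and "\<And>e. e > 0 \<Longrightarrow> \<exists>g. L1_approximated g \<and> (\<integral>z. norm (g z - f z) \<partial>lborel) < e"
  shows "L1_approximated f"
  unfolding L1_approximated_def
proof (intro conjI f tendstoI)
  fix e :: real assume "e > 0"
  then obtain g where g: "L1_approximated g" "(\<integral>z. norm (g z - f z) \<partial>lborel) < e / 3"
    using assms(2)[of "e / 3"] by auto
  then have "eventually (\<lambda>r. (\<integral>z. norm (smooth_avg r g z - g z) \<partial>lborel) < e / 3) (at_right 0)"
    using \<open>e > 0\<close> by (intro order_tendstoD[where y = 0]) (auto simp: L1_approximated_def)
  moreover have "eventually (\<lambda>r::real. r > 0) (at_right 0)"
    by (rule eventually_at_right_less)
  ultimately show "eventually (\<lambda>r. dist (\<integral>z. norm (smooth_avg r f z - f z) \<partial>lborel) 0 < e) (at_right 0)"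
  proof eventually_elim
    case (elim r)
    have g': "integrable lborel g" using g by (simp add: L1_approximated_def)
    note d = smooth_avg_L1_bound[OF elim(2) Bochner_Integration.integrable_diff[OF f g']]
    have "(\<integral>z. norm (smooth_avg r f z - f z) \<partial>lborel)
       \<le> (\<integral>z. norm (smooth_avg r (\<lambda>x. f x - g x) z) + norm (smooth_avg r g z - g z) + norm (g z - f z) \<partial>lborel)"
    proof (rule integral_mono)
      fix z
      have "smooth_avg r f z - f z
          = smooth_avg r (\<lambda>x. f x - g x) z + (smooth_avg r g z - g z) + (g z - f z)"
        by (simp add: smooth_avg_diff[OF elim(2) f g'])
      also have "norm \<dots> \<le> norm (smooth_avg r (\<lambda>x. f x - g x) z) + norm (smooth_avg r g z - g z) + norm (g z - f z)"
        using norm_triangle_ineq[of "smooth_avg r (\<lambda>x. f x - g x) z + (smooth_avg r g z - g z)" "g z - f z"]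
          norm_triangle_ineq[of "smooth_avg r (\<lambda>x. f x - g x) z" "smooth_avg r g z - g z"] by linarith
      finally show "norm (smooth_avg r f z - f z)
          \<le> norm (smooth_avg r (\<lambda>x. f x - g x) z) + norm (smooth_avg r g z - g z) + norm (g z - f z)" .
    qed (intro integrable_norm Bochner_Integration.integrable_add Bochner_Integration.integrable_diff
          smooth_avg_L1_bound f g' elim)+
    also have "\<dots> = (\<integral>z. norm (smooth_avg r (\<lambda>x. f x - g x) z) \<partial>lborel)
        + (\<integral>z. norm (smooth_avg r g z - g z) \<partial>lborel) + (\<integral>z. norm (g z - f z) \<partial>lborel)"
    proof -
      have "integrable lborel (\<lambda>z. norm (smooth_avg r (\<lambda>x. f x - g x) z))"
        "integrable lborel (\<lambda>z. norm (smooth_avg r g z - g z))" "integrable lborel (\<lambda>z. norm (g z - f z))"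
        by (intro integrable_norm Bochner_Integration.integrable_add Bochner_Integration.integrable_diff
          smooth_avg_L1_bound f g' elim)+
      then show ?thesis by simp
    qed
    also have "\<dots> < e"
      using d(2) elim(1) g(2) by (simp add: norm_minus_commute)
    finally show ?case by (simp add: dist_norm)
  qed
qed

lemma L1_approximated_dominated:
  fixes f :: "'b::euclidean_space \<Rightarrow> 'c::{banach, second_countable_topology}"
  assumes "\<And>i. L1_approximated (s i)" "\<And>x. (\<lambda>i. s i x) \<longlonglongrightarrow> f x"
    "\<And>i x. norm (s i x) \<le> w x" "integrable lborel w"
  shows "L1_approximated f"
proof (rule L1_approximatedI)
  have s: "integrable lborel (s i)" for i
    using assms(1) by (simp add: L1_approximated_def)
  then have [measurable]: "s i \<in> borel_measurable borel" for i
    by (simp add: borel_measurable_integrable)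
  have [measurable]: "f \<in> borel_measurable borel"
    by (rule borel_measurable_LIMSEQ_metric[OF _ assms(2)]) simp
  have le: "norm (f x) \<le> w x" for x
    by (rule tendsto_upperbound[OF tendsto_norm[OF assms(2)]]) (auto simp: assms)
  show f: "integrable lborel f"
    by (rule Bochner_Integration.integrable_bound[OF assms(4)]) (auto intro!: AE_I2 order_trans[OF le abs_ge_self])
  have "(\<lambda>i. \<integral>x. norm (s i x - f x) \<partial>lborel) \<longlonglongrightarrow> (\<integral>x. 0 \<partial>(lborel :: 'b measure))"
  proof (rule integral_dominated_convergence)
    show "integrable lborel (\<lambda>x. 2 * w x)" using assms(4) by simp
    show "AE x in lborel. (\<lambda>i. norm (s i x - f x)) \<longlonglongrightarrow> 0"
      using assms(2) by (auto intro!: tendsto_norm_zero simp: LIM_zero_iff)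
    show "AE x in lborel. norm (norm (s i x - f x)) \<le> 2 * w x" for i
    proof (rule AE_I2)
      fix x
      show "norm (norm (s i x - f x)) \<le> 2 * w x"
        using norm_triangle_ineq4[of "s i x" "f x"] assms(3)[of i x] le[of x] by simp
    qed
  qed simp_all
  then have "eventually (\<lambda>i. (\<integral>x. norm (s i x - f x) \<partial>lborel) < e) sequentially" if "e > 0" for e
    using that by (intro order_tendstoD[where y = 0]) auto
  then show "\<exists>g. L1_approximated g \<and> (\<integral>z. norm (g z - f z) \<partial>lborel) < e" if "e > 0" for e
    using that assms(1) eventually_happens[of _ sequentially] by fastforce
qed

lemma smooth_avg_cong_near:
  assumes "\<And>w. dist z w < r \<Longrightarrow> f w = g w" "r > 0"
  shows "smooth_avg r f z = smooth_avg r g z"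
  unfolding smooth_avg_def
proof (intro Bochner_Integration.integral_cong refl)
  fix w
  show "kern r (z - w) *\<^sub>R f w = kern r (z - w) *\<^sub>R g w"
    using assms kern_zero[OF \<open>r > 0\<close>, of "z - w"] by (cases "dist z w < r") (auto simp: dist_norm)
qed

lemma smooth_avg_dist_le:
  fixes z :: "'b::euclidean_space" and f :: "'b \<Rightarrow> 'c::{banach, second_countable_topology}"
  assumes r: "r > 0" and f: "integrable lborel f" and e: "\<And>w. dist z w < r \<Longrightarrow> norm (f w - f z) \<le> e"
  shows "norm (smooth_avg r f z - f z) \<le> e"
proof -
  have i: "integrable lborel (\<lambda>w. kern r (z - w) *\<^sub>R f z)"
    using kern_reflect[OF r, of z] by simp
  have "smooth_avg r f z - f z = (\<integral>w. kern r (z - w) *\<^sub>R f w - kern r (z - w) *\<^sub>R f z \<partial>lborel)"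
    using smooth_avg_integrable[OF r f, of z] i kern_reflect[OF r, of z]
    by (simp add: smooth_avg_def)
  also have "norm \<dots> \<le> (\<integral>w. kern r (z - w) * e \<partial>lborel)"
  proof (rule integral_norm_le_integral)
    show "norm (kern r (z - w) *\<^sub>R f w - kern r (z - w) *\<^sub>R f z) \<le> kern r (z - w) * e" for w
      using e[of w] kern_zero[OF r, of "z - w"] kern_nonneg[OF r, of "z - w"]
      by (cases "dist z w < r")
         (auto simp: dist_norm scaleR_diff_right[symmetric] intro!: mult_left_mono)
  qed (use smooth_avg_integrable[OF r f, of z] i kern_reflect[OF r, of z] in auto)
  also have "\<dots> = e" using kern_reflect[OF r, of z] by simp
  finally show ?thesis .
qed

text \<open>
  By uniform continuity the averages converge uniformly, and everything happens in a fixed ball.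
\<close>

lemma L1_approximated_continuous:
  fixes f :: "'b::euclidean_space \<Rightarrow> 'c::{banach, second_countable_topology}"
  assumes cont: "continuous_on UNIV f" and zero: "\<And>x. norm x \<ge> R \<Longrightarrow> f x = 0"
  shows "L1_approximated f"
  unfolding L1_approximated_def
proof (intro conjI tendstoI)
  show f: "integrable lborel f"
    by (rule integrable_continuous_compact_support[OF cont compact_cball[of 0 R]]) (use zero in auto)
  fix e :: real assume "e > 0"
  define m where "m = measure lborel (cball (0::'b) (R + 1))"
  define \<eta> where "\<eta> = e / (2 * (m + 1))"
  have "m \<ge> 0" by (simp add: m_def)
  then have "\<eta> > 0" using \<open>e > 0\<close> by (simp add: \<eta>_def)
  then obtain d where d: "d > 0" "\<And>x y. dist y x < d \<Longrightarrow> dist (f y) (f x) < \<eta>"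
    using uniformly_continuous_compact_support[OF cont zero] unfolding uniformly_continuous_on_def
    by (metis UNIV_I)
  have "eventually (\<lambda>r. 0 < r \<and> r < min d 1) (at_right (0::real))"
    using d(1) by (intro eventually_conj eventually_at_right_less eventually_at_rightI[of 0 "min d 1"]) auto
  then show "eventually (\<lambda>r. dist (\<integral>z. norm (smooth_avg r f z - f z) \<partial>lborel) 0 < e) (at_right 0)"
  proof eventually_elim
    case (elim r)
    have "(\<integral>z. norm (smooth_avg r f z - f z) \<partial>lborel)
        \<le> (\<integral>z. \<eta> * indicator (cball (0::'b) (R + 1)) z \<partial>lborel)"
    proof (rule integral_mono)
      fix z
      show "norm (smooth_avg r f z - f z) \<le> \<eta> * indicator (cball 0 (R + 1)) z"
      proof (cases "z \<in> cball 0 (R + 1)")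
        case True
        have "norm (smooth_avg r f z - f z) \<le> \<eta>"
          using elim d(2)[of _ z] by (intro smooth_avg_dist_le f) (auto simp: dist_norm norm_minus_commute intro: less_imp_le)
        with True show ?thesis by simp
      next
        case False
        have "smooth_avg r f z = smooth_avg r (\<lambda>_. 0) z"
        proof (rule smooth_avg_cong_near)
          fix w assume "dist z w < r"
          moreover have "norm z \<le> norm w + dist z w" by norm
          ultimately show "f w = 0" using False elim by (intro zero) auto
        qed (use elim in simp)
        then show ?thesis using False zero[of z] by (simp add: smooth_avg_def)
      qed
    next
      show "integrable lborel (\<lambda>z. norm (smooth_avg r f z - f z))"
        using smooth_avg_L1_bound(1)[OF _ f] f elim by auto
      show "integrable lborel (\<lambda>z. \<eta> * indicator (cball (0::'b) (R + 1)) z)"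
        using emeasure_lborel_cball_finite[of "0::'b" "R+1"]
        by (auto simp: top.not_eq_extremum intro!: integrable_real_indicator integrable_mult_right)
    qed
    also have "\<dots> = \<eta> * m" by (simp add: m_def)
    also have "\<dots> < e"
    proof -
      have "\<eta> * m = e * (m / (2 * (m + 1)))" by (simp add: \<eta>_def)
      also have "\<dots> < e * 1"
        using \<open>e > 0\<close> \<open>m \<ge> 0\<close> by (intro mult_strict_left_mono) auto
      finally show ?thesis by simp
    qed
    finally show ?case by (simp add: dist_norm)
  qed
qed


text \<open>
  On a compact set the indicator is the decreasing limit of the continuous functions
  \<open>max 0 (1 - i * infdist x K)\<close>; a closed set of finite measure is exhausted by compact ones.
\<close>

lemma L1_approximated_indicator_closed:
  fixes T :: "'b::euclidean_space set"
  assumes T: "closed T" "emeasure lborel T < \<infinity>"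
  shows "L1_approximated (\<lambda>x. indicator T x *\<^sub>R (c::'c::{banach, second_countable_topology}))"
proof (cases "T = {}")
  case True
  then show ?thesis
    using L1_approximated_continuous[of "\<lambda>_::'b. 0::'c" 0] by simp
next
  case False
  have cpt: "L1_approximated (\<lambda>x. indicator (T \<inter> cball 0 (real n)) x *\<^sub>R c)" for n :: nat
  proof (cases "T \<inter> cball 0 (real n) = {}")
    case True
    then show ?thesis
      using L1_approximated_continuous[of "\<lambda>_::'b. 0::'c" 0] by simp
  next
    case False
    define K where "K = T \<inter> cball 0 (real n)"
    have K: "closed K" "K \<noteq> {}" using T False by (auto simp: K_def)
    let ?g = "\<lambda>i x. max 0 (1 - real i * infdist x K) *\<^sub>R c"
    have 1: "?g (Suc i) x = 0" if "norm x \<ge> real n + 1" for i x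
    proof -
      have "1 \<le> infdist x K"
        unfolding infdist_def using K
      proof (simp, intro cINF_greatest K)
        fix y assume "y \<in> K"
        then have "norm y \<le> real n" by (simp add: K_def)
        moreover have "norm x \<le> norm y + dist x y" by norm
        ultimately show "1 \<le> dist x y" using that by linarith
      qed
      then have "1 * 1 \<le> real (Suc i) * infdist x K"
        by (intro mult_mono) auto
      then show ?thesis by simp
    qed
    have 2: "(\<lambda>i. ?g (Suc i) x) \<longlonglongrightarrow> indicator K x *\<^sub>R c" for x
    proof (cases "x \<in> K")
      case False
      then have "infdist x K > 0"
        using K infdist_pos_not_in_closed by blast
      then obtain N :: nat where N: "1 < real N * infdist x K"
        using reals_Archimedean3 by blast
      have "eventually (\<lambda>i. ?g (Suc i) x = 0) sequentially"
      proof (rule eventually_sequentiallyI[of N])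
        fix i assume "N \<le> i"
        then have "real N * infdist x K \<le> real (Suc i) * infdist x K"
          by (intro mult_right_mono) (auto simp: infdist_nonneg)
        with N show "?g (Suc i) x = 0" by simp
      qed
      with False show ?thesis by (simp add: tendsto_eventually)
    qed simp
    show ?thesis
      unfolding K_def[symmetric]
    proof (rule L1_approximated_dominated[where s = "\<lambda>i. ?g (Suc i)"
          and w = "\<lambda>x. norm c * indicator (cball 0 (real n + 1)) x"])
      show "L1_approximated (?g (Suc i))" for i
        by (rule L1_approximated_continuous[where R = "real n + 1"])
           (intro continuous_intros, rule 1)
      show "norm (?g (Suc i) x) \<le> norm c * indicator (cball 0 (real n + 1)) x" for i x
      proof (cases "norm x \<ge> real n + 1")
        case True
        then show ?thesis by (simp only: 1 norm_zero) (simp add: indicator_def)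
      next
        case False
        have "\<bar>max 0 (1 - real (Suc i) * infdist x K)\<bar> \<le> 1"
          by (auto simp: infdist_nonneg simp del: of_nat_Suc)
        then have "\<bar>max 0 (1 - real (Suc i) * infdist x K)\<bar> * norm c \<le> 1 * norm c"
          by (rule mult_right_mono) simp
        with False show ?thesis by (simp del: of_nat_Suc)
      qed
      show "integrable lborel (\<lambda>x::'b. norm c * indicator (cball 0 (real n + 1)) x)"
        using emeasure_lborel_cball_finite[of "0::'b" "real n + 1"]
        by (auto simp: top.not_eq_extremum intro!: integrable_real_indicator integrable_mult_right)
    qed (rule 2)
  qed
  show ?thesis
  proof (rule L1_approximated_dominated[where s = "\<lambda>n x. indicator (T \<inter> cball 0 (real n)) x *\<^sub>R c"
        and w = "\<lambda>x. norm c * indicator T x"])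
    show "(\<lambda>n. indicator (T \<inter> cball 0 (real n)) x *\<^sub>R c) \<longlonglongrightarrow> indicator T x *\<^sub>R c" for x
    proof -
      obtain N :: nat where "norm x \<le> real N" using real_arch_simple by blast
      then have "eventually (\<lambda>n. indicator (T \<inter> cball 0 (real n)) x *\<^sub>R c = indicator T x *\<^sub>R c) sequentially"
        by (intro eventually_sequentiallyI[of N]) (auto simp: indicator_def)
      then show ?thesis by (rule tendsto_eventually)
    qed
    show "integrable lborel (\<lambda>x. norm c * indicator T x)"
      using T by (auto intro!: integrable_mult_right integrable_real_indicator)
  qed (rule cpt, simp add: indicator_def)
qed

text \<open>
  Inner regularity reduces a measurable set to a closed subset of almost full measure.
\<close>

lemma L1_approximated_indicator:
  fixes A :: "'b::euclidean_space set"
  assumes A: "A \<in> sets lborel" "emeasure lborel A < \<infinity>"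
  shows "L1_approximated (\<lambda>x. indicator A x *\<^sub>R (c::'c::{banach, second_countable_topology}))"
proof (rule L1_approximatedI)
  show iA: "integrable lborel (\<lambda>x. indicator A x *\<^sub>R c)"
    using A by (intro integrable_scaleR_left integrable_real_indicator)
  fix e :: real assume "e > 0"
  define \<eta> where "\<eta> = e / (norm c + 1)"
  have "\<eta> > 0" using \<open>e > 0\<close> by (simp add: \<eta>_def add_nonneg_pos)
  obtain T where T: "closed T" "T \<subseteq> A" "emeasure lebesgue (A - T) < ennreal \<eta>"
    using sets_lebesgue_inner_closed[OF sets_completionI_sets[OF A(1)] \<open>\<eta> > 0\<close>] by metis
  have T': "T \<in> sets lborel" "emeasure lborel T < \<infinity>"
    unfolding sets_lborel by (rule borel_closed[OF T(1)], rule le_less_trans[OF emeasure_mono[OF T(2) A(1)] A(2)])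
  have d: "emeasure lborel (A - T) < ennreal \<eta>"
    using T(3) emeasure_completion[OF sets_completionI_sets[OF sets.Diff[OF A(1) T'(1)]]]
      main_part[OF sets.Diff[OF A(1) T'(1)]] by metis
  have "(\<integral>z. norm (indicator T z *\<^sub>R c - indicator A z *\<^sub>R c) \<partial>lborel) = (\<integral>z. norm c * indicator (A - T) z \<partial>lborel)"
    using T(2) by (intro Bochner_Integration.integral_cong) (auto simp: indicator_def)
  also have "\<dots> = norm c * measure lborel (A - T)"
    using A T' by simp
  also have "\<dots> \<le> norm c * \<eta>"
    using d \<open>\<eta> > 0\<close> by (intro mult_left_mono) (auto simp: measure_def enn2real_leI)
  also have "\<dots> < e"
  proof -
    have "norm c * \<eta> = e * (norm c / (norm c + 1))" by (simp add: \<eta>_def)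
    also have "\<dots> < e * 1"
      using \<open>e > 0\<close> by (intro mult_strict_left_mono) (auto simp: add_nonneg_pos)
    finally show ?thesis by simp
  qed
  finally show "\<exists>g. L1_approximated g \<and> (\<integral>z. norm (g z - indicator A z *\<^sub>R c) \<partial>lborel) < e"
    using L1_approximated_indicator_closed[OF T(1) T'(2)] by blast
qed

lemma integrable_imp_L1_approximated:
  assumes "integrable lborel f"
  shows "L1_approximated f"
  using assms
proof (induction rule: integrable_induct)
  case (base A c)
  then show ?case by (rule L1_approximated_indicator)
next
  case (add f g)
  have "((\<lambda>r. (\<integral>z. norm (smooth_avg r f z - f z) \<partial>lborel) + (\<integral>z. norm (smooth_avg r g z - g z) \<partial>lborel))
      \<longlongrightarrow> 0 + 0) (at_right 0)"
    using add by (intro tendsto_add) (auto simp: L1_approximated_def)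
  then have lim0: "((\<lambda>r. (\<integral>z. norm (smooth_avg r f z - f z) \<partial>lborel) + (\<integral>z. norm (smooth_avg r g z - g z) \<partial>lborel))
      \<longlongrightarrow> 0) (at_right 0)" by simp
  have "((\<lambda>r. \<integral>z. norm (smooth_avg r (\<lambda>x. f x + g x) z - (f z + g z)) \<partial>lborel) \<longlongrightarrow> 0) (at_right 0)"
  proof (rule Lim_null_comparison[OF _ lim0])
    show "eventually (\<lambda>r. norm (\<integral>z. norm (smooth_avg r (\<lambda>x. f x + g x) z - (f z + g z)) \<partial>lborel)
       \<le> (\<integral>z. norm (smooth_avg r f z - f z) \<partial>lborel) + (\<integral>z. norm (smooth_avg r g z - g z) \<partial>lborel)) (at_right 0)"
      using eventually_at_right_less[of 0]
    proof eventually_elim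
      case (elim r)
      have i: "integrable lborel (\<lambda>z. norm (smooth_avg r f z - f z))"
        "integrable lborel (\<lambda>z. norm (smooth_avg r g z - g z))"
        by (intro integrable_norm Bochner_Integration.integrable_diff smooth_avg_L1_bound elim add)+
      have "(\<integral>z. norm (smooth_avg r (\<lambda>x. f x + g x) z - (f z + g z)) \<partial>lborel)
         \<le> (\<integral>z. norm (smooth_avg r f z - f z) + norm (smooth_avg r g z - g z) \<partial>lborel)"
      proof (rule integral_mono)
        show "norm (smooth_avg r (\<lambda>x. f x + g x) z - (f z + g z))
           \<le> norm (smooth_avg r f z - f z) + norm (smooth_avg r g z - g z)" for z
          using norm_triangle_ineq[of "smooth_avg r f z - f z" "smooth_avg r g z - g z"]
          by (simp add: smooth_avg_add[OF elim add(1,2)] algebra_simps)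
      qed (intro integrable_norm Bochner_Integration.integrable_add Bochner_Integration.integrable_diff
             smooth_avg_L1_bound elim add)+
      then show ?case using i by simp
    qed
  qed
  then show ?case using add by (simp add: L1_approximated_def)
next
  \<comment> \<open>The approximations provided by the induction rule are dominated by \<open>2 * norm (f x)\<close>.\<close>
  case (lim f s)
  show ?case
  proof (rule L1_approximated_dominated)
    show "norm (s i x) \<le> 2 * norm (f x)" "(\<lambda>i. s i x) \<longlonglongrightarrow> f x" "L1_approximated (s i)" for i x
      using lim by simp_all
    show "integrable lborel (\<lambda>x. 2 * norm (f x))"
      using lim by (intro integrable_mult_right integrable_norm)
  qed
qed

lemma smooth_avg_tendsto_L1:
  assumes f: "integrable lborel f" and r: "\<And>n. r n > 0" "r \<longlonglongrightarrow> 0"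
  shows "(\<lambda>n. \<integral>z. norm (smooth_avg (r n) f z - f z) \<partial>lborel) \<longlonglongrightarrow> 0"
proof -
  have "filterlim r (at_right 0) sequentially"
    unfolding filterlim_at
  proof (intro conjI r always_eventually allI)
    show "r n \<in> {0<..}" "r n \<noteq> 0" for n using r(1)[of n] by simp_all
  qed
  moreover have "((\<lambda>r. \<integral>z. norm (smooth_avg r f z - f z) \<partial>lborel) \<longlongrightarrow> 0) (at_right 0)"
    using integrable_imp_L1_approximated[OF f] by (simp add: L1_approximated_def)
  ultimately show ?thesis
    by (rule filterlim_compose[rotated])
qed

section \<open>Integration by parts for regular functions\<close>

text \<open>
  Differentiability with the derivative represented by a vector: product and chain rule become
  rules for vectors, and continuity of the gradient can be expressed directly.
\<close>

definition has_grad :: "('b::euclidean_space \<Rightarrow> real) \<Rightarrow> 'b \<Rightarrow> 'b \<Rightarrow> bool" where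
  "has_grad f g z \<longleftrightarrow> (f has_derivative (\<lambda>v. g \<bullet> v)) (at z)"

lemma has_grad_mult:
  "has_grad f f' z \<Longrightarrow> has_grad g g' z \<Longrightarrow> has_grad (\<lambda>z. f z * g z) (f z *\<^sub>R g' + g z *\<^sub>R f') z"
  unfolding has_grad_def
  by (rule has_derivative_eq_rhs[OF has_derivative_mult]) (auto simp: fun_eq_iff inner_add_left mult.commute)

lemma has_grad_add:
  "has_grad f f' z \<Longrightarrow> has_grad g g' z \<Longrightarrow> has_grad (\<lambda>z. f z + g z) (f' + g') z"
  unfolding has_grad_def
  by (rule has_derivative_eq_rhs[OF has_derivative_add]) (auto simp: fun_eq_iff inner_add_left)

lemma has_grad_const: "has_grad (\<lambda>z. c) 0 z"
  unfolding has_grad_def by (rule has_derivative_eq_rhs[OF has_derivative_const]) (auto simp: fun_eq_iff)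

lemma has_grad_compose:
  assumes "has_grad f f' z" "(h has_real_derivative h') (at (f z))"
  shows "has_grad (\<lambda>z. h (f z)) (h' *\<^sub>R f') z"
  unfolding has_grad_def
  by (rule has_derivative_eq_rhs[OF has_derivative_compose[OF assms(1)[unfolded has_grad_def]
      assms(2)[THEN has_field_derivative_imp_has_derivative]]]) (auto simp: fun_eq_iff)

lemma has_grad_continuous:
  "(\<And>z. has_grad f (f' z) z) \<Longrightarrow> continuous_on UNIV f"
  unfolding has_grad_def
  by (intro continuous_at_imp_continuous_on ballI has_derivative_continuous)

lemma has_grad_zero_off_closed:
  assumes "has_grad f g z" "closed S" "\<And>x. x \<notin> S \<Longrightarrow> f x = 0" "z \<notin> S"
  shows "g = 0"
proof -
  have "((\<lambda>_. 0::real) has_derivative (\<lambda>v. g \<bullet> v)) (at z)"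
    using assms(1) unfolding has_grad_def
    by (rule has_derivative_transform_within_open[where s = "- S"]) (use assms in auto)
  then have "(\<lambda>v. g \<bullet> v) = (\<lambda>v. 0)"
    by (rule has_derivative_unique[OF _ has_derivative_const])
  then have "g \<bullet> g = 0" by metis
  then show ?thesis by simp
qed

lemma has_grad_lipschitz:
  assumes "\<And>z. has_grad f (g z) z" "\<And>z. norm (g z) \<le> M"
  shows "\<bar>f x - f y\<bar> \<le> M * norm (x - y)"
proof -
  have "norm (f x - f y) \<le> M * norm (x - y)"
  proof (rule differentiable_bound[where S = UNIV and f' = "\<lambda>z v. g z \<bullet> v"])
    show "onorm (\<lambda>v. g z \<bullet> v) \<le> M" for z
    proof (rule onorm_bound)
      show "0 \<le> M" using assms(2)[of 0] norm_ge_zero order_trans by blast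
      show "norm (g z \<bullet> v) \<le> M * norm v" for v
        using Cauchy_Schwarz_ineq2[of "g z" v] mult_right_mono[OF assms(2)[of z], of "norm v"]
        by simp
    qed
  qed (use assms(1) in \<open>auto simp: has_grad_def intro: has_derivative_at_withinI\<close>)
  then show ?thesis by simp
qed

text \<open>
  By translation invariance the integral of every difference quotient vanishes, and the quotients
  converge boundedly to the directional derivative.
\<close>

lemma integral_directional_derivative_eq_0:
  fixes \<Phi> :: "'b::euclidean_space \<Rightarrow> real"
  assumes grad: "\<And>z. has_grad \<Phi> (g z) z" and cont: "continuous_on UNIV g"
    and S: "compact S" "\<And>z. z \<notin> S \<Longrightarrow> \<Phi> z = 0"
  shows "integrable lborel (\<lambda>z. g z \<bullet> e)" "(\<integral>z. g z \<bullet> e \<partial>lborel) = 0"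
proof -
  have g0: "g z = 0" if "z \<notin> S" for z
    using has_grad_zero_off_closed[OF grad compact_imp_closed[OF S(1)] S(2) that] by blast
  show "integrable lborel (\<lambda>z. g z \<bullet> e)"
    by (rule integrable_continuous_compact_support[OF _ S(1)]) (use g0 in \<open>auto intro!: continuous_intros cont\<close>)
  have contP: "continuous_on UNIV \<Phi>" by (rule has_grad_continuous[OF grad])
  obtain M where M: "0 < M" "\<And>z. norm (g z) \<le> M"
    using bounded_continuous_compact_support[OF cont S(1) g0] by blast
  \<comment> \<open>All the difference quotients used below are supported in \<open>S \<union> T\<close>.\<close>
  define T where "T = (\<lambda>(x, t). x - t *\<^sub>R e) ` (S \<times> {0..1})"
  have "compact T"
    unfolding T_def
    by (intro compact_continuous_image compact_Times S compact_Icc)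
       (auto intro!: continuous_intros simp: split_beta')
  define s where "s n = 1 / real (Suc n)" for n
  have s: "0 < s n" "s n \<le> 1" for n by (auto simp: s_def)
  let ?q = "\<lambda>n z. (\<Phi> (z + s n *\<^sub>R e) - \<Phi> z) / s n"
  have [measurable]: "\<Phi> \<in> borel_measurable borel" "g \<in> borel_measurable borel"
    using contP cont by (auto intro: borel_measurable_continuous_onI)
  have iP: "integrable lborel \<Phi>"
    by (rule integrable_continuous_compact_support[OF contP S])
  have iPs: "integrable lborel (\<lambda>z. \<Phi> (z + c))" "(\<integral>z. \<Phi> (z + c) \<partial>lborel) = (\<integral>z. \<Phi> z \<partial>lborel)" for c
  proof -
    have eq: "(lborel :: 'b measure) = distr lborel borel ((+) c)"
      by (simp add: lborel_distr_plus)
    have "integrable (distr lborel borel ((+) c)) \<Phi>" using iP eq by metis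
    then show "integrable lborel (\<lambda>z. \<Phi> (z + c))"
      by (subst (asm) integrable_distr_eq) (auto simp: add.commute)
    have "(\<integral>z. \<Phi> z \<partial>distr lborel borel ((+) c)) = (\<integral>z. \<Phi> (z + c) \<partial>lborel)"
      by (subst integral_distr) (auto simp: add.commute)
    then show "(\<integral>z. \<Phi> (z + c) \<partial>lborel) = (\<integral>z. \<Phi> z \<partial>lborel)"
      using eq by simp
  qed
  have "(\<lambda>n. \<integral>z. ?q n z \<partial>lborel) \<longlonglongrightarrow> (\<integral>z. g z \<bullet> e \<partial>lborel)"
  proof (rule integral_dominated_convergence)
    show "integrable lborel (\<lambda>z. M * norm e * indicator (S \<union> T) z)"
      using \<open>compact T\<close> S(1)
      by (intro integrable_mult_right integrable_real_indicator)
         (use emeasure_compact_finite[of "S \<union> T"] in \<open>auto simp: compact_Un compact_imp_closed borel_closed\<close>)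
    show "AE z in lborel. (\<lambda>n. ?q n z) \<longlonglongrightarrow> g z \<bullet> e"
    proof (rule AE_I2)
      fix z
      have "((\<lambda>t. z + t *\<^sub>R e) has_derivative (\<lambda>t. t *\<^sub>R e)) (at 0)"
        by (auto intro!: derivative_eq_intros)
      from has_derivative_compose[OF this, of \<Phi> "\<lambda>v. g z \<bullet> v"]
      have "((\<lambda>t. \<Phi> (z + t *\<^sub>R e)) has_derivative (\<lambda>t. t * (g z \<bullet> e))) (at 0)"
        using grad[of z] by (simp add: has_grad_def)
      then have "((\<lambda>t. \<Phi> (z + t *\<^sub>R e)) has_real_derivative (g z \<bullet> e)) (at 0)"
        by (simp add: has_field_derivative_def mult_commute_abs)
      then have lim: "((\<lambda>h. (\<Phi> (z + h *\<^sub>R e) - \<Phi> z) / h) \<longlongrightarrow> g z \<bullet> e) (at 0)"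
        by (simp add: DERIV_def)
      have "filterlim s (at 0) sequentially"
        unfolding filterlim_at
      proof (intro conjI always_eventually allI)
        show "s \<longlonglongrightarrow> 0" unfolding s_def[abs_def] by (rule LIMSEQ_Suc[OF lim_1_over_n])
        show "s n \<in> UNIV" "s n \<noteq> 0" for n using s(1)[of n] by simp_all
      qed
      from filterlim_compose[OF lim this] show "(\<lambda>n. ?q n z) \<longlonglongrightarrow> g z \<bullet> e" .
    qed
    show "AE z in lborel. norm (?q n z) \<le> M * norm e * indicator (S \<union> T) z" for n
    proof (rule AE_I2)
      fix z
      show "norm (?q n z) \<le> M * norm e * indicator (S \<union> T) z"
      proof (cases "z \<in> S \<union> T")
        case True
        have "\<bar>\<Phi> (z + s n *\<^sub>R e) - \<Phi> z\<bar> \<le> M * norm e * s n"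
          using has_grad_lipschitz[OF grad M(2), of "z + s n *\<^sub>R e" z] s(1)[of n] by (simp add: mult_ac)
        then show ?thesis
          using True s(1)[of n] by (simp add: field_simps)
      next
        case False
        have "z + s n *\<^sub>R e \<notin> S"
        proof
          assume "z + s n *\<^sub>R e \<in> S"
          then have "z \<in> T"
            unfolding T_def using s[of n]
            by (intro image_eqI[of _ _ "(z + s n *\<^sub>R e, s n)"]) auto
          with False show False by simp
        qed
        with False S(2) show ?thesis by simp
      qed
    qed
  qed measurable
  moreover have "(\<integral>z. ?q n z \<partial>lborel) = 0" for n
    using iP iPs[of "s n *\<^sub>R e"] by simp
  ultimately show "(\<integral>z. g z \<bullet> e \<partial>lborel) = 0"
    by (simp only: LIMSEQ_const_iff)
qed

lemma smooth_avg_inner: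
  fixes f :: "'b::euclidean_space \<Rightarrow> 'c::euclidean_space"
  assumes "r > 0" "integrable lborel f"
  shows "smooth_avg r (\<lambda>w. f w \<bullet> m) z = smooth_avg r f z \<bullet> m"
  unfolding smooth_avg_def
  using integral_inner_left[OF smooth_avg_integrable[OF assms, of z], of m] by simp

lemma smooth_avg_nonneg:
  assumes "r > 0" "\<And>w. 0 \<le> f w"
  shows "0 \<le> (smooth_avg r f z :: real)"
  unfolding smooth_avg_def using assms by (intro Bochner_Integration.integral_nonneg) (auto simp: kern_nonneg)

lemma smooth_avg_has_grad:
  "r > 0 \<Longrightarrow> integrable lborel f \<Longrightarrow> has_grad (smooth_avg r f) (smooth_avg_grad r f z) z"
  unfolding has_grad_def by (rule smooth_avg_has_derivative)

text \<open>
  For regular functions the energy inequality holds pointwise up to derivatives: multiply the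
  differential inequality \<open>eq\<close> by \<open>\<zeta> v powr (- a)\<close>; what is left over are
  directional derivatives of \<open>\<zeta> v powr (- a) A\<close> and of \<open>\<zeta> v powr (1 - a) / (1 - a)\<close>, which have compact support and integrate to zero. Since the power of \<open>v\<close> is negative, the gradient of the
  test function contributes the term with \<open>A \<bullet> X\<close> on the favourable side.
\<close>

lemma mollified_energy:
  fixes u W \<zeta> :: "'a::euclidean_space \<times> real \<Rightarrow> real" and A X :: "'a \<times> real \<Rightarrow> 'a"
  assumes r: "r > 0" and int: "integrable lborel u" "integrable lborel W" "integrable lborel A" "integrable lborel X"
    and u0: "\<And>z. 0 \<le> u z"
    and grad: "\<And>z. has_grad \<zeta> (\<zeta>' z) z" and cont: "continuous_on UNIV \<zeta>'"
    and S: "compact S" "\<And>z. z \<notin> S \<Longrightarrow> \<zeta> z = 0" and \<zeta>0: "\<And>z. 0 \<le> \<zeta> z"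
    and eq: "\<And>z. z \<in> S \<Longrightarrow> smooth_avg r W z \<le>
        - (\<Sum>i\<in>Basis. smooth_avg_grad r (\<lambda>w. A w \<bullet> i) z \<bullet> (i, 0)) + smooth_avg_grad r u z \<bullet> (0, 1)"
    and gx: "\<And>z i. z \<in> S \<Longrightarrow> i \<in> Basis \<Longrightarrow> smooth_avg_grad r u z \<bullet> (i, 0) = smooth_avg r X z \<bullet> i"
    and \<epsilon>: "\<epsilon> > 0" and a: "0 < a" "a < 1"
  defines "v \<equiv> \<lambda>z. smooth_avg r u z + \<epsilon>"
  shows "(\<integral>z. smooth_avg r W z * \<zeta> z * v z powr (- a)
     + a * \<zeta> z * v z powr (- a - 1) * (smooth_avg r A z \<bullet> smooth_avg r X z)
     - v z powr (- a) * (smooth_avg r A z \<bullet> fst (\<zeta>' z))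
     + snd (\<zeta>' z) * (v z powr (1 - a) / (1 - a)) \<partial>lborel) \<le> 0"
proof -
  have vpos: "v z > 0" for z
    using smooth_avg_nonneg[where f = u and z = z, OF r u0] \<epsilon> by (simp add: v_def)
  define v' where "v' = smooth_avg_grad r u"
  have gv: "has_grad v (v' z) z" for z
    using has_grad_add[OF smooth_avg_has_grad[OF r int(1)] has_grad_const[of \<epsilon>]] by (simp add: v_def v'_def)
  have iA: "integrable lborel (\<lambda>w. A w \<bullet> i)" for i using int(3) by simp
  have gpow: "has_grad (\<lambda>z. v z powr b) ((b * v z powr (b - 1)) *\<^sub>R v' z) z" for b z
    by (rule has_grad_compose[OF gv, where h = "\<lambda>y. y powr b"])
       (use vpos[of z] in \<open>auto intro!: derivative_eq_intros\<close>)
  have cu: "continuous_on UNIV v" by (rule has_grad_continuous[OF gv])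
  have cv': "continuous_on UNIV v'" unfolding v'_def by (rule smooth_avg_grad_continuous[OF r int(1)])
  have cpow: "continuous_on UNIV (\<lambda>z. v z powr b)" for b by (rule has_grad_continuous[OF gpow])
  have c\<zeta>: "continuous_on UNIV \<zeta>" by (rule has_grad_continuous[OF grad])
  note cavg = smooth_avg_continuous[OF r int(2)] smooth_avg_continuous[OF r int(3)]
    smooth_avg_continuous[OF r int(4)] smooth_avg_continuous[OF r iA]
  have \<zeta>'0: "\<zeta>' z = 0" if "z \<notin> S" for z
    using has_grad_zero_off_closed[OF grad compact_imp_closed[OF S(1)] S(2) that] by blast
  define \<Phi> where "\<Phi> i z = \<zeta> z * v z powr (- a) * smooth_avg r (\<lambda>w. A w \<bullet> i) z" for i z
  define \<Phi>' where "\<Phi>' i z = (\<zeta> z * v z powr (- a)) *\<^sub>R smooth_avg_grad r (\<lambda>w. A w \<bullet> i) z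
      + smooth_avg r (\<lambda>w. A w \<bullet> i) z *\<^sub>R
          (\<zeta> z *\<^sub>R ((- a * v z powr (- a - 1)) *\<^sub>R v' z) + (v z powr (- a)) *\<^sub>R \<zeta>' z)" for i z
  have \<Phi>: "has_grad (\<Phi> i) (\<Phi>' i z) z" for i z
    unfolding \<Phi>_def[abs_def] \<Phi>'_def
    by (intro has_grad_mult grad gpow smooth_avg_has_grad r iA)
  have c\<Phi>: "continuous_on UNIV (\<Phi>' i)" for i
    unfolding \<Phi>'_def[abs_def]
    by (intro continuous_intros c\<zeta> cpow cv' cont cavg smooth_avg_grad_continuous[OF r iA])
  have I\<Phi>: "integrable lborel (\<lambda>z. \<Phi>' i z \<bullet> e)" "(\<integral>z. \<Phi>' i z \<bullet> e \<partial>lborel) = 0" for i e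
    using integral_directional_derivative_eq_0[OF \<Phi> c\<Phi> S(1)] S(2) by (auto simp: \<Phi>_def)
  define \<Psi> where "\<Psi> z = \<zeta> z * (v z powr (1 - a) * (1 / (1 - a)))" for z
  define \<Psi>' where "\<Psi>' z = \<zeta> z *\<^sub>R (v z powr (1 - a) *\<^sub>R 0 + (1 / (1 - a)) *\<^sub>R (((1 - a) * v z powr (1 - a - 1)) *\<^sub>R v' z))
      + (v z powr (1 - a) * (1 / (1 - a))) *\<^sub>R \<zeta>' z" for z
  have \<Psi>: "has_grad \<Psi> (\<Psi>' z) z" for z
    unfolding \<Psi>_def[abs_def] \<Psi>'_def
    by (intro has_grad_mult grad gpow has_grad_const)
  have c\<Psi>: "continuous_on UNIV \<Psi>'"
    unfolding \<Psi>'_def[abs_def]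
    by (intro continuous_intros c\<zeta> cpow cv' cont) (use a in auto)
  have I\<Psi>: "integrable lborel (\<lambda>z. \<Psi>' z \<bullet> e)" "(\<integral>z. \<Psi>' z \<bullet> e \<partial>lborel) = 0" for e
    using integral_directional_derivative_eq_0[OF \<Psi> c\<Psi> S(1)] S(2) by (auto simp: \<Psi>_def)
  let ?L = "\<lambda>z. smooth_avg r W z * \<zeta> z * v z powr (- a)
     + a * \<zeta> z * v z powr (- a - 1) * (smooth_avg r A z \<bullet> smooth_avg r X z)
     - v z powr (- a) * (smooth_avg r A z \<bullet> fst (\<zeta>' z))
     + snd (\<zeta>' z) * (v z powr (1 - a) / (1 - a))"
  let ?R = "\<lambda>z. \<Psi>' z \<bullet> (0, 1) - (\<Sum>i\<in>Basis. \<Phi>' i z \<bullet> (i, 0))"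
  have "(\<integral>z. ?L z \<partial>lborel) \<le> (\<integral>z. ?R z \<partial>lborel)"
  proof (rule integral_mono)
    show "integrable lborel ?L"
    proof (rule integrable_continuous_compact_support[OF _ S(1)])
      show "continuous_on UNIV ?L"
        using a by (intro continuous_on_add continuous_on_diff continuous_on_mult continuous_on_inner
            continuous_on_divide continuous_on_const continuous_on_fst continuous_on_snd
            c\<zeta> cpow cont cavg ballI) simp
      show "?L z = 0" if "z \<notin> S" for z
        using S(2)[OF that] \<zeta>'0[OF that] by simp
    qed
    show "integrable lborel ?R"
      by (intro Bochner_Integration.integrable_diff Bochner_Integration.integrable_sum I\<Phi> I\<Psi>)
    fix z :: "'a \<times> real"
    show "?L z \<le> ?R z"
    proof (cases "z \<in> S")
      case False
      then show ?thesis
        using S(2)[of z] \<zeta>'0[of z] by (simp add: \<Psi>'_def \<Phi>'_def)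
    next
      case True
      have 1: "\<Phi>' i z \<bullet> (i, 0) = (\<zeta> z * v z powr (- a)) * (smooth_avg_grad r (\<lambda>w. A w \<bullet> i) z \<bullet> (i, 0))
         - a * \<zeta> z * v z powr (- a - 1) * ((smooth_avg r A z \<bullet> i) * (smooth_avg r X z \<bullet> i))
         + v z powr (- a) * ((smooth_avg r A z \<bullet> i) * (fst (\<zeta>' z) \<bullet> i))" if "i \<in> Basis" for i
      proof -
        have z1: "\<zeta>' z \<bullet> (i, 0) = fst (\<zeta>' z) \<bullet> i" by (simp add: inner_prod_def)
        have z2: "v' z \<bullet> (i, 0) = smooth_avg r X z \<bullet> i" unfolding v'_def by (rule gx[OF True that])
        show ?thesis
          unfolding \<Phi>'_def inner_add_left inner_scaleR_left z1 z2 smooth_avg_inner[OF r int(3)]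
          by (simp add: algebra_simps)
      qed
      have 2: "(\<Sum>i\<in>Basis. \<Phi>' i z \<bullet> (i, 0)) =
          (\<zeta> z * v z powr (- a)) * (\<Sum>i\<in>Basis. smooth_avg_grad r (\<lambda>w. A w \<bullet> i) z \<bullet> (i, 0))
         - a * \<zeta> z * v z powr (- a - 1) * (smooth_avg r A z \<bullet> smooth_avg r X z)
         + v z powr (- a) * (smooth_avg r A z \<bullet> fst (\<zeta>' z))"
      proof -
        have lin: "(\<Sum>i\<in>Basis. c * g i - d * (y \<bullet> i * (x \<bullet> i)) + e * (y \<bullet> i * (w \<bullet> i)))
            = c * (\<Sum>i\<in>Basis. g i) - d * (y \<bullet> x) + e * (y \<bullet> w)" for c d e g and x y w :: 'a
          by (subst (1 2) euclidean_inner) (simp only: sum_distrib_left sum.distrib sum_subtractf)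
        show ?thesis
          by (subst lin[symmetric], rule sum.cong[OF refl 1])
      qed
      have 3: "\<Psi>' z \<bullet> (0, 1) = \<zeta> z * v z powr (- a) * (v' z \<bullet> (0, 1)) + snd (\<zeta>' z) * (v z powr (1 - a) / (1 - a))"
      proof -
        have z1: "\<zeta>' z \<bullet> (0, 1) = snd (\<zeta>' z)" by (simp add: inner_prod_def)
        show ?thesis
          unfolding \<Psi>'_def inner_add_left inner_scaleR_left z1 using a by simp
      qed
      have "smooth_avg r W z * (\<zeta> z * v z powr (- a)) \<le>
        (- (\<Sum>i\<in>Basis. smooth_avg_grad r (\<lambda>w. A w \<bullet> i) z \<bullet> (i, 0)) + v' z \<bullet> (0, 1)) * (\<zeta> z * v z powr (- a))"
        unfolding v'_def by (intro mult_right_mono eq[OF True] mult_nonneg_nonneg \<zeta>0) simp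
      then show ?thesis
        unfolding 2 3 by (simp add: algebra_simps)
    qed
  qed
  also have "(\<integral>z. ?R z \<partial>lborel) = 0"
    by (simp add: I\<Phi> I\<Psi>)
  finally show ?thesis .
qed

section \<open>The energy inequality\<close>

text \<open>
  Convergence in \<open>L\<^sup>1\<close> of one factor and bounded convergence almost everywhere of the other
  suffice to pass to the limit in the integral of a product.
\<close>

lemma tendsto_integral_inner:
  fixes f :: "nat \<Rightarrow> 'x \<Rightarrow> 'c::euclidean_space"
  assumes int: "\<And>n. integrable M (f n)" "integrable M g"
    and L1: "(\<lambda>n. \<integral>x. norm (f n x - g x) \<partial>M) \<longlonglongrightarrow> 0"
    and meas: "\<And>n. c n \<in> borel_measurable M" "d \<in> borel_measurable M"
    and bound: "\<And>n x. norm (c n x) \<le> B" and lim: "AE x in M. (\<lambda>n. c n x) \<longlonglongrightarrow> d x"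
  shows "\<And>n. integrable M (\<lambda>x. c n x \<bullet> f n x)" "integrable M (\<lambda>x. d x \<bullet> g x)"
    "(\<lambda>n. \<integral>x. c n x \<bullet> f n x \<partial>M) \<longlonglongrightarrow> (\<integral>x. d x \<bullet> g x \<partial>M)"
proof -
  note [measurable] = meas
  have [measurable]: "f n \<in> borel_measurable M" "g \<in> borel_measurable M" for n
    using int by (auto simp: borel_measurable_integrable)
  have cb: "\<bar>c n x \<bullet> y\<bar> \<le> B * norm y" for n x y
    using Cauchy_Schwarz_ineq2[of "c n x" y] mult_right_mono[OF bound[of n x], of "norm y"] by simp
  have i: "integrable M (\<lambda>x. c n x \<bullet> h x)" if "integrable M h" for h n
  proof (rule Bochner_Integration.integrable_bound)
    show "integrable M (\<lambda>x. B * norm (h x))" using that by simp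
    have [measurable]: "h \<in> borel_measurable M" using that by (simp add: borel_measurable_integrable)
    show "(\<lambda>x. c n x \<bullet> h x) \<in> borel_measurable M" by measurable
    show "AE x in M. norm (c n x \<bullet> h x) \<le> norm (B * norm (h x))"
      by (rule AE_I2, unfold real_norm_def, rule order_trans[OF cb abs_ge_self])
  qed
  show "integrable M (\<lambda>x. c n x \<bullet> f n x)" for n by (rule i[OF int(1)])
  have D: "integrable M (\<lambda>x. B * norm (g x))" using int(2) by simp
  have Dl: "AE x in M. (\<lambda>n. c n x \<bullet> g x) \<longlonglongrightarrow> d x \<bullet> g x"
    using lim by eventually_elim (intro tendsto_inner tendsto_const)
  have Db: "AE x in M. norm (c n x \<bullet> g x) \<le> B * norm (g x)" for n
    using cb by simp
  show "integrable M (\<lambda>x. d x \<bullet> g x)"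
    by (rule integrable_dominated_convergence[OF _ _ D Dl Db]) measurable
  have 1: "(\<lambda>n. \<integral>x. c n x \<bullet> g x \<partial>M) \<longlonglongrightarrow> (\<integral>x. d x \<bullet> g x \<partial>M)"
    by (rule integral_dominated_convergence[OF _ _ D Dl Db]) measurable
  have 2: "(\<lambda>n. \<integral>x. c n x \<bullet> (f n x - g x) \<partial>M) \<longlonglongrightarrow> 0"
  proof (rule Lim_null_comparison)
    show "(\<lambda>n. B * (\<integral>x. norm (f n x - g x) \<partial>M)) \<longlonglongrightarrow> 0"
      using tendsto_mult_left[OF L1, of B] by simp
    show "eventually (\<lambda>n. norm (\<integral>x. c n x \<bullet> (f n x - g x) \<partial>M) \<le> B * (\<integral>x. norm (f n x - g x) \<partial>M)) sequentially"
    proof (intro always_eventually allI)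
      fix n
      have "norm (\<integral>x. c n x \<bullet> (f n x - g x) \<partial>M) \<le> (\<integral>x. B * norm (f n x - g x) \<partial>M)"
        by (rule integral_norm_le_integral) (use i int cb in auto)
      then show "norm (\<integral>x. c n x \<bullet> (f n x - g x) \<partial>M) \<le> B * (\<integral>x. norm (f n x - g x) \<partial>M)"
        by simp
    qed
  qed
  have "(\<integral>x. c n x \<bullet> (f n x - g x) \<partial>M) + (\<integral>x. c n x \<bullet> g x \<partial>M) = (\<integral>x. c n x \<bullet> f n x \<partial>M)" for n
    using i int by (simp add: inner_diff_right)
  with tendsto_add[OF 2 1]
  show "(\<lambda>n. \<integral>x. c n x \<bullet> f n x \<partial>M) \<longlonglongrightarrow> (\<integral>x. d x \<bullet> g x \<partial>M)" by simp
qed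

text \<open>
  Since \<open>s powr (p - 1)\<close> is increasing in \<open>s\<close>, the product
  \<open>(s powr (p - 1) - t powr (p - 1)) * (s - t)\<close> is nonnegative; apply this to \<open>s = norm x\<close> and
  \<open>t = norm m\<close> together with the Cauchy-Schwarz inequality. The point of the form chosen here is that
  it is affine in \<open>norm x powr p\<close> and \<open>x\<close> on the right, so that it can be averaged.
\<close>

lemma flux_lower_bound:
  fixes x m :: "'a::real_inner"
  assumes p: "p > 1"
  shows "- (norm x powr (p - 2) * (x \<bullet> m)) \<le> norm x powr p - norm m powr (p - 2) * (x \<bullet> m) + norm m powr p"
proof (cases "x = 0 \<or> m = 0")
  case True
  then show ?thesis by auto
next
  case False
  define s t where "s = norm x" and "t = norm m"
  have st: "s > 0" "t > 0" using False by (auto simp: s_def t_def)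
  have cs: "\<bar>x \<bullet> m\<bar> \<le> s * t" unfolding s_def t_def by (rule Cauchy_Schwarz_ineq2)
  have pw: "y powr (p - 2) * y = y powr (p - 1)" "y powr (p - 1) * y = y powr p" if "y > 0" for y :: real
  proof -
    show "y powr (p - 2) * y = y powr (p - 1)"
      using powr_mult_base[of y "p - 2"] that by (simp add: mult.commute)
    show "y powr (p - 1) * y = y powr p"
      using powr_mult_base[of y "p - 1"] that by (simp add: mult.commute)
  qed
  have 1: "- (s powr (p - 2) * (x \<bullet> m)) \<le> s powr (p - 1) * t"
  proof -
    have "s powr (p - 2) * (- (x \<bullet> m)) \<le> s powr (p - 2) * (s * t)"
      using cs by (intro mult_left_mono) auto
    also have "\<dots> = s powr (p - 1) * t" using pw(1)[OF st(1)] by (simp add: mult.assoc[symmetric])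
    finally show ?thesis by simp
  qed
  have 2: "t powr (p - 2) * (x \<bullet> m) \<le> t powr (p - 1) * s"
  proof -
    have "t powr (p - 2) * (x \<bullet> m) \<le> t powr (p - 2) * (t * s)"
      using cs by (intro mult_left_mono) (auto simp: mult.commute)
    also have "\<dots> = t powr (p - 1) * s" using pw(1)[OF st(2)] by (simp add: mult.assoc[symmetric])
    finally show ?thesis .
  qed
  have "0 \<le> (s powr (p - 1) - t powr (p - 1)) * (s - t)"
  proof (cases "s \<le> t")
    case True
    then have "s powr (p - 1) \<le> t powr (p - 1)"
      using st p by (intro powr_mono2) auto
    with True show ?thesis by (intro mult_nonpos_nonpos) auto
  next
    case False
    then have "t powr (p - 1) \<le> s powr (p - 1)"
      using st p by (intro powr_mono2) auto
    with False show ?thesis by (intro mult_nonneg_nonneg) auto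
  qed
  then have 3: "s powr (p - 1) * t + t powr (p - 1) * s \<le> s powr p + t powr p"
    using pw(2)[OF st(1)] pw(2)[OF st(2)] by (simp add: algebra_simps)
  show ?thesis using 1 2 3 unfolding s_def t_def by linarith
qed

text \<open>
  Average the preceding inequality with \<open>m\<close> the average of \<open>X\<close>: the last two terms cancel,
  because the average of \<open>X \<bullet> m\<close> is the square of \<open>norm m\<close>. This replaces an appeal to
  Hoelder's inequality.
\<close>

lemma smooth_avg_flux_lower_bound:
  fixes X :: "'b::euclidean_space \<Rightarrow> 'a::euclidean_space"
  assumes p: "p > 1" and r: "r > 0"
    and int: "integrable lborel X" "integrable lborel (\<lambda>w. norm (X w) powr (p - 2) *\<^sub>R X w)"
      "integrable lborel (\<lambda>w. norm (X w) powr p)"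
  shows "- (smooth_avg r (\<lambda>w. norm (X w) powr (p - 2) *\<^sub>R X w) z \<bullet> smooth_avg r X z)
     \<le> smooth_avg r (\<lambda>w. norm (X w) powr p) z"
proof -
  define m where "m = smooth_avg r X z"
  let ?A = "\<lambda>w. norm (X w) powr (p - 2) *\<^sub>R X w" and ?P = "\<lambda>w. norm (X w) powr p"
  have iA: "integrable lborel (\<lambda>w. kern r (z - w) * (?A w \<bullet> m))"
    using integrable_inner_left[OF smooth_avg_integrable[OF r int(2), of z], of m] by (simp add: mult.assoc)
  have iX: "integrable lborel (\<lambda>w. kern r (z - w) * (X w \<bullet> m))"
    using integrable_inner_left[OF smooth_avg_integrable[OF r int(1), of z], of m] by simp
  have iP: "integrable lborel (\<lambda>w. kern r (z - w) * ?P w)"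
    using smooth_avg_integrable[OF r int(3), of z] by simp
  note k = kern_reflect[OF r, of z]
  have eX: "(\<integral>w. kern r (z - w) * (X w \<bullet> m) \<partial>lborel) = m \<bullet> m"
    using integral_inner_left[OF smooth_avg_integrable[OF r int(1), of z], of m]
    by (simp add: m_def smooth_avg_def)
  have eA: "(\<integral>w. kern r (z - w) * (?A w \<bullet> m) \<partial>lborel) = smooth_avg r ?A z \<bullet> m"
    using integral_inner_left[OF smooth_avg_integrable[OF r int(2), of z], of m]
    by (simp add: smooth_avg_def mult.assoc)
  have "(\<integral>w. - (kern r (z - w) * (?A w \<bullet> m)) \<partial>lborel)
     \<le> (\<integral>w. kern r (z - w) * ?P w - norm m powr (p - 2) * (kern r (z - w) * (X w \<bullet> m))
            + kern r (z - w) * norm m powr p \<partial>lborel)"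
  proof (rule integral_mono)
    fix w
    have "kern r (z - w) * (- (norm (X w) powr (p - 2) * (X w \<bullet> m)))
        \<le> kern r (z - w) * (norm (X w) powr p - norm m powr (p - 2) * (X w \<bullet> m) + norm m powr p)"
      by (intro mult_left_mono flux_lower_bound p kern_nonneg r)
    then show "- (kern r (z - w) * (?A w \<bullet> m)) \<le> kern r (z - w) * ?P w
        - norm m powr (p - 2) * (kern r (z - w) * (X w \<bullet> m)) + kern r (z - w) * norm m powr p"
      by (simp add: algebra_simps)
  qed (intro Bochner_Integration.integrable_add Bochner_Integration.integrable_diff
        Bochner_Integration.integrable_minus integrable_mult_right integrable_mult_left iA iX iP k)+
  also have "\<dots> = smooth_avg r ?P z - norm m powr (p - 2) * (m \<bullet> m) + norm m powr p"
    using iX iP k by (simp add: eX smooth_avg_def)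
  also have "norm m powr (p - 2) * (m \<bullet> m) = norm m powr p"
    by (cases "m = 0") (auto simp: dot_square_norm powr_add[symmetric] simp flip: powr_numeral)
  finally show ?thesis
    using iA eA by (simp add: m_def)
qed

lemma AE_subsequence_L1:
  fixes F :: "nat \<Rightarrow> 'x \<Rightarrow> real"
  assumes "\<And>n. integrable M (F n)" "\<And>n x. 0 \<le> F n x" "(\<lambda>n. \<integral>x. F n x \<partial>M) \<longlonglongrightarrow> 0"
  obtains s where "strict_mono s" "AE x in M. (\<lambda>n. F (s n) x) \<longlonglongrightarrow> 0"
  using tendsto_L1_AE_subseq[of M F] assms by auto

text \<open>
  The radius of mollification tends to zero. All terms but one are products of an \<open>L\<^sup>1\<close> convergent
  and a boundedly convergent factor. In the remaining one, flux times gradient, convergence of both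
  factors in \<open>L\<^sup>1\<close> and almost everywhere does not suffice; but adding the mollification of
  \<open>norm (X z) powr p\<close>, whose integral does converge, makes it nonnegative by
  \<open>smooth_avg_flux_lower_bound\<close>, and Fatou's lemma gives the inequality in the direction needed.
\<close>

lemma energy_inequality:
  fixes u W \<zeta> :: "'a::euclidean_space \<times> real \<Rightarrow> real" and X :: "'a \<times> real \<Rightarrow> 'a"
    and p \<epsilon> :: real
  defines "A \<equiv> \<lambda>z. norm (X z) powr (p - 2) *\<^sub>R X z" and "P \<equiv> \<lambda>z. norm (X z) powr p"
  assumes p: "p > 1"
    and int: "integrable lborel u" "integrable lborel W" "integrable lborel A" "integrable lborel X" "integrable lborel P"
    and u0: "\<And>z. 0 \<le> u z"
    and grad: "\<And>z. has_grad \<zeta> (\<zeta>' z) z" and cont: "continuous_on UNIV \<zeta>'"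
    and S: "compact S" "\<And>z. z \<notin> S \<Longrightarrow> \<zeta> z = 0" and \<zeta>0: "\<And>z. 0 \<le> \<zeta> z"
    and r0: "r0 > 0"
    and eq: "\<And>r z. 0 < r \<Longrightarrow> r < r0 \<Longrightarrow> z \<in> S \<Longrightarrow> smooth_avg r W z \<le>
        - (\<Sum>i\<in>Basis. smooth_avg_grad r (\<lambda>w. A w \<bullet> i) z \<bullet> (i, 0)) + smooth_avg_grad r u z \<bullet> (0, 1)"
    and gx: "\<And>r z i. 0 < r \<Longrightarrow> r < r0 \<Longrightarrow> z \<in> S \<Longrightarrow> i \<in> Basis \<Longrightarrow>
        smooth_avg_grad r u z \<bullet> (i, 0) = smooth_avg r X z \<bullet> i"
    and \<epsilon>: "\<epsilon> > 0" and a: "0 < a" "a < 1"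
  defines "v \<equiv> \<lambda>z. u z + \<epsilon>"
  defines "D \<equiv> \<lambda>z. v z powr (- a) * (A z \<bullet> fst (\<zeta>' z)) - a * \<zeta> z * v z powr (- a - 1) * P z
            - snd (\<zeta>' z) * (v z powr (1 - a) / (1 - a))"
  shows "integrable lborel (\<lambda>z. W z * \<zeta> z * v z powr (- a))" "integrable lborel D"
    "(\<integral>z. W z * \<zeta> z * v z powr (- a) \<partial>lborel) \<le> (\<integral>z. D z \<partial>lborel)"
proof -
  define r where "r n = r0 / real (n + 2)" for n :: nat
  have r: "0 < r n" "r n < r0" for n using r0 by (auto simp: r_def field_simps intro: add_pos_nonneg)
  have rlim: "r \<longlonglongrightarrow> 0"
    unfolding r_def[abs_def] by (rule LIMSEQ_ignore_initial_segment[OF lim_const_over_n])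
  \<comment> \<open>One subsequence along which all four mollifications converge almost everywhere.\<close>
  let ?F = "\<lambda>n z. norm (smooth_avg (r n) u z - u z) + norm (smooth_avg (r n) A z - A z)
     + norm (smooth_avg (r n) X z - X z) + norm (smooth_avg (r n) P z - P z)"
  have iF: "integrable lborel (\<lambda>z. norm (smooth_avg (r n) f z - f z))" if "integrable lborel f"
    for n and f :: "'a \<times> real \<Rightarrow> 'c::{banach, second_countable_topology}"
    by (intro integrable_norm Bochner_Integration.integrable_diff smooth_avg_L1_bound that r)
  note iFs = iF[OF int(1)] iF[OF int(3)] iF[OF int(4)] iF[OF int(5)]
  have Fint: "integrable lborel (?F n)" for n
    by (intro Bochner_Integration.integrable_add iFs)
  have Feq: "(\<integral>z. ?F n z \<partial>lborel) = (\<integral>z. norm (smooth_avg (r n) u z - u z) \<partial>lborel)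
      + (\<integral>z. norm (smooth_avg (r n) A z - A z) \<partial>lborel) + (\<integral>z. norm (smooth_avg (r n) X z - X z) \<partial>lborel)
      + (\<integral>z. norm (smooth_avg (r n) P z - P z) \<partial>lborel)" for n
    by (simp only: Bochner_Integration.integral_add Bochner_Integration.integrable_add iFs)
  have Flim: "(\<lambda>n. \<integral>z. ?F n z \<partial>lborel) \<longlonglongrightarrow> 0"
    unfolding Feq by (intro tendsto_add_zero smooth_avg_tendsto_L1 int r rlim)
  obtain s where s: "strict_mono s" "AE z in lborel. (\<lambda>n. ?F (s n) z) \<longlonglongrightarrow> 0"
    by (rule AE_subsequence_L1[OF Fint _ Flim]) simp
  define \<rho> where "\<rho> n = r (s n)" for n
  have \<rho>: "0 < \<rho> n" "\<rho> n < r0" for n using r by (auto simp: \<rho>_def)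
  have \<rho>lim: "\<rho> \<longlonglongrightarrow> 0"
    using LIMSEQ_subseq_LIMSEQ[OF rlim s(1)] by (simp add: \<rho>_def[abs_def] o_def)
  have ae: "AE z in lborel. (\<lambda>n. smooth_avg (\<rho> n) u z) \<longlonglongrightarrow> u z \<and> (\<lambda>n. smooth_avg (\<rho> n) A z) \<longlonglongrightarrow> A z
     \<and> (\<lambda>n. smooth_avg (\<rho> n) X z) \<longlonglongrightarrow> X z \<and> (\<lambda>n. smooth_avg (\<rho> n) P z) \<longlonglongrightarrow> P z"
    using s(2)
  proof eventually_elim
    case (elim z)
    show ?case
      by (intro conjI; rule LIM_zero_cancel; rule Lim_null_comparison[OF always_eventually elim])
         (auto simp: \<rho>_def)
  qed
  define vn where "vn n z = smooth_avg (\<rho> n) u z + \<epsilon>" for n z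
  have vn: "\<epsilon> \<le> vn n z" for n z
    using smooth_avg_nonneg[where f = u and z = z, OF \<rho>(1) u0] by (simp add: vn_def)
  have v: "\<epsilon> \<le> v z" for z using u0 by (simp add: v_def)
  have vb: "vn n z powr (- b) \<le> \<epsilon> powr (- b)" if "b \<ge> 0" for n z b
    using vn[of n z] \<epsilon> that by (intro powr_mono2') auto
  have vlim: "AE z in lborel. (\<lambda>n. vn n z powr b) \<longlonglongrightarrow> v z powr b" for b
    using ae
  proof eventually_elim
    case (elim z)
    then show ?case
      unfolding vn_def v_def using v[of z] \<epsilon>
      by (intro tendsto_powr tendsto_add tendsto_const) (auto simp: v_def)
  qed
  have \<zeta>'0: "\<zeta>' z = 0" if "z \<notin> S" for z
    using has_grad_zero_off_closed[OF grad compact_imp_closed[OF S(1)] S(2) that] by blast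
  have c\<zeta>: "continuous_on UNIV \<zeta>" by (rule has_grad_continuous[OF grad])
  obtain Z where Z: "0 < Z" "\<And>z. norm (\<zeta> z) \<le> Z"
    using bounded_continuous_compact_support[OF c\<zeta> S] by blast
  obtain Z' where Z': "0 < Z'" "\<And>z. norm (\<zeta>' z) \<le> Z'"
    using bounded_continuous_compact_support[OF cont S(1) \<zeta>'0] by blast
  have cvn: "continuous_on UNIV (\<lambda>z. vn n z powr b)" for n b
    unfolding vn_def
  proof (intro continuous_on_powr continuous_on_add continuous_on_const smooth_avg_continuous \<rho> int ballI)
    show "smooth_avg (\<rho> n) u z + \<epsilon> \<noteq> 0" for z
      using vn[of n z] \<epsilon> by (simp add: vn_def)
  qed
  have [measurable]: "u \<in> borel_measurable borel" "A \<in> borel_measurable borel" "P \<in> borel_measurable borel"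
    "W \<in> borel_measurable borel"
    using int by (auto simp: borel_measurable_integrable)
  have [measurable]: "\<zeta> \<in> borel_measurable borel" "\<zeta>' \<in> borel_measurable borel"
    using c\<zeta> cont by (auto intro: borel_measurable_continuous_onI)
  have [measurable]: "(\<lambda>z. vn n z powr b) \<in> borel_measurable borel" for n b
    by (intro borel_measurable_continuous_onI cvn)
  have [measurable]: "v \<in> borel_measurable borel"
    unfolding v_def by measurable
  have [measurable]: "(\<lambda>z. fst (\<zeta>' z)) \<in> borel_measurable borel" "(\<lambda>z. snd (\<zeta>' z)) \<in> borel_measurable borel"
    by (intro borel_measurable_continuous_onI continuous_on_fst continuous_on_snd cont)+
  have iS: "integrable lborel (\<lambda>z. \<epsilon> * indicator S z :: real)"
    using S(1) by (intro integrable_mult_right integrable_real_indicator)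
       (use emeasure_compact_finite[OF S(1)] in \<open>auto simp: compact_imp_closed borel_closed\<close>)
  have nf: "norm (fst (\<zeta>' z)) \<le> Z'" "norm (snd (\<zeta>' z)) \<le> Z'" for z
    using norm_fst_le[of "fst (\<zeta>' z)" "snd (\<zeta>' z)"] norm_snd_le[of "snd (\<zeta>' z)" "fst (\<zeta>' z)"] Z'(2)[of z] by auto

  note smi = smooth_avg_L1_bound(1)[OF \<rho>(1)] and sml = smooth_avg_tendsto_L1[OF _ \<rho>(1) \<rho>lim]
  have T1: "integrable lborel (\<lambda>z. \<zeta> z * vn n z powr (- a) * smooth_avg (\<rho> n) W z)"
    "integrable lborel (\<lambda>z. \<zeta> z * v z powr (- a) * W z)"
    "(\<lambda>n. \<integral>z. \<zeta> z * vn n z powr (- a) * smooth_avg (\<rho> n) W z \<partial>lborel)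
       \<longlonglongrightarrow> (\<integral>z. \<zeta> z * v z powr (- a) * W z \<partial>lborel)" for n
  proof -
    have b: "norm (\<zeta> z * vn n z powr (- a)) \<le> Z * \<epsilon> powr (- a)" for n z
      unfolding norm_mult using vb[of a n z] a Z by (intro mult_mono) auto
    have l: "AE z in lborel. (\<lambda>n. \<zeta> z * vn n z powr (- a)) \<longlonglongrightarrow> \<zeta> z * v z powr (- a)"
      using vlim[of "- a"] by eventually_elim (intro tendsto_mult tendsto_const)
    note t = tendsto_integral_inner[OF smi[OF int(2)] int(2) sml[OF int(2)] _ _ b l, unfolded inner_real_def]
    show "integrable lborel (\<lambda>z. \<zeta> z * vn n z powr (- a) * smooth_avg (\<rho> n) W z)" by (rule t) measurable
    show "integrable lborel (\<lambda>z. \<zeta> z * v z powr (- a) * W z)" by (rule t) measurable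
    show "(\<lambda>n. \<integral>z. \<zeta> z * vn n z powr (- a) * smooth_avg (\<rho> n) W z \<partial>lborel)
       \<longlonglongrightarrow> (\<integral>z. \<zeta> z * v z powr (- a) * W z \<partial>lborel)" by (rule t) measurable
  qed
  have T2: "integrable lborel (\<lambda>z. (vn n z powr (- a) *\<^sub>R fst (\<zeta>' z)) \<bullet> smooth_avg (\<rho> n) A z)"
    "integrable lborel (\<lambda>z. (v z powr (- a) *\<^sub>R fst (\<zeta>' z)) \<bullet> A z)"
    "(\<lambda>n. \<integral>z. (vn n z powr (- a) *\<^sub>R fst (\<zeta>' z)) \<bullet> smooth_avg (\<rho> n) A z \<partial>lborel)
       \<longlonglongrightarrow> (\<integral>z. (v z powr (- a) *\<^sub>R fst (\<zeta>' z)) \<bullet> A z \<partial>lborel)" for n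
  proof -
    have b: "norm (vn n z powr (- a) *\<^sub>R fst (\<zeta>' z)) \<le> \<epsilon> powr (- a) * Z'" for n z
      unfolding norm_scaleR using vb[of a n z] a nf by (intro mult_mono) auto
    have l: "AE z in lborel. (\<lambda>n. vn n z powr (- a) *\<^sub>R fst (\<zeta>' z)) \<longlonglongrightarrow> v z powr (- a) *\<^sub>R fst (\<zeta>' z)"
      using vlim[of "- a"] by eventually_elim (intro tendsto_scaleR tendsto_const)
    note t = tendsto_integral_inner[OF smi[OF int(3)] int(3) sml[OF int(3)] _ _ b l]
    show "integrable lborel (\<lambda>z. (vn n z powr (- a) *\<^sub>R fst (\<zeta>' z)) \<bullet> smooth_avg (\<rho> n) A z)" by (rule t) measurable
    show "integrable lborel (\<lambda>z. (v z powr (- a) *\<^sub>R fst (\<zeta>' z)) \<bullet> A z)" by (rule t) measurable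
    show "(\<lambda>n. \<integral>z. (vn n z powr (- a) *\<^sub>R fst (\<zeta>' z)) \<bullet> smooth_avg (\<rho> n) A z \<partial>lborel)
       \<longlonglongrightarrow> (\<integral>z. (v z powr (- a) *\<^sub>R fst (\<zeta>' z)) \<bullet> A z \<partial>lborel)" by (rule t) measurable
  qed
  have powsplit: "y powr (1 - a) = y * y powr (- a)" if "y > 0" for y :: real
    using powr_mult_base[of y "- a"] that by simp
  have T3: "integrable lborel (\<lambda>z. snd (\<zeta>' z) * (vn n z powr (1 - a) / (1 - a)))"
    "integrable lborel (\<lambda>z. snd (\<zeta>' z) * (v z powr (1 - a) / (1 - a)))"
    "(\<lambda>n. \<integral>z. snd (\<zeta>' z) * (vn n z powr (1 - a) / (1 - a)) \<partial>lborel)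
       \<longlonglongrightarrow> (\<integral>z. snd (\<zeta>' z) * (v z powr (1 - a) / (1 - a)) \<partial>lborel)" for n
  proof -
    have b: "norm (snd (\<zeta>' z) * (vn n z powr (- a) / (1 - a))) \<le> Z' * (\<epsilon> powr (- a) / (1 - a))" for n z
      unfolding norm_mult using vb[of a n z] a nf Z'(1) by (intro mult_mono) (auto intro!: divide_right_mono)
    have l: "AE z in lborel. (\<lambda>n. snd (\<zeta>' z) * (vn n z powr (- a) / (1 - a))) \<longlonglongrightarrow> snd (\<zeta>' z) * (v z powr (- a) / (1 - a))"
      using vlim[of "- a"] by eventually_elim (use a in \<open>intro tendsto_mult tendsto_divide tendsto_const\<close>, auto)
    have c: "(\<lambda>n. \<integral>z. norm ((smooth_avg (\<rho> n) u z + \<epsilon> * indicator S z) - (u z + \<epsilon> * indicator S z)) \<partial>lborel) \<longlonglongrightarrow> 0"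
      using sml[OF int(1)] by simp
    \<comment> \<open>The indicator makes \<open>\<epsilon>\<close> integrable and is harmless, since \<open>\<zeta>'\<close> vanishes off \<open>S\<close>.\<close>
    have e1: "snd (\<zeta>' z) * (vn n z powr (- a) / (1 - a)) * (smooth_avg (\<rho> n) u z + \<epsilon> * indicator S z)
        = snd (\<zeta>' z) * (vn n z powr (1 - a) / (1 - a))" for n z
      using \<zeta>'0[of z] powsplit[of "vn n z"] vn[of n z] \<epsilon> by (cases "z \<in> S") (auto simp: vn_def)
    have e2: "snd (\<zeta>' z) * (v z powr (- a) / (1 - a)) * (u z + \<epsilon> * indicator S z)
        = snd (\<zeta>' z) * (v z powr (1 - a) / (1 - a))" for z
      using \<zeta>'0[of z] powsplit[of "v z"] v[of z] \<epsilon> by (cases "z \<in> S") (auto simp: v_def)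
    note t = tendsto_integral_inner[OF Bochner_Integration.integrable_add[OF smi[OF int(1)] iS]
        Bochner_Integration.integrable_add[OF int(1) iS] c _ _ b l, unfolded inner_real_def e1 e2]
    show "integrable lborel (\<lambda>z. snd (\<zeta>' z) * (vn n z powr (1 - a) / (1 - a)))" by (rule t) measurable
    show "integrable lborel (\<lambda>z. snd (\<zeta>' z) * (v z powr (1 - a) / (1 - a)))" by (rule t) measurable
    show "(\<lambda>n. \<integral>z. snd (\<zeta>' z) * (vn n z powr (1 - a) / (1 - a)) \<partial>lborel)
       \<longlonglongrightarrow> (\<integral>z. snd (\<zeta>' z) * (v z powr (1 - a) / (1 - a)) \<partial>lborel)" by (rule t) measurable
  qed
  define Bn where "Bn n z = a * \<zeta> z * vn n z powr (- a - 1)" for n z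
  define B where "B z = a * \<zeta> z * v z powr (- a - 1)" for z
  have [measurable]: "B \<in> borel_measurable borel" "Bn n \<in> borel_measurable borel" for n
    unfolding B_def[abs_def] Bn_def[abs_def] by measurable
  have Bn0: "0 \<le> Bn n z" and B0: "0 \<le> B z" for n z
    using a \<zeta>0 by (auto simp: Bn_def B_def)
  have Blim: "AE z in lborel. (\<lambda>n. Bn n z) \<longlonglongrightarrow> B z"
    unfolding Bn_def B_def using vlim[of "- a - 1"] by eventually_elim (intro tendsto_mult tendsto_const)
  have T4: "integrable lborel (\<lambda>z. Bn n z * smooth_avg (\<rho> n) P z)"
    "integrable lborel (\<lambda>z. B z * P z)"
    "(\<lambda>n. \<integral>z. Bn n z * smooth_avg (\<rho> n) P z \<partial>lborel) \<longlonglongrightarrow> (\<integral>z. B z * P z \<partial>lborel)" for n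
  proof -
    have b: "norm (Bn n z) \<le> a * Z * \<epsilon> powr (- (a + 1))" for n z
      unfolding Bn_def norm_mult using vb[of "a + 1" n z] a Z by (intro mult_mono) auto
    note t = tendsto_integral_inner[OF smi[OF int(5)] int(5) sml[OF int(5)] _ _ b Blim, unfolded inner_real_def]
    show "integrable lborel (\<lambda>z. Bn n z * smooth_avg (\<rho> n) P z)" by (rule t) measurable
    show "integrable lborel (\<lambda>z. B z * P z)" by (rule t) measurable
    show "(\<lambda>n. \<integral>z. Bn n z * smooth_avg (\<rho> n) P z \<partial>lborel) \<longlonglongrightarrow> (\<integral>z. B z * P z \<partial>lborel)" by (rule t) measurable
  qed
  have T5: "integrable lborel (\<lambda>z. Bn n z * (smooth_avg (\<rho> n) A z \<bullet> smooth_avg (\<rho> n) X z))" for n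
  proof (rule integrable_continuous_compact_support[OF _ S(1)])
    show "continuous_on UNIV (\<lambda>z. Bn n z * (smooth_avg (\<rho> n) A z \<bullet> smooth_avg (\<rho> n) X z))"
      unfolding Bn_def
      by (intro continuous_on_mult continuous_on_inner continuous_on_const c\<zeta> cvn smooth_avg_continuous \<rho> int)
    show "Bn n z * (smooth_avg (\<rho> n) A z \<bullet> smooth_avg (\<rho> n) X z) = 0" if "z \<notin> S" for z
      using S(2)[OF that] by (simp add: Bn_def)
  qed
  \<comment> \<open>The nonnegative sequence for Fatou's lemma. Its limit is \<open>2 * B z * P z\<close>, one half of which is
    compensated by the limit of the added term.\<close>
  define h where "h n z = Bn n z * (smooth_avg (\<rho> n) A z \<bullet> smooth_avg (\<rho> n) X z) + Bn n z * smooth_avg (\<rho> n) P z" for n z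
  define Rn where "Rn n = (\<integral>z. (vn n z powr (- a) *\<^sub>R fst (\<zeta>' z)) \<bullet> smooth_avg (\<rho> n) A z \<partial>lborel)
      - (\<integral>z. snd (\<zeta>' z) * (vn n z powr (1 - a) / (1 - a)) \<partial>lborel)
      - (\<integral>z. \<zeta> z * vn n z powr (- a) * smooth_avg (\<rho> n) W z \<partial>lborel)
      + (\<integral>z. Bn n z * smooth_avg (\<rho> n) P z \<partial>lborel)" for n
  define R where "R = (\<integral>z. (v z powr (- a) *\<^sub>R fst (\<zeta>' z)) \<bullet> A z \<partial>lborel)
      - (\<integral>z. snd (\<zeta>' z) * (v z powr (1 - a) / (1 - a)) \<partial>lborel)
      - (\<integral>z. \<zeta> z * v z powr (- a) * W z \<partial>lborel)
      + (\<integral>z. B z * P z \<partial>lborel)"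
  have Rlim: "Rn \<longlonglongrightarrow> R"
    unfolding Rn_def[abs_def] R_def by (intro tendsto_add tendsto_diff T1 T2 T3 T4)
  have h0: "0 \<le> h n z" for n z
  proof -
    have "0 \<le> Bn n z * (smooth_avg (\<rho> n) A z \<bullet> smooth_avg (\<rho> n) X z + smooth_avg (\<rho> n) P z)"
      using smooth_avg_flux_lower_bound[OF p \<rho>(1) int(4) int(3,5)[unfolded A_def P_def], of n z]
      by (intro mult_nonneg_nonneg Bn0) (simp add: A_def P_def)
    then show ?thesis by (simp add: h_def algebra_simps)
  qed
  have hi: "integrable lborel (h n)" for n
    unfolding h_def[abs_def] by (intro Bochner_Integration.integrable_add T4 T5)
  have hR: "(\<integral>z. h n z \<partial>lborel) \<le> Rn n" for n
  proof -
    have "(\<integral>z. smooth_avg (\<rho> n) W z * \<zeta> z * vn n z powr (- a)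
     + a * \<zeta> z * vn n z powr (- a - 1) * (smooth_avg (\<rho> n) A z \<bullet> smooth_avg (\<rho> n) X z)
     - vn n z powr (- a) * (smooth_avg (\<rho> n) A z \<bullet> fst (\<zeta>' z))
     + snd (\<zeta>' z) * (vn n z powr (1 - a) / (1 - a)) \<partial>lborel) \<le> 0"
      unfolding vn_def
      by (rule mollified_energy[OF \<rho>(1) int(1-4) u0 grad cont S \<zeta>0 eq[OF \<rho>] gx[OF \<rho>] \<epsilon> a])
    also have "(\<lambda>z. smooth_avg (\<rho> n) W z * \<zeta> z * vn n z powr (- a)
     + a * \<zeta> z * vn n z powr (- a - 1) * (smooth_avg (\<rho> n) A z \<bullet> smooth_avg (\<rho> n) X z)
     - vn n z powr (- a) * (smooth_avg (\<rho> n) A z \<bullet> fst (\<zeta>' z))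
     + snd (\<zeta>' z) * (vn n z powr (1 - a) / (1 - a))) =
      (\<lambda>z. \<zeta> z * vn n z powr (- a) * smooth_avg (\<rho> n) W z
        + Bn n z * (smooth_avg (\<rho> n) A z \<bullet> smooth_avg (\<rho> n) X z)
        - (vn n z powr (- a) *\<^sub>R fst (\<zeta>' z)) \<bullet> smooth_avg (\<rho> n) A z
        + snd (\<zeta>' z) * (vn n z powr (1 - a) / (1 - a)))"
      by (simp add: Bn_def inner_commute mult_ac)
    finally show ?thesis
      using T1(1)[of n] T2(1)[of n] T3(1)[of n] T4(1)[of n] T5[of n]
      by (simp add: h_def Rn_def)
  qed
  have "0 \<le> R"
    by (rule tendsto_lowerbound[OF Rlim]) (auto intro!: always_eventually order_trans[OF _ hR] Bochner_Integration.integral_nonneg h0)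
  have AX: "A z \<bullet> X z = P z" for z
    by (cases "X z = 0") (auto simp: A_def P_def dot_square_norm powr_add[symmetric] simp flip: powr_numeral)
  have BP: "integrable lborel (\<lambda>z. 2 * (B z * P z))" using T4(2) by simp
  have P0: "0 \<le> P z" for z by (simp add: P_def)
  have "ennreal (\<integral>z. 2 * (B z * P z) \<partial>lborel) = (\<integral>\<^sup>+z. ennreal (2 * (B z * P z)) \<partial>lborel)"
    using BP B0 P0 by (intro nn_integral_eq_integral[symmetric]) auto
  also have "\<dots> = (\<integral>\<^sup>+z. liminf (\<lambda>n. ennreal (h n z)) \<partial>lborel)"
  proof (rule nn_integral_cong_AE)
    show "AE z in lborel. ennreal (2 * (B z * P z)) = liminf (\<lambda>n. ennreal (h n z))"
      using ae Blim
    proof eventually_elim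
      case (elim z)
      have "(\<lambda>n. h n z) \<longlonglongrightarrow> B z * (A z \<bullet> X z) + B z * P z"
        unfolding h_def using elim by (intro tendsto_add tendsto_mult tendsto_inner) auto
      then have "(\<lambda>n. ennreal (h n z)) \<longlonglongrightarrow> ennreal (2 * (B z * P z))"
        by (intro tendsto_ennrealI) (simp add: AX)
      then show ?case
        by (rule lim_imp_Liminf[OF sequentially_bot, symmetric])
    qed
  qed
  also have "\<dots> \<le> liminf (\<lambda>n. \<integral>\<^sup>+z. ennreal (h n z) \<partial>lborel)"
    using hi by (intro nn_integral_liminf) (auto simp: borel_measurable_integrable)
  also have "\<dots> \<le> liminf (\<lambda>n. ennreal (Rn n))"
  proof (rule Liminf_mono, rule always_eventually, rule allI)
    fix n
    have "(\<integral>\<^sup>+z. ennreal (h n z) \<partial>lborel) = ennreal (\<integral>z. h n z \<partial>lborel)"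
      using hi h0 by (intro nn_integral_eq_integral) auto
    then show "(\<integral>\<^sup>+z. ennreal (h n z) \<partial>lborel) \<le> ennreal (Rn n)"
      using hR by (simp add: ennreal_leI)
  qed
  also have "\<dots> = ennreal R"
    by (rule lim_imp_Liminf[OF sequentially_bot tendsto_ennrealI[OF Rlim]])
  finally have le: "(\<integral>z. 2 * (B z * P z) \<partial>lborel) \<le> R"
    using \<open>0 \<le> R\<close> by (simp add: ennreal_le_iff)
  have D_eq: "D = (\<lambda>z. (v z powr (- a) *\<^sub>R fst (\<zeta>' z)) \<bullet> A z - B z * P z
      - snd (\<zeta>' z) * (v z powr (1 - a) / (1 - a)))"
    by (simp add: D_def B_def fun_eq_iff inner_commute)
  show "integrable lborel (\<lambda>z. W z * \<zeta> z * v z powr (- a))"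
    using T1(2) by (simp add: mult_ac)
  show "integrable lborel D"
    unfolding D_eq by (intro Bochner_Integration.integrable_diff T2 T3 T4)
  have "(\<integral>z. W z * \<zeta> z * v z powr (- a) \<partial>lborel) = (\<integral>z. \<zeta> z * v z powr (- a) * W z \<partial>lborel)"
    by (simp add: mult_ac)
  then show "(\<integral>z. W z * \<zeta> z * v z powr (- a) \<partial>lborel) \<le> (\<integral>z. D z \<partial>lborel)"
    using le T2(2) T3(2) T4(2) unfolding D_eq R_def
    by (simp del: inner_scaleR_left times_divide_eq_right)
qed

section \<open>Mollification of weak solutions\<close>

text \<open>
  The hypotheses live on the completed measure, while Fubini's theorem is applied to Borel
  functions; this lemma and the next one mediate between the two.
\<close>

lemma lebesgue_AE_eq_borel:
  fixes f g :: "'b::euclidean_space \<Rightarrow> 'c::euclidean_space"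
  assumes g: "g \<in> borel_measurable borel" and ae: "AE w in lborel. f w = g w"
  shows "integrable lebesgue f \<longleftrightarrow> integrable lborel g" "integral\<^sup>L lebesgue f = integral\<^sup>L lborel g"
proof -
  have g': "g \<in> borel_measurable lebesgue" using g by (simp add: measurable_completion)
  have ae': "AE w in lebesgue. g w = f w"
    using ae unfolding AE_completion_iff by eventually_elim simp
  have f': "f \<in> borel_measurable lebesgue" by (rule borel_measurable_AE[OF g' ae'])
  have "integrable lebesgue f \<longleftrightarrow> integrable lebesgue g"
    using ae' by (intro integrable_cong_AE f' g') auto
  then show "integrable lebesgue f \<longleftrightarrow> integrable lborel g"
    using g by (simp add: integrable_completion)
  have "integral\<^sup>L lebesgue f = integral\<^sup>L lebesgue g"
    using ae' by (intro integral_cong_AE f' g') auto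
  then show "integral\<^sup>L lebesgue f = integral\<^sup>L lborel g"
    using g by (simp add: integral_completion)
qed

lemma borel_version_on:
  fixes f :: "'b::euclidean_space \<Rightarrow> 'c::euclidean_space"
  assumes "set_borel_measurable lebesgue S f"
  obtains g where "g \<in> borel_measurable borel" "AE z in lborel. z \<in> S \<longrightarrow> f z = g z"
proof -
  have "\<exists>g\<in>borel_measurable lborel. AE z in lborel. (indicator S z *\<^sub>R f z) \<bullet> i = g z" for i
    using assms unfolding set_borel_measurable_def
    by (intro completion_ex_borel_measurable_real borel_measurable_inner) auto
  then obtain g where g: "\<And>i. g i \<in> borel_measurable lborel"
    "\<And>i. AE z in lborel. (indicator S z *\<^sub>R f z) \<bullet> i = g i z"
    by metis
  have [measurable]: "g i \<in> borel_measurable borel" for i using g(1)[of i] by simp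
  show thesis
  proof (rule that[of "\<lambda>z. \<Sum>i\<in>Basis. g i z *\<^sub>R i"])
    show "(\<lambda>z. \<Sum>i\<in>Basis. g i z *\<^sub>R i) \<in> borel_measurable borel" by measurable
    have "AE z in lborel. \<forall>i\<in>Basis. (indicator S z *\<^sub>R f z) \<bullet> i = g i z"
      by (intro AE_finite_allI finite_Basis g(2))
    then show "AE z in lborel. z \<in> S \<longrightarrow> f z = (\<Sum>i\<in>Basis. g i z *\<^sub>R i)"
    proof eventually_elim
      case (elim z)
      show ?case
      proof
        assume "z \<in> S"
        then have "(\<Sum>i\<in>Basis. g i z *\<^sub>R i) = (\<Sum>i\<in>Basis. (f z \<bullet> i) *\<^sub>R i)"
          using elim by (intro sum.cong) auto
        then show "f z = (\<Sum>i\<in>Basis. g i z *\<^sub>R i)" by (simp add: euclidean_representation)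
      qed
    qed
  qed
qed

lemma set_integrable_borel_version:
  fixes f g :: "'b::euclidean_space \<Rightarrow> real"
  assumes "set_integrable lebesgue K f" "compact K" "g \<in> borel_measurable borel"
    "AE z in lborel. z \<in> K \<longrightarrow> f z = g z"
  shows "integrable lborel (\<lambda>z. indicator K z * g z)"
proof -
  have [measurable]: "K \<in> sets borel" "g \<in> borel_measurable borel"
    using assms by (auto intro: borel_closed compact_imp_closed)
  have "(\<lambda>z. indicator K z * g z) \<in> borel_measurable borel" by measurable
  moreover have "AE z in lborel. indicator K z *\<^sub>R f z = indicator K z * g z"
    using assms(4) by eventually_elim (auto simp: indicator_def)
  ultimately show ?thesis
    using lebesgue_AE_eq_borel(1)[of "\<lambda>z. indicator K z * g z" "\<lambda>z. indicator K z *\<^sub>R f z"] assms(1)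
    unfolding set_integrable_def by simp
qed

lemma gradient_eqI:
  assumes "(f has_derivative (\<lambda>v. g \<bullet> v)) (at x)"
  shows "gradient f x = g"
proof -
  have "frechet_derivative f (at x) = (\<lambda>v. g \<bullet> v)"
    by (rule frechet_derivative_at[OF assms, symmetric])
  moreover have "f differentiable (at x)" using assms by (auto simp: differentiable_def)
  ultimately show ?thesis by (simp add: gradient_def euclidean_representation)
qed

lemma kern_reflected_has_grad: "has_grad (\<lambda>w. kern r (z - w)) (- kgrad r (z - w)) w"
proof -
  have "((\<lambda>w. z - w) has_derivative (\<lambda>v. - v)) (at w)" by (auto intro!: derivative_eq_intros)
  from has_derivative_compose[OF this kern_has_derivative]
  show ?thesis unfolding has_grad_def by (rule has_derivative_eq_rhs) (simp add: fun_eq_iff)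
qed

text \<open>
  The weak formulation takes gradients of slices of the test function.
\<close>

lemma gradient_slice_fst:
  fixes f :: "'a::euclidean_space \<times> real \<Rightarrow> real"
  assumes "has_grad f g (x, t)"
  shows "gradient (\<lambda>y. f (y, t)) x = fst g"
proof (rule gradient_eqI)
  have "((\<lambda>y. (y, t)) has_derivative (\<lambda>v. (v, 0))) (at x)" by (auto intro!: derivative_eq_intros)
  from has_derivative_compose[OF this assms[unfolded has_grad_def]]
  show "((\<lambda>y. f (y, t)) has_derivative (\<lambda>v. fst g \<bullet> v)) (at x)"
    by (rule has_derivative_eq_rhs) (simp add: fun_eq_iff inner_prod_def)
qed

lemma gradient_slice_snd:
  fixes f :: "'a::euclidean_space \<times> real \<Rightarrow> real"
  assumes "has_grad f g (x, t)"
  shows "gradient (\<lambda>s. f (x, s)) t = snd g"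
proof (rule gradient_eqI)
  have "((\<lambda>s. (x, s)) has_derivative (\<lambda>v. (0, v))) (at t)" by (auto intro!: derivative_eq_intros)
  from has_derivative_compose[OF this assms[unfolded has_grad_def]]
  show "((\<lambda>s. f (x, s)) has_derivative (\<lambda>v. snd g \<bullet> v)) (at t)"
    by (rule has_derivative_eq_rhs) (simp add: fun_eq_iff inner_prod_def)
qed

lemma kern_Lip_test:
  fixes z :: "'a::euclidean_space \<times> real"
  assumes r: "r > 0" and sub: "cball z r \<subseteq> cyl \<Omega>"
  shows "(\<lambda>w. kern r (z - w)) \<in> Lip_test \<Omega>"
proof -
  obtain M where M: "0 < M" "\<And>x. norm (kgrad r (x :: 'a \<times> real)) \<le> M" using kgrad_bounded[OF r] by blast
  have "\<bar>kern r (z - x) - kern r (z - y)\<bar> \<le> M * norm (x - y)" for x y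
    by (rule has_grad_lipschitz[OF kern_reflected_has_grad]) (simp add: M)
  then have "M-lipschitz_on (cyl \<Omega>) (\<lambda>w. kern r (z - w))"
    using M(1) by (intro lipschitz_onI) (auto simp: dist_norm)
  moreover have cl: "closure {w \<in> cyl \<Omega>. kern r (z - w) \<noteq> 0} \<subseteq> cball z r"
    by (rule closure_minimal) (use kern_zero[OF r] in \<open>force simp: dist_norm\<close>)+
  moreover have "compact (closure {w \<in> cyl \<Omega>. kern r (z - w) \<noteq> 0})"
    using cl by (meson bounded_cball bounded_subset closed_closure compact_eq_bounded_closed)
  ultimately show ?thesis
    using sub kern_nonneg[OF r] unfolding Lip_test_def support_on_def by auto
qed

text \<open>
  What remains of a weak solution after the passage to Borel representatives: local
  integrability in the open cylinder, the inequality obtained by testing with reflected kernels,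
  and the fact that mollification commutes with the weak spatial gradient \<open>X\<close>. The functions are cut
  off by a compact set \<open>K\<close> to make them integrable; near the point \<open>z\<close> this changes nothing, since
  the kernel only sees a ball inside \<open>K\<close>.
\<close>

locale regular_supersolution =
  fixes p q :: real and U :: "('a::euclidean_space \<times> real) set"
    and u V :: "'a \<times> real \<Rightarrow> real" and X :: "'a \<times> real \<Rightarrow> 'a"
  assumes u_borel: "u \<in> borel_measurable borel"
    and V_borel: "V \<in> borel_measurable borel"
    and X_borel: "X \<in> borel_measurable borel"
    and u_nonneg: "0 \<le> u z"
    and V_pos: "0 < V z"
    and u_integrable: "compact K \<Longrightarrow> K \<subseteq> U \<Longrightarrow> integrable lborel (\<lambda>z. indicator K z * u z)"
    and u_powr_integrable: "compact K \<Longrightarrow> K \<subseteq> U \<Longrightarrow> integrable lborel (\<lambda>z. indicator K z * u z powr p)"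
    and V_integrable: "compact K \<Longrightarrow> K \<subseteq> U \<Longrightarrow> integrable lborel (\<lambda>z. indicator K z * V z)"
    and Vu_integrable: "compact K \<Longrightarrow> K \<subseteq> U \<Longrightarrow> integrable lborel (\<lambda>z. indicator K z * (V z * u z powr q))"
    and X_powr_integrable: "compact K \<Longrightarrow> K \<subseteq> U \<Longrightarrow> integrable lborel (\<lambda>z. indicator K z * norm (X z) powr p)"
    and X_integrable: "compact K \<Longrightarrow> K \<subseteq> U \<Longrightarrow> integrable lborel (\<lambda>z. indicator K z *\<^sub>R X z)"
    and flux_integrable: "compact K \<Longrightarrow> K \<subseteq> U \<Longrightarrow>
        integrable lborel (\<lambda>z. indicator K z *\<^sub>R (norm (X z) powr (p - 2) *\<^sub>R X z))"
    and mollified_inequality: "compact K \<Longrightarrow> K \<subseteq> U \<Longrightarrow> 0 < r \<Longrightarrow> cball z r \<subseteq> K \<Longrightarrow>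
        smooth_avg r (\<lambda>z. indicator K z * (V z * u z powr q)) z
         \<le> - (\<Sum>i\<in>Basis. smooth_avg_grad r
                (\<lambda>w. (indicator K w *\<^sub>R (norm (X w) powr (p - 2) *\<^sub>R X w)) \<bullet> i) z \<bullet> (i, 0))
           + smooth_avg_grad r (\<lambda>z. indicator K z * u z) z \<bullet> (0, 1)"
    and mollified_gradient: "compact K \<Longrightarrow> K \<subseteq> U \<Longrightarrow> 0 < r \<Longrightarrow> cball z r \<subseteq> K \<Longrightarrow> i \<in> Basis \<Longrightarrow>
        smooth_avg_grad r (\<lambda>z. indicator K z * u z) z \<bullet> (i, 0)
         = smooth_avg r (\<lambda>z. indicator K z *\<^sub>R X z) z \<bullet> i"

text \<open>
  Insert \<open>\<lambda>w. kern r (z - w)\<close> into the weak formulation. By the reflection the derivatives of the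
  test function turn into derivatives of the averages at \<open>z\<close>: the divergence of the averaged flux
  and the time derivative of the averaged solution. The support of the kernel stays away from
  \<open>t = 0\<close>.
\<close>

lemma weak_solution_regularised:
  fixes \<Omega> :: "'a::euclidean_space set" and V u :: "'a \<times> real \<Rightarrow> real"
  assumes p: "p > 1"
    and V_loc: "Lp_loc 1 (cyl \<Omega>) V"
    and V_pos: "AE z\<in>open_cyl \<Omega> in lebesgue. V z > 0"
    and sol: "weak_solution p q \<Omega> V u0 u"
  obtains uB VB :: "'a \<times> real \<Rightarrow> real" and X :: "'a \<times> real \<Rightarrow> 'a" where
    "regular_supersolution p q (open_cyl \<Omega>) uB VB X"
    "AE z in lborel. z \<in> open_cyl \<Omega> \<longrightarrow> u z = uB z" "AE z in lborel. z \<in> open_cyl \<Omega> \<longrightarrow> V z = VB z"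
proof -
  let ?U = "open_cyl \<Omega>"
  have Usub: "?U \<subseteq> cyl \<Omega>" by auto
  have unn: "AE z in lborel. z \<in> ?U \<longrightarrow> 0 \<le> u z"
    and uq: "Lp_loc_weighted q V (cyl \<Omega>) u"
    using sol unfolding weak_solution_def by (simp_all add: AE_completion_iff)
  obtain G where G: "W1p_loc_grad p \<Omega> u G" and weak: "\<And>\<phi>. \<phi> \<in> Lip_test \<Omega> \<Longrightarrow>
       (LINT z:?U|lebesgue. V z * u z powr q * \<phi> z)
          \<le> (LINT (x, t):?U|lebesgue.
                norm (fst (G (x, t))) powr (p - 2) *
                (fst (G (x, t)) \<bullet> gradient (\<lambda>y. \<phi> (y, t)) x))
            - (LINT (x, t):?U|lebesgue. u (x, t) * gradient (\<lambda>s. \<phi> (x, s)) t)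
            - (LINT x:\<Omega>|lebesgue. u0 x * \<phi> (x, 0))"
    using sol unfolding weak_solution_def by blast
  have wg: "is_weak_gradient ?U u G" and up: "Lp_loc p (cyl \<Omega>) u" and Gp: "Lp_loc p (cyl \<Omega>) G"
    using G by (auto simp: W1p_loc_grad_def)
  obtain ub where ub: "ub \<in> borel_measurable borel" "AE z in lborel. z \<in> cyl \<Omega> \<longrightarrow> u z = ub z"
    by (rule borel_version_on[of "cyl \<Omega>" u]) (use up in \<open>simp add: Lp_loc_weighted_def\<close>)
  obtain vb where vb: "vb \<in> borel_measurable borel" "AE z in lborel. z \<in> cyl \<Omega> \<longrightarrow> V z = vb z"
    by (rule borel_version_on[of "cyl \<Omega>" V]) (use V_loc in \<open>simp add: Lp_loc_weighted_def\<close>)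
  obtain gb where gb: "gb \<in> borel_measurable borel" "AE z in lborel. z \<in> cyl \<Omega> \<longrightarrow> G z = gb z"
    by (rule borel_version_on[of "cyl \<Omega>" G]) (use Gp in \<open>simp add: Lp_loc_weighted_def\<close>)
  note [measurable] = ub(1) vb(1) gb(1)
  define uB where "uB z = max 0 (ub z)" for z
  \<comment> \<open>Changes on null sets make the representatives nonnegative and positive everywhere.\<close>
  define VB where "VB z = (if vb z > 0 then vb z else 1)" for z
  define X where "X z = fst (gb z)" for z
  have [measurable]: "uB \<in> borel_measurable borel" "VB \<in> borel_measurable borel"
    unfolding uB_def[abs_def] VB_def[abs_def] by measurable
  have [measurable]: "X \<in> borel_measurable borel"
    unfolding X_def[abs_def]
    by (rule borel_measurable_continuous_on[OF _ gb(1)]) (intro continuous_intros)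
  have u0: "0 \<le> uB z" and V0: "0 < VB z" for z by (auto simp: uB_def VB_def)
  have uae: "AE z in lborel. z \<in> ?U \<longrightarrow> u z = uB z"
    using ub(2) unn by eventually_elim (auto simp: uB_def)
  have Vae: "AE z in lborel. z \<in> ?U \<longrightarrow> V z = VB z"
    using vb(2) V_pos[unfolded AE_completion_iff] by eventually_elim (auto simp: VB_def)
  have Gae: "AE z in lborel. z \<in> ?U \<longrightarrow> G z = gb z"
    using gb(2) by eventually_elim auto
  have Kb: "K \<in> sets borel" if "compact K" for K :: "('a \<times> real) set"
    using that by (intro borel_closed compact_imp_closed)
  have i1: "integrable lborel (\<lambda>z. indicator K z * uB z)" if K: "compact K" "K \<subseteq> ?U" for K
  proof (rule set_integrable_borel_version[where f = "\<lambda>z. norm (u z) powr 1 * 1"])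
    show "set_integrable lebesgue K (\<lambda>z. norm (u z) powr 1 * 1)"
      using wg K unfolding is_weak_gradient_def Lp_loc_weighted_def by blast
    show "AE z in lborel. z \<in> K \<longrightarrow> norm (u z) powr 1 * 1 = uB z"
      using uae by eventually_elim (use K u0 in \<open>auto simp: subset_iff\<close>)
  qed (use K in auto)
  have i0: "integrable lborel (\<lambda>z. indicator K z * uB z powr p)" if K: "compact K" "K \<subseteq> ?U" for K
  proof (rule set_integrable_borel_version[where f = "\<lambda>z. norm (u z) powr p * 1"])
    show "set_integrable lebesgue K (\<lambda>z. norm (u z) powr p * 1)"
      using up K Usub unfolding Lp_loc_weighted_def by blast
    show "AE z in lborel. z \<in> K \<longrightarrow> norm (u z) powr p * 1 = uB z powr p"
      using uae by eventually_elim (use K u0 in \<open>auto simp: subset_iff\<close>)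
    show "(\<lambda>z. uB z powr p) \<in> borel_measurable borel" by measurable
  qed (use K in auto)
  have i2: "integrable lborel (\<lambda>z. indicator K z * VB z)" if K: "compact K" "K \<subseteq> ?U" for K
  proof (rule set_integrable_borel_version[where f = "\<lambda>z. norm (V z) powr 1 * 1"])
    show "set_integrable lebesgue K (\<lambda>z. norm (V z) powr 1 * 1)"
      using V_loc K Usub unfolding Lp_loc_weighted_def by blast
    show "AE z in lborel. z \<in> K \<longrightarrow> norm (V z) powr 1 * 1 = VB z"
      using Vae by eventually_elim (use K V0 in \<open>auto simp: subset_iff less_imp_le\<close>)
  qed (use K in auto)
  have i3: "integrable lborel (\<lambda>z. indicator K z * (VB z * uB z powr q))" if K: "compact K" "K \<subseteq> ?U" for K
  proof (rule set_integrable_borel_version[where f = "\<lambda>z. norm (u z) powr q * V z"])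
    show "set_integrable lebesgue K (\<lambda>z. norm (u z) powr q * V z)"
      using uq K Usub unfolding Lp_loc_weighted_def by blast
    show "AE z in lborel. z \<in> K \<longrightarrow> norm (u z) powr q * V z = VB z * uB z powr q"
      using Vae uae by eventually_elim (use K u0 in \<open>auto simp: subset_iff\<close>)
    show "(\<lambda>z. VB z * uB z powr q) \<in> borel_measurable borel" by measurable
  qed (use K in auto)
  have i4': "integrable lborel (\<lambda>z. indicator K z * norm (gb z) powr p)" if K: "compact K" "K \<subseteq> ?U" for K
  proof (rule set_integrable_borel_version[where f = "\<lambda>z. norm (G z) powr p * 1"])
    show "set_integrable lebesgue K (\<lambda>z. norm (G z) powr p * 1)"
      using Gp K Usub unfolding Lp_loc_weighted_def by blast
    show "AE z in lborel. z \<in> K \<longrightarrow> norm (G z) powr p * 1 = norm (gb z) powr p"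
      using Gae by eventually_elim (use K in \<open>auto simp: subset_iff\<close>)
    show "(\<lambda>z. norm (gb z) powr p) \<in> borel_measurable borel" by measurable
  qed (use K in auto)
  have XG: "norm (X z) \<le> norm (gb z)" for z
    unfolding X_def using norm_fst_le[of "fst (gb z)" "snd (gb z)"] by simp
  have dom: "integrable lborel (\<lambda>z. indicator K z *\<^sub>R f z)"
    if K: "compact K" "K \<subseteq> ?U" and f: "f \<in> borel_measurable borel"
      and le: "\<And>z. norm (f z) \<le> 1 + norm (gb z) powr p"
    for K and f :: "'a \<times> real \<Rightarrow> 'c::{banach, second_countable_topology}"
  proof (rule Bochner_Integration.integrable_bound)
    note [measurable] = f Kb[OF K(1)]
    show "integrable lborel (\<lambda>z. indicator K z + indicator K z * norm (gb z) powr p)"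
      using i4'[OF K] K Kb[OF K(1)]
      by (intro Bochner_Integration.integrable_add integrable_real_indicator)
         (use emeasure_compact_finite[OF K(1)] in auto)
    show "(\<lambda>z. indicator K z *\<^sub>R f z) \<in> borel_measurable lborel" by measurable
    show "AE z in lborel. norm (indicator K z *\<^sub>R f z) \<le> norm (indicator K z + indicator K z * norm (gb z) powr p)"
      using le by (intro AE_I2) (auto simp: indicator_def intro: order_trans[OF _ abs_ge_self])
  qed
  have le1: "x \<le> 1 + x powr p" and le2: "x powr (p - 1) \<le> 1 + x powr p" if "0 \<le> x" for x :: real
  proof -
    have "x powr b \<le> 1 + x powr p" if "0 < b" "b \<le> p" for b
    proof (cases "x \<le> 1")
      case True
      then have "x powr b \<le> 1" using \<open>0 \<le> x\<close> \<open>0 < b\<close> by (intro powr_le1) auto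
      then show ?thesis by (simp add: add_increasing2)
    next
      case False
      then have "x powr b \<le> x powr p" using \<open>b \<le> p\<close> by (intro powr_mono) auto
      then show ?thesis by simp
    qed
    from this[of 1] this[of "p - 1"] show "x \<le> 1 + x powr p" "x powr (p - 1) \<le> 1 + x powr p"
      using p that by auto
  qed
  have leX: "norm (X z) powr p \<le> norm (gb z) powr p" for z
    using p XG by (intro powr_mono2) auto
  have i4: "integrable lborel (\<lambda>z. indicator K z * norm (X z) powr p)" if K: "compact K" "K \<subseteq> ?U" for K
    using dom[OF K, of "\<lambda>z. norm (X z) powr p"] leX by (simp add: add_increasing)
  have i5': "integrable lborel (\<lambda>z. indicator K z *\<^sub>R gb z)" if K: "compact K" "K \<subseteq> ?U" for K
    by (rule dom[OF K gb(1)]) (rule le1, simp)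
  have i5: "integrable lborel (\<lambda>z. indicator K z *\<^sub>R X z)" if K: "compact K" "K \<subseteq> ?U" for K
    by (rule dom[OF K]) (simp, rule order_trans[OF XG le1], simp)
  have i6: "integrable lborel (\<lambda>z. indicator K z *\<^sub>R (norm (X z) powr (p - 2) *\<^sub>R X z))"
    if K: "compact K" "K \<subseteq> ?U" for K
  proof (rule dom[OF K])
    show "norm (norm (X z) powr (p - 2) *\<^sub>R X z) \<le> 1 + norm (gb z) powr p" for z
    proof -
      have "norm (norm (X z) powr (p - 2) *\<^sub>R X z) = norm (X z) powr (p - 1)"
        using powr_mult_base[of "norm (X z)" "p - 2"] by (simp add: mult.commute)
      also have "\<dots> \<le> 1 + norm (X z) powr p" by (rule le2) simp
      finally show ?thesis using leX[of z] by simp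
    qed
  qed measurable
  have test: "smooth_avg r (\<lambda>z. indicator K z * (VB z * uB z powr q)) z
         \<le> - (\<Sum>i\<in>Basis. smooth_avg_grad r
                (\<lambda>w. (indicator K w *\<^sub>R (norm (X w) powr (p - 2) *\<^sub>R X w)) \<bullet> i) z \<bullet> (i, 0))
           + smooth_avg_grad r (\<lambda>z. indicator K z * uB z) z \<bullet> (0, 1)" (is ?T1)
    "smooth_avg_grad r (\<lambda>z. indicator K z * uB z) z = smooth_avg r (\<lambda>z. indicator K z *\<^sub>R gb z) z" (is ?T2)
    if K: "compact K" "K \<subseteq> ?U" and r: "0 < r" and sub: "cball z r \<subseteq> K" for K z r
  proof -
    note [measurable] = Kb[OF K(1)]
    have [measurable]: "kern r \<in> borel_measurable (borel :: ('a \<times> real) measure)"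
      "kgrad r \<in> borel_measurable (borel :: ('a \<times> real) measure)"
      by (intro borel_measurable_continuous_onI kern_continuous_UNIV kgrad_continuous_UNIV)+
    have [measurable]: "(\<lambda>w. fst (kgrad r (z - w))) \<in> borel_measurable borel"
      "(\<lambda>w. snd (kgrad r (z - w))) \<in> borel_measurable borel"
      by (intro borel_measurable_continuous_onI continuous_intros)+
    have k0: "kern r (z - w) = 0" "kgrad r (z - w) = 0" if "w \<notin> K" for w
    proof -
      have "norm (z - w) \<ge> r" using that sub by (force simp: dist_norm)
      then show "kern r (z - w) = 0" "kgrad r (z - w) = 0" using r by (auto simp: kern_zero kgrad_zero)
    qed
    have KU: "w \<in> ?U" "indicator ?U w = (1 :: real)" if "w \<in> K" for w
      using that K(2) by (blast, metis indicator_simps(1) subsetD)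
    let ?\<phi> = "\<lambda>w. kern r (z - w)"
    let ?A = "\<lambda>w. indicator K w *\<^sub>R (norm (X w) powr (p - 2) *\<^sub>R X w)"
    have L1: "(LINT w:?U|lebesgue. V w * u w powr q * ?\<phi> w)
        = smooth_avg r (\<lambda>z. indicator K z * (VB z * uB z powr q)) z"
      unfolding set_lebesgue_integral_def smooth_avg_def
    proof (rule lebesgue_AE_eq_borel(2))
      show "AE w in lborel. indicator ?U w *\<^sub>R (V w * u w powr q * ?\<phi> w)
          = ?\<phi> w *\<^sub>R (indicator K w * (VB w * uB w powr q))"
        using uae Vae
      proof eventually_elim
        case (elim w)
        show ?case
        proof (cases "w \<in> K")
          case True
          with elim KU[OF True] show ?thesis by (simp)
        next
          case False
          then show ?thesis using k0[of w] by (simp)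
        qed
      qed
    qed measurable
    have L2: "(LINT (x, t):?U|lebesgue. norm (fst (G (x, t))) powr (p - 2) *
                (fst (G (x, t)) \<bullet> gradient (\<lambda>y. ?\<phi> (y, t)) x))
        = (\<integral>w. - (?A w \<bullet> fst (kgrad r (z - w))) \<partial>lborel)"
      unfolding set_lebesgue_integral_def
    proof (rule lebesgue_AE_eq_borel(2))
      show "AE w in lborel. indicator ?U w *\<^sub>R (case w of (x, t) \<Rightarrow> norm (fst (G (x, t))) powr (p - 2) *
                (fst (G (x, t)) \<bullet> gradient (\<lambda>y. ?\<phi> (y, t)) x)) = - (?A w \<bullet> fst (kgrad r (z - w)))"
        using Gae
      proof eventually_elim
        case (elim w)
        obtain x t where w: "w = (x, t)" by (cases w)
        have gr: "gradient (\<lambda>y. ?\<phi> (y, t)) x = - fst (kgrad r (z - w))"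
          using gradient_slice_fst[OF kern_reflected_has_grad[of r z "(x, t)"]] by (simp add: w)
        show ?case
        proof (cases "w \<in> K")
          case True
          with elim KU[OF True] show ?thesis by (simp add: gr[unfolded w] w X_def)
        next
          case False
          then show ?thesis using k0[of w] by (simp add: gr[unfolded w] w X_def)
        qed
      qed
    qed measurable
    have L3: "(LINT (x, t):?U|lebesgue. u (x, t) * gradient (\<lambda>s. ?\<phi> (x, s)) t)
        = (\<integral>w. - (indicator K w * uB w * snd (kgrad r (z - w))) \<partial>lborel)"
      unfolding set_lebesgue_integral_def
    proof (rule lebesgue_AE_eq_borel(2))
      show "AE w in lborel. indicator ?U w *\<^sub>R (case w of (x, t) \<Rightarrow> u (x, t) * gradient (\<lambda>s. ?\<phi> (x, s)) t)
         = - (indicator K w * uB w * snd (kgrad r (z - w)))"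
        using uae
      proof eventually_elim
        case (elim w)
        obtain x t where w: "w = (x, t)" by (cases w)
        have gr: "gradient (\<lambda>s. ?\<phi> (x, s)) t = - snd (kgrad r (z - w))"
          using gradient_slice_snd[OF kern_reflected_has_grad[of r z "(x, t)"]] by (simp add: w)
        show ?case
        proof (cases "w \<in> K")
          case True
          with elim KU[OF True] show ?thesis by (simp add: gr[unfolded w] w)
        next
          case False
          then show ?thesis using k0[of w] by (simp add: gr[unfolded w] w)
        qed
      qed
    qed measurable
    have L4: "(LINT x:\<Omega>|lebesgue. u0 x * ?\<phi> (x, 0)) = 0"
    proof -
      have "?\<phi> (x, 0) = 0" for x by (rule k0) (use K(2) in auto)
      then show ?thesis by (simp add: set_lebesgue_integral_def)
    qed
    have iA: "integrable lborel ?A" by (rule i6[OF K])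
    have iAi: "integrable lborel (\<lambda>w. ?A w \<bullet> i)" for i by (rule integrable_inner_left[OF iA])
    have iAk: "integrable lborel (\<lambda>w. (?A w \<bullet> i) * (kgrad r (z - w) \<bullet> (i, 0)))" for i
      using integrable_inner_left[OF smooth_avg_grad_integrable[OF r iAi, of i z], of "(i, 0)"] by simp
    have R2: "(\<integral>w. - (?A w \<bullet> fst (kgrad r (z - w))) \<partial>lborel)
       = - (\<Sum>i\<in>Basis. smooth_avg_grad r (\<lambda>w. ?A w \<bullet> i) z \<bullet> (i, 0))"
    proof -
      have "smooth_avg_grad r (\<lambda>w. ?A w \<bullet> i) z \<bullet> (i, 0)
          = (\<integral>w. (?A w \<bullet> i) * (kgrad r (z - w) \<bullet> (i, 0)) \<partial>lborel)" for i
        unfolding smooth_avg_grad_def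
        using integral_inner_left[OF smooth_avg_grad_integrable[OF r iAi, of i z], of "(i, 0)"] by simp
      then have "(\<Sum>i\<in>Basis. smooth_avg_grad r (\<lambda>w. ?A w \<bullet> i) z \<bullet> (i, 0))
          = (\<integral>w. (\<Sum>i\<in>Basis. (?A w \<bullet> i) * (kgrad r (z - w) \<bullet> (i, 0))) \<partial>lborel)"
        using iAk by (subst Bochner_Integration.integral_sum) auto
      also have "(\<lambda>w. \<Sum>i\<in>Basis. (?A w \<bullet> i) * (kgrad r (z - w) \<bullet> (i, 0))) = (\<lambda>w. ?A w \<bullet> fst (kgrad r (z - w)))"
      proof
        fix w
        have "kgrad r (z - w) \<bullet> (i, 0) = fst (kgrad r (z - w)) \<bullet> i" for i by (simp add: inner_prod_def)
        then show "(\<Sum>i\<in>Basis. (?A w \<bullet> i) * (kgrad r (z - w) \<bullet> (i, 0))) = ?A w \<bullet> fst (kgrad r (z - w))"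
          by (subst euclidean_inner) simp
      qed
      finally show ?thesis by simp
    qed
    have R3: "(\<integral>w. - (indicator K w * uB w * snd (kgrad r (z - w))) \<partial>lborel)
        = - (smooth_avg_grad r (\<lambda>z. indicator K z * uB z) z \<bullet> (0, 1))"
    proof -
      have "kgrad r (z - w) \<bullet> (0, 1) = snd (kgrad r (z - w))" for w by (simp add: inner_prod_def)
      then show ?thesis
        unfolding smooth_avg_grad_def
        using integral_inner_left[OF smooth_avg_grad_integrable[OF r i1[OF K], of z], of "(0, 1)"] by simp
    qed
    show ?T1
      using weak[OF kern_Lip_test[OF r order_trans[OF sub order_trans[OF K(2) Usub]]]]
      unfolding L1 L2 L3 L4 R2 R3 by simp
    have "(LINT w:?U|lebesgue. u w *\<^sub>R gradient ?\<phi> w) = - (LINT w:?U|lebesgue. ?\<phi> w *\<^sub>R G w)"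
      using wg kern_Cc_infinity[OF r order_trans[OF sub K(2)]] unfolding is_weak_gradient_def by blast
    also have "(LINT w:?U|lebesgue. u w *\<^sub>R gradient ?\<phi> w)
        = (\<integral>w. - ((indicator K w * uB w) *\<^sub>R kgrad r (z - w)) \<partial>lborel)"
      unfolding set_lebesgue_integral_def
    proof (rule lebesgue_AE_eq_borel(2))
      show "AE w in lborel. indicator ?U w *\<^sub>R u w *\<^sub>R gradient ?\<phi> w
         = - ((indicator K w * uB w) *\<^sub>R kgrad r (z - w))"
        using uae
      proof eventually_elim
        case (elim w)
        have gr: "gradient ?\<phi> w = - kgrad r (z - w)"
          by (rule gradient_eqI) (rule kern_reflected_has_grad[unfolded has_grad_def])
        show ?case
        proof (cases "w \<in> K")
          case True
          with elim KU[OF True] show ?thesis by (simp add: gr)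
        next
          case False
          then show ?thesis using k0[of w] by (simp add: gr)
        qed
      qed
    qed measurable
    also have "\<dots> = - smooth_avg_grad r (\<lambda>z. indicator K z * uB z) z"
      by (simp add: smooth_avg_grad_def)
    also have "(LINT w:?U|lebesgue. ?\<phi> w *\<^sub>R G w) = smooth_avg r (\<lambda>z. indicator K z *\<^sub>R gb z) z"
      unfolding set_lebesgue_integral_def smooth_avg_def
    proof (rule lebesgue_AE_eq_borel(2))
      show "AE w in lborel. indicator ?U w *\<^sub>R ?\<phi> w *\<^sub>R G w = ?\<phi> w *\<^sub>R indicator K w *\<^sub>R gb w"
        using Gae
      proof eventually_elim
        case (elim w)
        show ?case
        proof (cases "w \<in> K")
          case True
          with elim KU[OF True] show ?thesis by (simp)
        next
          case False
          then show ?thesis using k0[of w] by (simp)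
        qed
      qed
    qed measurable
    finally show ?T2 by simp
  qed
  have T2: "smooth_avg_grad r (\<lambda>z. indicator K z * uB z) z \<bullet> (i, 0)
         = smooth_avg r (\<lambda>z. indicator K z *\<^sub>R X z) z \<bullet> i"
    if K: "compact K" "K \<subseteq> ?U" and r: "0 < r" and sub: "cball z r \<subseteq> K" for K z r i
  proof -
    have "(indicator K w *\<^sub>R gb w) \<bullet> (i, 0) = (indicator K w *\<^sub>R X w) \<bullet> i" for w
      by (simp add: X_def inner_prod_def)
    then show ?thesis
      unfolding test(2)[OF that] smooth_avg_inner[OF r i5'[OF K], symmetric] smooth_avg_inner[OF r i5[OF K], symmetric]
      by (simp only:)
  qed
  have meas: "uB \<in> borel_measurable borel" "VB \<in> borel_measurable borel" "X \<in> borel_measurable borel"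
    by measurable
  have "regular_supersolution p q ?U uB VB X"
    by (rule regular_supersolution.intro)
       (assumption | rule meas u0 V0 i0 i1 i2 i3 i4 i5 i6 test(1) T2)+
  then show thesis using uae Vae by (rule that)
qed

text \<open>
  The energy inequality for test functions \<open>\<zeta>\<close> with compact support in \<open>U\<close>: a compact
  neighbourhood \<open>K\<close> of the support contains all the balls of averaging, and outside of the support
  every term vanishes, so that the indicators of \<open>K\<close> disappear from the conclusion.
\<close>

lemma regular_supersolution_energy:
  fixes u V \<zeta> :: "'a::euclidean_space \<times> real \<Rightarrow> real" and X :: "'a \<times> real \<Rightarrow> 'a" and p q \<epsilon> a :: real
  assumes sol: "regular_supersolution p q U u V X" and p: "p > 1" and U: "open U"
    and grad: "\<And>z. has_grad \<zeta> (\<zeta>' z) z" and cont: "continuous_on UNIV \<zeta>'"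
    and S: "compact S" "S \<subseteq> U" "\<And>z. z \<notin> S \<Longrightarrow> \<zeta> z = 0" and \<zeta>0: "\<And>z. 0 \<le> \<zeta> z"
    and \<epsilon>: "\<epsilon> > 0" and a: "0 < a" "a < 1"
  defines "v \<equiv> \<lambda>z. u z + \<epsilon>"
  defines "D \<equiv> \<lambda>z. v z powr (- a) * ((norm (X z) powr (p - 2) *\<^sub>R X z) \<bullet> fst (\<zeta>' z))
            - a * \<zeta> z * v z powr (- a - 1) * norm (X z) powr p
            - snd (\<zeta>' z) * (v z powr (1 - a) / (1 - a))"
  shows "integrable lborel (\<lambda>z. V z * u z powr q * \<zeta> z * v z powr (- a))" "integrable lborel D"
    "(\<integral>z. V z * u z powr q * \<zeta> z * v z powr (- a) \<partial>lborel) \<le> (\<integral>z. D z \<partial>lborel)"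
proof -
  obtain r0 where r0: "r0 > 0" "(\<Union>x\<in>S. cball x r0) \<subseteq> U"
    using compact_subset_open_imp_cball_epsilon_subset[OF S(1) U S(2)] by blast
  define K where "K = (\<Union>x\<in>S. \<Union>y\<in>cball 0 r0. {x + y})"
  have "compact K" unfolding K_def by (intro compact_sums' S compact_cball)
  have K_eq: "K = (\<Union>x\<in>S. cball x r0)"
  proof (intro equalityI subsetI)
    fix w assume "w \<in> (\<Union>x\<in>S. cball x r0)"
    then obtain x where "x \<in> S" "dist x w \<le> r0" by auto
    then show "w \<in> K" unfolding K_def
      by (intro UN_I[of x] UN_I[of "w - x"]) (auto simp: dist_norm norm_minus_commute)
  next
    fix w assume "w \<in> K"
    then obtain x y where "x \<in> S" "norm y \<le> r0" "w = x + y" 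
      unfolding K_def UN_iff singleton_iff Bex_def mem_cball_0 by metis
    then show "w \<in> (\<Union>x\<in>S. cball x r0)" by (intro UN_I[of x]) (simp_all add: dist_norm)
  qed
  have K: "compact K" "K \<subseteq> U" using \<open>compact K\<close> r0 by (auto simp: K_eq)
  have SK: "S \<subseteq> K" unfolding K_eq using r0 by force
  have ball: "cball z r \<subseteq> K" if "r < r0" "z \<in> S" for z r
    unfolding K_eq using subset_cball[OF less_imp_le[OF that(1)], of z] that(2) by blast
  note sol' = regular_supersolution.u_integrable[OF sol] regular_supersolution.Vu_integrable[OF sol]
    regular_supersolution.X_powr_integrable[OF sol] regular_supersolution.X_integrable[OF sol]
    regular_supersolution.flux_integrable[OF sol]
  have u0: "0 \<le> u z" for z by (rule regular_supersolution.u_nonneg[OF sol])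
  let ?u = "\<lambda>z. indicator K z * u z" and ?W = "\<lambda>z. indicator K z * (V z * u z powr q)"
  let ?X = "\<lambda>z. indicator K z *\<^sub>R X z"
  have A_eq: "(\<lambda>z. norm (?X z) powr (p - 2) *\<^sub>R ?X z) = (\<lambda>z. indicator K z *\<^sub>R (norm (X z) powr (p - 2) *\<^sub>R X z))"
    and P_eq: "(\<lambda>z. norm (?X z) powr p) = (\<lambda>z. indicator K z * norm (X z) powr p)"
    by (auto simp: indicator_def fun_eq_iff)
  have int: "integrable lborel ?u" "integrable lborel ?W"
     "integrable lborel (\<lambda>z. norm (?X z) powr (p - 2) *\<^sub>R ?X z)" "integrable lborel ?X"
     "integrable lborel (\<lambda>z. norm (?X z) powr p)"
    unfolding A_eq P_eq by (intro sol' K)+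
  have u0': "0 \<le> ?u z" for z using u0 by simp
  have eq: "smooth_avg r ?W z \<le> - (\<Sum>i\<in>Basis. smooth_avg_grad r
                (\<lambda>w. (norm (?X w) powr (p - 2) *\<^sub>R ?X w) \<bullet> i) z \<bullet> (i, 0))
           + smooth_avg_grad r ?u z \<bullet> (0, 1)" if "0 < r" "r < r0" "z \<in> S" for r z
  proof -
    have "(\<lambda>w. (norm (?X w) powr (p - 2) *\<^sub>R ?X w) \<bullet> i) =
        (\<lambda>w. (indicator K w *\<^sub>R (norm (X w) powr (p - 2) *\<^sub>R X w)) \<bullet> i)" for i
      by (rule ext) (simp only: A_eq[THEN fun_cong])
    then show ?thesis using regular_supersolution.mollified_inequality[OF sol K that(1) ball[OF that(2,3)]] by (simp only:)
  qed
  have gx: "smooth_avg_grad r ?u z \<bullet> (i, 0) = smooth_avg r ?X z \<bullet> i"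
    if "0 < r" "r < r0" "z \<in> S" "i \<in> Basis" for r z i
    by (rule regular_supersolution.mollified_gradient[OF sol K that(1) ball[OF that(2,3)] that(4)])
  note E = energy_inequality[OF p int u0' grad cont S(1,3) \<zeta>0 r0(1) _ _ \<epsilon> a]
  have \<zeta>'0: "\<zeta>' z = 0" if "z \<notin> S" for z
    using has_grad_zero_off_closed[OF grad compact_imp_closed[OF S(1)] S(3) that] by blast
  have KS: "indicator K z = (1 :: real)" if "z \<in> S" for z
    using SK that by (metis indicator_simps(1) subsetD)
  have W_eq: "(\<lambda>z. ?W z * \<zeta> z * (?u z + \<epsilon>) powr (- a)) = (\<lambda>z. V z * u z powr q * \<zeta> z * v z powr (- a))"
  proof
    fix z
    show "?W z * \<zeta> z * (?u z + \<epsilon>) powr (- a) = V z * u z powr q * \<zeta> z * v z powr (- a)"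
      using S(3)[of z] by (cases "z \<in> S") (simp_all add: v_def KS)
  qed
  have D_eq: "(\<lambda>z. (?u z + \<epsilon>) powr (- a) * ((norm (?X z) powr (p - 2) *\<^sub>R ?X z) \<bullet> fst (\<zeta>' z))
       - a * \<zeta> z * (?u z + \<epsilon>) powr (- a - 1) * norm (?X z) powr p
       - snd (\<zeta>' z) * ((?u z + \<epsilon>) powr (1 - a) / (1 - a))) = D"
  proof
    fix z
    show "(?u z + \<epsilon>) powr (- a) * ((norm (?X z) powr (p - 2) *\<^sub>R ?X z) \<bullet> fst (\<zeta>' z))
       - a * \<zeta> z * (?u z + \<epsilon>) powr (- a - 1) * norm (?X z) powr p
       - snd (\<zeta>' z) * ((?u z + \<epsilon>) powr (1 - a) / (1 - a)) = D z"
      using S(3)[of z] \<zeta>'0[of z] by (cases "z \<in> S") (simp_all add: v_def D_def KS)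
  qed
  show "integrable lborel (\<lambda>z. V z * u z powr q * \<zeta> z * v z powr (- a))"
    unfolding W_eq[symmetric] by (rule E(1)) (assumption, fact eq, fact gx)
  show "integrable lborel D"
    unfolding D_eq[symmetric] by (rule E(2)) (assumption, fact eq, fact gx)
  show "(\<integral>z. V z * u z powr q * \<zeta> z * v z powr (- a) \<partial>lborel) \<le> (\<integral>z. D z \<partial>lborel)"
    unfolding W_eq[symmetric] D_eq[symmetric] by (rule E(3)) (assumption, fact eq, fact gx)
qed

section \<open>The capacity estimate\<close>

text \<open>
  A crude form of Young's inequality, by comparing \<open>y\<close> with \<open>k * x\<close>: the constants need only be
  explicit enough to stay bounded when the parameters vary.
\<close>

lemma young_power:
  fixes x y k p :: real
  assumes p: "p > 1" and x: "x \<ge> 0" and y: "y \<ge> 0" and k: "k > 0"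
  shows "x powr (p - 1) * y \<le> k * x powr p + (y / k) powr (p - 1) * y"
proof (cases "y \<le> k * x")
  case True
  have "x powr (p - 1) * y \<le> x powr (p - 1) * (k * x)"
    using True by (intro mult_left_mono) auto
  also have "\<dots> = k * x powr p"
    using powr_mult_base[OF x, of "p - 1"] by (simp add: mult_ac)
  finally show ?thesis using y k by (simp add: add_increasing2)
next
  case False
  then have "x \<le> y / k" using k by (simp add: field_simps)
  then have "x powr (p - 1) \<le> (y / k) powr (p - 1)"
    using x p by (intro powr_mono2) auto
  then have "x powr (p - 1) * y \<le> (y / k) powr (p - 1) * y"
    using y by (rule mult_right_mono)
  then show ?thesis using k by (simp add: add_increasing)
qed

text \<open>
  Compare \<open>c * \<phi> powr (n - l)\<close> with \<open>(V / 4) * \<phi> ^ n * u powr (b - m)\<close>. If it is larger, then \<open>u\<close> is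
  bounded in terms of the other quantities, and the power of \<open>\<phi>\<close> that is left over is nonnegative by
  the assumption on \<open>n\<close>. The constants stay bounded when \<open>m\<close> and \<open>b\<close> vary.
\<close>

lemma young_absorb:
  fixes c \<phi> V u m b l :: real
  assumes c: "c \<ge> 0" and \<phi>: "0 \<le> \<phi>" "\<phi> \<le> 1" and V: "V > 0" and u: "u \<ge> 0" and m: "0 < m" "m < b"
    and n: "real n \<ge> l * (b / (b - m))" and l: "l > 0"
  shows "c * \<phi> powr (real n - l) * u powr m
     \<le> (V / 4) * \<phi> ^ n * u powr b + c powr (b / (b - m)) * (V / 4) powr (- (m / (b - m)))"
proof (cases "c = 0 \<or> \<phi> = 0 \<or> u = 0")
  case True
  then show ?thesis using V \<phi> by auto
next
  case False
  then have pos: "c > 0" "\<phi> > 0" "u > 0" using c \<phi> u by auto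
  define k where "k = (V / 4) * \<phi> powr real n"
  define y where "y = c * \<phi> powr (real n - l)"
  have k: "k > 0" and y: "y > 0" using pos V by (auto simp: k_def y_def)
  have bm: "b - m > 0" using m by simp
  define e where "e = m / (b - m)"
  have ex: "1 + m / (b - m) = b / (b - m)" using bm by (simp add: field_simps)
  show ?thesis
  proof (cases "y \<le> k * u powr (b - m)")
    case True
    have "y * u powr m \<le> (k * u powr (b - m)) * u powr m"
      using True by (intro mult_right_mono) auto
    also have "\<dots> = k * u powr b" by (simp add: powr_add[symmetric])
    finally show ?thesis using pos V
      by (simp add: k_def y_def powr_realpow add_increasing2)
  next
    case False
    have "u powr m = (u powr (b - m)) powr (m / (b - m))"
      using bm by (simp add: powr_powr)
    also have "\<dots> \<le> (y / k) powr (m / (b - m))"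
      using False k bm m by (intro powr_mono2) (auto simp: field_simps)
    finally have "y * u powr m \<le> y * (y / k) powr (m / (b - m))"
      using y by (intro mult_left_mono) auto
    also have "\<dots> = y powr (1 + e) * k powr (- e)"
      using y k by (simp add: e_def powr_divide powr_minus_divide powr_add)
    also have "y powr (1 + e) = c powr (1 + e) * \<phi> powr ((real n - l) * (1 + e))"
      using pos by (simp only: y_def powr_mult powr_powr less_imp_le powr_ge_zero)
    also have "k powr (- e) = (V / 4) powr (- e) * \<phi> powr (real n * - e)"
      using V powr_mult[of "V / 4" "\<phi> powr real n" "- e"] by (simp only: k_def powr_powr powr_ge_zero)
    also have "c powr (1 + e) * \<phi> powr ((real n - l) * (1 + e)) * ((V / 4) powr (- e) * \<phi> powr (real n * - e))
       = c powr (1 + e) * (V / 4) powr (- e) * \<phi> powr (real n - l * (1 + e))"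
    proof -
      have "real n - l * (1 + e) = (real n - l) * (1 + e) + real n * - e" by (simp add: algebra_simps)
      then show ?thesis by (simp only: powr_add mult_ac)
    qed
    also have "\<dots> \<le> c powr (1 + e) * (V / 4) powr (- e) * 1"
      using n \<phi> by (intro mult_left_mono) (auto intro!: powr_le1 simp: ex[symmetric] e_def)
    also have "c powr (1 + e) * (V / 4) powr (- e) * 1 = c powr (b / (b - m)) * (V / 4) powr (- (m / (b - m)))"
      unfolding e_def ex by simp
    finally show ?thesis using pos V
      by (simp add: y_def add_increasing)
  qed
qed

text \<open>
  Young's inequality against the good term \<open>a * \<phi> ^ n * v powr (- a - 1) * norm x powr p\<close> removes
  the gradient of the solution at the price of the factor \<open>a powr (1 - p)\<close>. As \<open>\<eta>\<close> is increasing in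
  time, the term with its derivative \<open>\<eta>t\<close> has the favourable sign.
\<close>

lemma energy_density_bound:
  fixes x g :: "'a::euclidean_space" and v \<phi> \<eta> \<eta>t gt a p :: real
  assumes p: "p > 1" and a: "0 < a" "a < 1" and v: "v > 0" and \<phi>: "0 \<le> \<phi>" and \<eta>: "0 \<le> \<eta>" "0 \<le> \<eta>t"
    and n: "real n > p"
  shows "v powr (- a) * ((norm x powr (p - 2) *\<^sub>R x) \<bullet> (\<eta> *\<^sub>R (real n * \<phi> ^ (n - 1)) *\<^sub>R g))
       - a * (\<phi> ^ n * \<eta>) * v powr (- a - 1) * norm x powr p
       - (\<phi> ^ n * \<eta>t + \<eta> * (real n * \<phi> ^ (n - 1)) * gt) * (v powr (1 - a) / (1 - a))
     \<le> \<eta> * ((a powr (1 - p) * (real n * norm g) powr p) * \<phi> powr (real n - p) * v powr (p - 1 - a)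
          + (real n * \<bar>gt\<bar> / (1 - a)) * \<phi> powr (real n - 1) * v powr (1 - a))"
proof -
  have n1: "n \<ge> 1" using n p by linarith
  have T: "- (\<phi> ^ n * \<eta>t + \<eta> * (real n * \<phi> ^ (n - 1)) * gt) * (v powr (1 - a) / (1 - a))
      \<le> \<eta> * ((real n * \<bar>gt\<bar> / (1 - a)) * \<phi> powr (real n - 1) * v powr (1 - a))"
  proof -
    have pw: "\<phi> ^ (n - 1) = \<phi> powr (real n - 1)" if "\<phi> > 0"
      using that n1 by (simp add: powr_realpow[symmetric] of_nat_diff)
    have "- (\<phi> ^ n * \<eta>t + \<eta> * (real n * \<phi> ^ (n - 1)) * gt) \<le> \<eta> * (real n * \<phi> ^ (n - 1)) * \<bar>gt\<bar>"
    proof -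
      have "\<eta> * (real n * \<phi> ^ (n - 1)) * (- gt) \<le> \<eta> * (real n * \<phi> ^ (n - 1)) * \<bar>gt\<bar>"
        using \<eta> \<phi> by (intro mult_left_mono) auto
      moreover have "0 \<le> \<phi> ^ n * \<eta>t" using \<phi> \<eta> by simp
      ultimately show ?thesis by simp
    qed
    then have "- (\<phi> ^ n * \<eta>t + \<eta> * (real n * \<phi> ^ (n - 1)) * gt) * (v powr (1 - a) / (1 - a))
        \<le> \<eta> * (real n * \<phi> ^ (n - 1)) * \<bar>gt\<bar> * (v powr (1 - a) / (1 - a))"
      using a by (intro mult_right_mono) auto
    also have "\<dots> = \<eta> * ((real n * \<bar>gt\<bar> / (1 - a)) * \<phi> powr (real n - 1) * v powr (1 - a))"
    proof (cases "\<phi> = 0")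
      case True
      then have "\<phi> ^ (n - 1) = 0" using n p n1 by (simp add: power_0_left) 
      then show ?thesis using True by simp
    next
      case False
      then show ?thesis using pw \<phi> by (simp add: mult_ac)
    qed
    finally show ?thesis .
  qed
  have G: "v powr (- a) * ((norm x powr (p - 2) *\<^sub>R x) \<bullet> (\<eta> *\<^sub>R (real n * \<phi> ^ (n - 1)) *\<^sub>R g))
       - a * (\<phi> ^ n * \<eta>) * v powr (- a - 1) * norm x powr p
     \<le> \<eta> * ((a powr (1 - p) * (real n * norm g) powr p) * \<phi> powr (real n - p) * v powr (p - 1 - a))"
  proof (cases "\<phi> = 0")
    case True
    then have z: "\<phi> ^ (n - 1) = 0" "\<phi> ^ n = 0" using n p n1 by (simp_all add: power_0_left)
    show ?thesis unfolding z using \<eta> by simp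
  next
    case False
    then have f: "\<phi> > 0" using \<phi> by simp
    define w where "w = \<eta> * \<phi> ^ (n - 1) * v powr (- a)"
    have w: "w \<ge> 0" using \<eta> f by (simp add: w_def)
    define y where "y = real n * norm g"
    have y: "y \<ge> 0" by (simp add: y_def)
    define k where "k = a * \<phi> / v"
    have k: "k > 0" using a f v by (simp add: k_def)
    have phin: "\<phi> ^ n = \<phi> ^ (n - 1) * \<phi>" using n1 by (metis power_minus_mult zero_less_one less_le_trans)
    have nx: "norm x powr (p - 2) * norm x = norm x powr (p - 1)"
      using powr_mult_base[of "norm x" "p - 2"] by (simp add: mult.commute)
    have "(norm x powr (p - 2) *\<^sub>R x) \<bullet> g \<le> norm x powr (p - 1) * norm g"
    proof -
      have "norm x powr (p - 2) * (x \<bullet> g) \<le> norm x powr (p - 2) * (norm x * norm g)"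
        using norm_cauchy_schwarz[of x g] by (intro mult_left_mono) auto
      then show ?thesis using nx by (simp add: mult.assoc[symmetric])
    qed
    then have "w * real n * ((norm x powr (p - 2) *\<^sub>R x) \<bullet> g) \<le> w * real n * (norm x powr (p - 1) * norm g)"
      using w by (intro mult_left_mono) auto
    then have 1: "v powr (- a) * ((norm x powr (p - 2) *\<^sub>R x) \<bullet> (\<eta> *\<^sub>R (real n * \<phi> ^ (n - 1)) *\<^sub>R g))
        \<le> w * (norm x powr (p - 1) * y)"
      by (simp add: w_def y_def mult_ac)
    have 2: "a * (\<phi> ^ n * \<eta>) * v powr (- a - 1) * norm x powr p = w * (k * norm x powr p)"
      using v by (simp add: w_def k_def phin powr_diff field_simps)
    have "w * (norm x powr (p - 1) * y) \<le> w * (k * norm x powr p + (y / k) powr (p - 1) * y)"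
      using young_power[OF p norm_ge_zero y k] w by (rule mult_left_mono)
    then have "v powr (- a) * ((norm x powr (p - 2) *\<^sub>R x) \<bullet> (\<eta> *\<^sub>R (real n * \<phi> ^ (n - 1)) *\<^sub>R g))
       - a * (\<phi> ^ n * \<eta>) * v powr (- a - 1) * norm x powr p \<le> w * ((y / k) powr (p - 1) * y)"
      using 1 2 distrib_left[of w "k * norm x powr p" "(y / k) powr (p - 1) * y"] by linarith
    also have "\<dots> = \<eta> * ((a powr (1 - p) * y powr p) * \<phi> powr (real n - p) * v powr (p - 1 - a))"
    proof (cases "y = 0")
      case False
      then have y0: "y > 0" using y by simp
      have "(y / k) powr (p - 1) * y = (y powr (p - 1) * y) * k powr (1 - p)"
        using y0 k powr_minus_divide[of k "p - 1"] by (simp add: powr_divide)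
      also have "y powr (p - 1) * y = y powr p"
        using y0 powr_mult_base[of y "p - 1"] by (simp add: mult.commute)
      also have "k powr (1 - p) = a powr (1 - p) * \<phi> powr (1 - p) * v powr (p - 1)"
        using a f v powr_minus_divide[of v "p - 1"] powr_minus_divide[of v "1 - p"]
        by (simp add: k_def powr_divide powr_mult)
      also have "w * (y powr p * (a powr (1 - p) * \<phi> powr (1 - p) * v powr (p - 1))) =
        \<eta> * ((a powr (1 - p) * y powr p) * (\<phi> ^ (n - 1) * \<phi> powr (1 - p)) * (v powr (- a) * v powr (p - 1)))"
        by (simp only: w_def mult_ac)
      also have "\<phi> ^ (n - 1) * \<phi> powr (1 - p) = \<phi> powr (real n - p)"
      proof -
        have "\<phi> ^ (n - 1) = \<phi> powr (real n - 1)"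
          using f n1 by (simp add: powr_realpow[symmetric] of_nat_diff)
        then show ?thesis by (simp add: powr_add[symmetric])
      qed
      also have "v powr (- a) * v powr (p - 1) = v powr (p - 1 - a)"
        by (simp add: powr_add[symmetric])
      finally show ?thesis .
    qed simp
    finally show ?thesis by (simp add: y_def)
  qed
  show ?thesis using G T by (simp add: algebra_simps)
qed

lemma ennreal_absorb_half:
  assumes "J \<le> ennreal (1/2) * J + R" "J < \<infinity>"
  shows "J \<le> 2 * R"
proof (cases "R = \<infinity>")
  case True
  then show ?thesis by (simp add: ennreal_mult_top)
next
  case False
  obtain j where j: "J = ennreal j" "0 \<le> j" using assms(2) by (cases J) auto
  obtain s where s: "R = ennreal s" "0 \<le> s" using False by (cases R) auto
  have "ennreal j \<le> ennreal (1/2 * j + s)"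
    using assms(1) unfolding j(1) s(1)
    by (subst ennreal_plus) (use j s in \<open>simp_all only: ennreal_mult mult_nonneg_nonneg zero_le_divide_1_iff zero_le_numeral\<close>)
  then have "j \<le> 1/2 * j + s"
    by (subst (asm) ennreal_le_iff) (use j s in simp_all)
  then have "j \<le> 2 * s" by simp
  then have "ennreal j \<le> ennreal (2 * s)" by (rule ennreal_leI)
  then show ?thesis using j s by (simp add: ennreal_mult)
qed

text \<open>
  The energy inequality with \<open>\<zeta> = \<phi> ^ n * \<eta>\<close> and \<open>v = u + \<epsilon>\<close>, in which \<open>\<epsilon>\<close> tends to zero. Then
  \<open>young_absorb\<close>, applied to each of the two powers of \<open>u\<close> on the right, trades them for half of the
  left-hand side, which is finite, plus \<open>R\<close>. Only the derivatives of the cut-off and powers of \<open>V\<close> with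
  the exponents of the hypotheses on \<open>V\<close> are left in \<open>R\<close>.
\<close>

lemma capacity_estimate:
  fixes u V \<phi> :: "'a::euclidean_space \<times> real \<Rightarrow> real" and X :: "'a \<times> real \<Rightarrow> 'a" and p q a :: real
    and \<eta> \<eta>' :: "real \<Rightarrow> real" and n :: nat
  assumes sol: "regular_supersolution p q U u V X" and p: "p > 1" and q: "q > p - 1" "q > 1" and U: "open U"
    and grad: "\<And>z. has_grad \<phi> (\<phi>' z) z" and cont: "continuous_on UNIV \<phi>'"
    and \<phi>: "\<And>z. 0 \<le> \<phi> z" "\<And>z. \<phi> z \<le> 1"
    and \<eta>: "\<And>t. (\<eta> has_real_derivative \<eta>' t) (at t)" "continuous_on UNIV \<eta>'"
      "\<And>t. 0 \<le> \<eta> t" "\<And>t. \<eta> t \<le> 1" "\<And>t. 0 \<le> \<eta>' t"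
    and S: "compact S" "S \<subseteq> U" "\<And>z. z \<notin> S \<Longrightarrow> \<phi> z = 0 \<or> \<eta> (snd z) = 0"
    and n: "real n > p" "real n \<ge> p * (q / (q - p + 1))" "real n \<ge> q / (q - 1)"
    and a: "0 < a" "a < 1" "a < p - 1"
  defines "R \<equiv> \<lambda>z. (a powr (1 - p) * (real n * norm (fst (\<phi>' z))) powr p) powr ((q - a) / (q - p + 1))
           * (V z / 4) powr (- ((p - 1 - a) / (q - p + 1)))
         + (real n * \<bar>snd (\<phi>' z)\<bar> / (1 - a)) powr ((q - a) / (q - 1)) * (V z / 4) powr (- ((1 - a) / (q - 1)))"
  shows "(\<integral>\<^sup>+z. ennreal (V z * u z powr (q - a) * (\<phi> z ^ n * \<eta> (snd z))) \<partial>lborel)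
       \<le> 2 * (\<integral>\<^sup>+z. ennreal (\<eta> (snd z) * R z) \<partial>lborel)"
proof -
  note [measurable] = regular_supersolution.u_borel[OF sol] regular_supersolution.V_borel[OF sol]
  have n1: "n \<ge> 1" "real n > 1" using n p by auto
  have c\<phi>: "continuous_on UNIV \<phi>" by (rule has_grad_continuous[OF grad])
  have c\<eta>: "continuous_on T \<eta>" for T
    by (intro continuous_at_imp_continuous_on ballI DERIV_isCont[OF \<eta>(1)])
  have cs: "continuous_on UNIV (\<lambda>z::'a \<times> real. \<eta> (snd z))" "continuous_on UNIV (\<lambda>z::'a \<times> real. \<eta>' (snd z))"
    by (rule continuous_on_compose2[OF c\<eta>[of UNIV]]; auto intro!: continuous_intros)
       (rule continuous_on_compose2[OF \<eta>(2)]; auto intro!: continuous_intros)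
  have [measurable]: "\<phi> \<in> borel_measurable borel" "\<phi>' \<in> borel_measurable borel"
    "(\<lambda>z::'a \<times> real. \<eta> (snd z)) \<in> borel_measurable borel"
    "(\<lambda>z. fst (\<phi>' z)) \<in> borel_measurable borel" "(\<lambda>z. snd (\<phi>' z)) \<in> borel_measurable borel"
    by (intro borel_measurable_continuous_onI c\<phi> cont cs continuous_on_fst continuous_on_snd)+
  have Sb [measurable]: "S \<in> sets borel" using S(1) by (intro borel_closed compact_imp_closed)
  define \<zeta> where "\<zeta> z = \<phi> z ^ n * \<eta> (snd z)" for z
  define \<zeta>' where "\<zeta>' z = (\<phi> z ^ n) *\<^sub>R (0, \<eta>' (snd z)) + \<eta> (snd z) *\<^sub>R ((real n * \<phi> z ^ (n - 1)) *\<^sub>R \<phi>' z)" for z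
  have g\<eta>: "has_grad (\<lambda>z::'a \<times> real. \<eta> (snd z)) (0, \<eta>' (snd z)) z" for z
    unfolding has_grad_def
    by (rule has_derivative_eq_rhs[OF has_derivative_compose[OF has_derivative_snd[OF has_derivative_ident]
          \<eta>(1)[THEN has_field_derivative_imp_has_derivative]]])
       (auto simp: fun_eq_iff inner_prod_def)
  have g\<phi>: "has_grad (\<lambda>z. \<phi> z ^ n) ((real n * \<phi> z ^ (n - 1)) *\<^sub>R \<phi>' z) z" for z
    by (rule has_grad_compose[OF grad, where h = "\<lambda>x. x ^ n"])
       (use n1 in \<open>auto intro!: derivative_eq_intros\<close>)
  have g\<zeta>: "has_grad \<zeta> (\<zeta>' z) z" for z
    unfolding \<zeta>_def[abs_def] \<zeta>'_def by (rule has_grad_mult[OF g\<phi> g\<eta>])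
  have c\<zeta>': "continuous_on UNIV \<zeta>'"
    unfolding \<zeta>'_def[abs_def] by (intro continuous_intros cs c\<phi> cont)
  have \<zeta>0: "0 \<le> \<zeta> z" for z using \<phi> \<eta> by (simp add: \<zeta>_def)
  have \<zeta>S: "\<zeta> z = 0" if "z \<notin> S" for z using S(3)[OF that] n1 by (auto simp: \<zeta>_def)
  define c1 where "c1 z = a powr (1 - p) * (real n * norm (fst (\<phi>' z))) powr p" for z
  define c2 where "c2 z = real n * \<bar>snd (\<phi>' z)\<bar> / (1 - a)" for z
  have c0: "0 \<le> c1 z" "0 \<le> c2 z" for z using a by (auto simp: c1_def c2_def)
  have [measurable]: "c1 \<in> borel_measurable borel" "c2 \<in> borel_measurable borel"
    unfolding c1_def[abs_def] c2_def[abs_def] by measurable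
  define H where "H w z = \<eta> (snd z) * (c1 z * \<phi> z powr (real n - p) * w powr (p - 1 - a)
        + c2 z * \<phi> z powr (real n - 1) * w powr (1 - a))" for w z
  have H0: "0 \<le> H w z" for w z using c0 \<eta> by (simp add: H_def)
  have HS: "H w z = 0" if "z \<notin> S" for w z using S(3)[OF that] by (auto simp: H_def)
  define e where "e k = 1 / real (Suc k)" for k
  have e: "0 < e k" "e k \<le> 1" for k by (auto simp: e_def)
  have elim: "e \<longlonglongrightarrow> 0" unfolding e_def[abs_def] by (rule LIMSEQ_Suc[OF lim_1_over_n])
  have u0: "0 \<le> u z" and V0: "0 < V z" for z
    by (rule regular_supersolution.u_nonneg[OF sol], rule regular_supersolution.V_pos[OF sol])

  \<comment> \<open>An integrable majorant of \<open>H (u z + e k) z\<close> for all \<open>k\<close>.\<close>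
  obtain B where B: "B > 0" "\<And>z. z \<in> S \<Longrightarrow> norm (\<phi>' z) \<le> B"
  proof -
    have "compact (\<phi>' ` S)" by (intro compact_continuous_image S continuous_on_subset[OF cont]) auto
    then show thesis using that bounded_pos compact_imp_bounded by (metis imageI)
  qed
  define M where "M = a powr (1 - p) * (real n * B) powr p + real n * B / (1 - a)"
  have Hle: "H w z \<le> indicator S z * (M * (2 powr p * (1 + u z powr p)))"
    if "0 \<le> w" "w \<le> u z + 1" for w z
  proof (cases "z \<in> S")
    case True
    have f: "norm (fst (\<phi>' z)) \<le> B" "\<bar>snd (\<phi>' z)\<bar> \<le> B"
      using B(2)[OF True] norm_fst_le[of "fst (\<phi>' z)" "snd (\<phi>' z)"] norm_snd_le[of "snd (\<phi>' z)" "fst (\<phi>' z)"] by auto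
    have c1: "c1 z \<le> a powr (1 - p) * (real n * B) powr p"
      unfolding c1_def using f p by (intro mult_left_mono powr_mono2) auto
    have c2: "c2 z \<le> real n * B / (1 - a)"
      unfolding c2_def using f a by (intro divide_right_mono mult_left_mono) auto
    have wb: "w powr b \<le> 2 powr p * (1 + u z powr p)" if "0 \<le> b" "b \<le> p" for b
    proof -
      have "w powr b \<le> (u z + 1) powr b" using \<open>0 \<le> w\<close> \<open>w \<le> u z + 1\<close> that by (intro powr_mono2) auto
      also have "\<dots> \<le> (u z + 1) powr p" using u0 that by (intro powr_mono) auto
      also have "\<dots> \<le> 2 powr p * (1 + u z powr p)"
      proof (cases "u z \<le> 1")
        case True
        then have "(u z + 1) powr p \<le> 2 powr p" using u0[of z] p by (intro powr_mono2) auto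
        also have "\<dots> \<le> 2 powr p * (1 + u z powr p)" by (simp add: algebra_simps)
        finally show ?thesis .
      next
        case False
        then have "(u z + 1) powr p \<le> (2 * u z) powr p" using u0[of z] p by (intro powr_mono2) auto
        also have "\<dots> = 2 powr p * u z powr p" using u0[of z] by (simp add: powr_mult)
        finally show ?thesis by (simp add: algebra_simps add_increasing)
      qed
      finally show ?thesis .
    qed
    define Q where "Q = 2 powr p * (1 + u z powr p)"
    have Q0: "0 \<le> Q" by (simp add: Q_def)
    have ph: "\<phi> z powr b \<le> 1" if "0 \<le> b" for b using \<phi> that by (intro powr_le1) auto
    have "c1 z * \<phi> z powr (real n - p) * w powr (p - 1 - a) \<le> (a powr (1 - p) * (real n * B) powr p) * 1 * Q"
      unfolding Q_def using a n by (intro mult_mono c1 ph wb) auto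
    moreover have "c2 z * \<phi> z powr (real n - 1) * w powr (1 - a) \<le> (real n * B / (1 - a)) * 1 * Q"
      unfolding Q_def using a n1 p B(1) by (intro mult_mono c2 ph wb) auto
    ultimately have "c1 z * \<phi> z powr (real n - p) * w powr (p - 1 - a)
        + c2 z * \<phi> z powr (real n - 1) * w powr (1 - a) \<le> M * Q"
      by (simp add: M_def algebra_simps)
    moreover have "0 \<le> c1 z * \<phi> z powr (real n - p) * w powr (p - 1 - a)
        + c2 z * \<phi> z powr (real n - 1) * w powr (1 - a)" using c0 by simp
    ultimately have "H w z \<le> 1 * (M * Q)"
      unfolding H_def using \<eta> by (intro mult_mono) auto
    then show ?thesis using True by (simp add: Q_def)
  qed (simp add: HS)
  have iM: "integrable lborel (\<lambda>z. indicator S z * (M * (2 powr p * (1 + u z powr p))))"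
  proof -
    have "integrable lborel (\<lambda>z. M * 2 powr p * indicator S z + M * 2 powr p * (indicator S z * u z powr p))"
      using regular_supersolution.u_powr_integrable[OF sol S(1,2)] emeasure_compact_finite[OF S(1)] Sb
      by (intro Bochner_Integration.integrable_add integrable_mult_right integrable_real_indicator) auto
    then show ?thesis by (simp add: algebra_simps)
  qed
  have mH [measurable]: "(\<lambda>z. H (u z + c) z) \<in> borel_measurable borel" for c
    unfolding H_def by measurable
  have mH0 [measurable]: "(\<lambda>z. H (u z) z) \<in> borel_measurable borel"
    using mH[of 0] by simp
  have Hb: "AE z in lborel. norm (H (u z + e k) z) \<le> indicator S z * (M * (2 powr p * (1 + u z powr p)))" for k
    using Hle[of "u _ + e k"] e[of k] u0 H0 by (intro AE_I2) (simp add: abs_of_nonneg add_nonneg_nonneg less_imp_le)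
  have Hl: "AE z in lborel. (\<lambda>k. H (u z + e k) z) \<longlonglongrightarrow> H (u z) z"
  proof (rule AE_I2)
    fix z
    have ul: "(\<lambda>k. u z + e k) \<longlonglongrightarrow> u z" using tendsto_add[OF tendsto_const elim, of "u z"] by simp
    have "(\<lambda>k. (u z + e k) powr b) \<longlonglongrightarrow> u z powr b" if "b > 0" for b
      using that u0[of z] e
      by (intro tendsto_powr'[OF ul tendsto_const]) (auto intro!: always_eventually add_nonneg_nonneg less_imp_le)
    then show "(\<lambda>k. H (u z + e k) z) \<longlonglongrightarrow> H (u z) z"
      unfolding H_def using a by (intro tendsto_mult tendsto_add tendsto_const) auto
  qed
  have Hi: "integrable lborel (\<lambda>z. H (u z + e k) z)" for k
    by (rule integrable_dominated_convergence2[OF _ _ iM Hl Hb]) measurable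
  have Hi0: "integrable lborel (\<lambda>z. H (u z) z)"
    by (rule integrable_dominated_convergence[OF _ _ iM Hl Hb]) measurable
  have Hlim: "(\<lambda>k. \<integral>z. H (u z + e k) z \<partial>lborel) \<longlonglongrightarrow> (\<integral>z. H (u z) z \<partial>lborel)"
    by (rule integral_dominated_convergence[OF _ _ iM Hl Hb]) measurable

  let ?L = "\<lambda>k z. V z * u z powr q * \<zeta> z * (u z + e k) powr (- a)"
  have L0: "0 \<le> ?L k z" for k z using V0[of z] \<zeta>0 by simp
  note E = regular_supersolution_energy[OF sol p U g\<zeta> c\<zeta>' S(1,2) \<zeta>S \<zeta>0 e(1) a(1,2)]
  have EL: "integrable lborel (?L k)" for k by (rule E(1))
  have EH: "(\<integral>z. ?L k z \<partial>lborel) \<le> (\<integral>z. H (u z + e k) z \<partial>lborel)" for k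
  proof (rule order_trans[OF E(3)], assumption, rule integral_mono[OF E(2) Hi], assumption)
    fix z :: "'a \<times> real"
    have z': "fst (\<zeta>' z) = \<eta> (snd z) *\<^sub>R (real n * \<phi> z ^ (n - 1)) *\<^sub>R fst (\<phi>' z)"
      "snd (\<zeta>' z) = \<phi> z ^ n * \<eta>' (snd z) + \<eta> (snd z) * (real n * \<phi> z ^ (n - 1)) * snd (\<phi>' z)"
      by (simp_all add: \<zeta>'_def)
    show "(u z + e k) powr (- a) * ((norm (X z) powr (p - 2) *\<^sub>R X z) \<bullet> fst (\<zeta>' z))
            - a * \<zeta> z * (u z + e k) powr (- a - 1) * norm (X z) powr p
            - snd (\<zeta>' z) * ((u z + e k) powr (1 - a) / (1 - a)) \<le> H (u z + e k) z"
      unfolding H_def c1_def c2_def \<zeta>_def z'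
      by (rule energy_density_bound[OF p a(1,2) _ \<phi>(1) \<eta>(3,5) n(1)]) (use u0 e in \<open>simp add: add_nonneg_pos\<close>)
  qed
  define J where "J = (\<integral>\<^sup>+z. ennreal (V z * u z powr (q - a) * \<zeta> z) \<partial>lborel)"
  have "J = (\<integral>\<^sup>+z. liminf (\<lambda>k. ennreal (?L k z)) \<partial>lborel)"
    unfolding J_def
  proof (rule nn_integral_cong)
    fix z
    have "(\<lambda>k. ?L k z) \<longlonglongrightarrow> V z * u z powr (q - a) * \<zeta> z"
    proof (cases "u z = 0")
      case False
      then have u: "u z > 0" using u0[of z] by simp
      have ul: "(\<lambda>k. u z + e k) \<longlonglongrightarrow> u z" using tendsto_add[OF tendsto_const elim, of "u z"] by simp
      have "(\<lambda>k. ?L k z) \<longlonglongrightarrow> V z * u z powr q * \<zeta> z * u z powr (- a)"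
        using u by (intro tendsto_mult tendsto_const tendsto_powr ul) auto
      also have "V z * u z powr q * \<zeta> z * u z powr (- a) = V z * (u z powr q * u z powr (- a)) * \<zeta> z"
        by (simp only: mult_ac)
      also have "u z powr q * u z powr (- a) = u z powr (q - a)" by (simp add: powr_add[symmetric])
      finally show ?thesis .
    qed simp
    then have "(\<lambda>k. ennreal (?L k z)) \<longlonglongrightarrow> ennreal (V z * u z powr (q - a) * \<zeta> z)"
      by (rule tendsto_ennrealI)
    then show "ennreal (V z * u z powr (q - a) * \<zeta> z) = liminf (\<lambda>k. ennreal (?L k z))"
      by (rule lim_imp_Liminf[OF sequentially_bot, symmetric])
  qed
  also have "\<dots> \<le> liminf (\<lambda>k. \<integral>\<^sup>+z. ennreal (?L k z) \<partial>lborel)"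
    using EL by (intro nn_integral_liminf) (simp add: borel_measurable_integrable)
  also have "\<dots> \<le> liminf (\<lambda>k. ennreal (\<integral>z. H (u z + e k) z \<partial>lborel))"
  proof (rule Liminf_mono, rule always_eventually, rule allI)
    fix k
    have "(\<integral>\<^sup>+z. ennreal (?L k z) \<partial>lborel) = ennreal (\<integral>z. ?L k z \<partial>lborel)"
      using EL L0 by (intro nn_integral_eq_integral) auto
    then show "(\<integral>\<^sup>+z. ennreal (?L k z) \<partial>lborel) \<le> ennreal (\<integral>z. H (u z + e k) z \<partial>lborel)"
      using EH by (simp add: ennreal_leI)
  qed
  also have "\<dots> = ennreal (\<integral>z. H (u z) z \<partial>lborel)"
    by (rule lim_imp_Liminf[OF sequentially_bot tendsto_ennrealI[OF Hlim]])
  finally have JH: "J \<le> ennreal (\<integral>z. H (u z) z \<partial>lborel)" .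
  have [measurable]: "R \<in> borel_measurable borel"
    unfolding R_def c1_def[symmetric] c2_def[symmetric] by measurable
  have R0: "0 \<le> R z" for z by (simp add: R_def)
  have HR: "H (u z) z \<le> 1/2 * (V z * u z powr (q - a) * \<zeta> z) + \<eta> (snd z) * R z" for z
  proof -
    \<comment> \<open>The exponents are largest for \<open>a = 0\<close>, so that one \<open>n\<close> works for all \<open>a\<close>.\<close>
    have l: "l * ((q - a) / d) \<le> l * (q / d)" if "0 \<le> l" "0 < d" for l d :: real
      using that a by (intro mult_left_mono divide_right_mono) auto
    have 1: "c1 z * \<phi> z powr (real n - p) * u z powr (p - 1 - a)
       \<le> (V z / 4) * \<phi> z ^ n * u z powr (q - a) + c1 z powr ((q - a) / (q - p + 1)) * (V z / 4) powr (- ((p - 1 - a) / (q - p + 1)))"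
      using young_absorb[OF c0(1) \<phi>(1) \<phi>(2) V0 u0, of "p - 1 - a" "q - a" p n z z z z] l[of p "q - p + 1"] a q p n
      by (simp add: algebra_simps)
    have 2: "c2 z * \<phi> z powr (real n - 1) * u z powr (1 - a)
       \<le> (V z / 4) * \<phi> z ^ n * u z powr (q - a) + c2 z powr ((q - a) / (q - 1)) * (V z / 4) powr (- ((1 - a) / (q - 1)))"
      using young_absorb[OF c0(2) \<phi>(1) \<phi>(2) V0 u0, of "1 - a" "q - a" 1 n z z z z] l[of 1 "q - 1"] a q p n
      by (simp add: algebra_simps)
    have "c1 z * \<phi> z powr (real n - p) * u z powr (p - 1 - a) + c2 z * \<phi> z powr (real n - 1) * u z powr (1 - a)
        \<le> 1/2 * (V z * u z powr (q - a) * \<phi> z ^ n) + R z"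
      using add_mono[OF 1 2] unfolding R_def c1_def[symmetric] c2_def[symmetric] by (simp add: algebra_simps)
    then have "H (u z) z \<le> \<eta> (snd z) * (1/2 * (V z * u z powr (q - a) * \<phi> z ^ n) + R z)"
      unfolding H_def by (rule mult_left_mono[OF _ \<eta>(3)])
    then show ?thesis by (simp add: \<zeta>_def algebra_simps)
  qed
  have [measurable]: "\<zeta> \<in> borel_measurable borel" unfolding \<zeta>_def[abs_def] by measurable
  have "ennreal (\<integral>z. H (u z) z \<partial>lborel) = (\<integral>\<^sup>+z. ennreal (H (u z) z) \<partial>lborel)"
    using Hi0 H0 by (intro nn_integral_eq_integral[symmetric]) auto
  also have "\<dots> \<le> (\<integral>\<^sup>+z. ennreal (1/2) * ennreal (V z * u z powr (q - a) * \<zeta> z) + ennreal (\<eta> (snd z) * R z) \<partial>lborel)"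
  proof (rule nn_integral_mono)
    fix z
    have "ennreal (H (u z) z) \<le> ennreal (1/2 * (V z * u z powr (q - a) * \<zeta> z) + \<eta> (snd z) * R z)"
      by (rule ennreal_leI[OF HR])
    also have "\<dots> = ennreal (1/2) * ennreal (V z * u z powr (q - a) * \<zeta> z) + ennreal (\<eta> (snd z) * R z)"
      using V0[of z] \<zeta>0[of z] \<eta>(3)[of "snd z"] R0[of z]
      by (subst ennreal_plus) (simp_all only: ennreal_mult mult_nonneg_nonneg less_imp_le powr_ge_zero zero_le_divide_1_iff zero_le_numeral)
    finally show "ennreal (H (u z) z) \<le> \<dots>" .
  qed
  also have "\<dots> = ennreal (1/2) * J + (\<integral>\<^sup>+z. ennreal (\<eta> (snd z) * R z) \<partial>lborel)"
    unfolding J_def by (subst nn_integral_add) (auto simp: nn_integral_cmult)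
  finally have "J \<le> ennreal (1/2) * J + (\<integral>\<^sup>+z. ennreal (\<eta> (snd z) * R z) \<partial>lborel)"
    using JH by (rule order_trans[rotated])
  moreover have "J < \<infinity>" using JH by (rule le_less_trans) simp
  ultimately have "J \<le> 2 * (\<integral>\<^sup>+z. ennreal (\<eta> (snd z) * R z) \<partial>lborel)"
    by (rule ennreal_absorb_half)
  then show ?thesis by (simp add: J_def \<zeta>_def)
qed

text \<open>
  The standard transition from \<open>0\<close> (for \<open>x \<le> 0\<close>) to \<open>1\<close> (for \<open>x \<ge> 1\<close>).
\<close>

definition smooth_step :: "real \<Rightarrow> real" where
  "smooth_step x = flat_exp 0 x / (flat_exp 0 x + flat_exp 0 (1 - x))"

definition smooth_step' :: "real \<Rightarrow> real" where
  "smooth_step' x = (flat_exp 2 x * flat_exp 0 (1 - x) + flat_exp 0 x * flat_exp 2 (1 - x))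
      / (flat_exp 0 x + flat_exp 0 (1 - x))\<^sup>2"

section \<open>Logarithmic cut-off functions\<close>

lemma flat_exp_nonneg: "0 \<le> flat_exp n t" and flat_exp_pos: "t > 0 \<Longrightarrow> 0 < flat_exp n t"
  and flat_exp_eq_0: "t \<le> 0 \<Longrightarrow> flat_exp n t = 0"
  by (auto simp: flat_exp_def)

lemma smooth_step_denominator: "0 < flat_exp 0 x + flat_exp 0 (1 - x)"
proof (cases "x > 0")
  case True
  then show ?thesis using flat_exp_pos[of x 0] flat_exp_nonneg[of 0 "1 - x"] by linarith
next
  case False
  then show ?thesis using flat_exp_pos[of "1 - x" 0] flat_exp_nonneg[of 0 x] by linarith
qed

lemma smooth_step_has_derivative: "(smooth_step has_real_derivative smooth_step' x) (at x)"
proof -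
  have f: "(flat_exp 0 has_real_derivative flat_exp 2 t) (at t)" for t
    using flat_exp_has_derivative[of 0 t] by (simp add: numeral_2_eq_2)
  have g: "((\<lambda>x. flat_exp 0 (1 - x)) has_real_derivative - flat_exp 2 (1 - x)) (at x)"
    by (rule DERIV_cong[OF DERIV_chain2[where g = "\<lambda>x. 1 - x", OF f]]) (auto intro!: derivative_eq_intros)
  have "((\<lambda>x. flat_exp 0 x / (flat_exp 0 x + flat_exp 0 (1 - x))) has_real_derivative
     (flat_exp 2 x * (flat_exp 0 x + flat_exp 0 (1 - x)) - flat_exp 0 x * (flat_exp 2 x + - flat_exp 2 (1 - x)))
       / ((flat_exp 0 x + flat_exp 0 (1 - x)) * (flat_exp 0 x + flat_exp 0 (1 - x)))) (at x)"
    using smooth_step_denominator[of x] by (intro DERIV_divide DERIV_add f g) simp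
  then show ?thesis
    unfolding smooth_step_def[abs_def] smooth_step'_def by (simp add: power2_eq_square algebra_simps)
qed

lemma smooth_step_props:
  "0 \<le> smooth_step x" "smooth_step x \<le> 1" "x \<le> 0 \<Longrightarrow> smooth_step x = 0" "x \<ge> 1 \<Longrightarrow> smooth_step x = 1"
  "0 \<le> smooth_step' x" "x \<le> 0 \<or> x \<ge> 1 \<Longrightarrow> smooth_step' x = 0" "continuous_on UNIV smooth_step'"
proof -
  note d = smooth_step_denominator[of x] and nn = flat_exp_nonneg
  show "0 \<le> smooth_step x" unfolding smooth_step_def using nn by (intro divide_nonneg_nonneg add_nonneg_nonneg)
  show "smooth_step x \<le> 1" unfolding smooth_step_def using nn[of 0 "1 - x"] d by (simp add: field_simps)
  show "x \<le> 0 \<Longrightarrow> smooth_step x = 0" by (simp add: smooth_step_def flat_exp_eq_0)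
  show "x \<ge> 1 \<Longrightarrow> smooth_step x = 1" using d by (simp add: smooth_step_def flat_exp_eq_0)
  show "0 \<le> smooth_step' x" unfolding smooth_step'_def
    using nn by (intro divide_nonneg_nonneg add_nonneg_nonneg mult_nonneg_nonneg) auto
  show "x \<le> 0 \<or> x \<ge> 1 \<Longrightarrow> smooth_step' x = 0" by (auto simp: smooth_step'_def flat_exp_eq_0)
  show "continuous_on UNIV smooth_step'"
    unfolding smooth_step'_def[abs_def] using smooth_step_denominator
    by (intro continuous_intros) (auto simp: less_imp_neq[symmetric] dest: less_imp_neq)
qed

lemma smooth_step'_bounded: obtains M where "0 < M" "\<And>x. smooth_step' x \<le> M"
proof -
  obtain M where "0 < M" "\<And>x. norm (smooth_step' x) \<le> M"
    using bounded_continuous_compact_support[OF smooth_step_props(7) compact_Icc[of 0 1]] smooth_step_props(6)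
    by (metis atLeastAtMost_iff less_eq_real_def not_less)
  then show thesis using that by (metis abs_le_D1 real_norm_def)
qed

text \<open>
  Translate the variable of integration so that both averages use the same kernel.
\<close>

lemma smooth_avg_lipschitz:
  fixes f :: "'b::euclidean_space \<Rightarrow> real"
  assumes r: "r > 0" and f: "integrable lborel f" and L: "\<And>x y. \<bar>f x - f y\<bar> \<le> L * dist x y"
  shows "\<bar>smooth_avg r f x - smooth_avg r f y\<bar> \<le> L * dist x y"
proof -
  have [measurable]: "f \<in> borel_measurable borel" using f by (simp add: borel_measurable_integrable)
  have [measurable]: "kern r \<in> borel_measurable (borel :: 'b measure)"
    by (intro borel_measurable_continuous_onI kern_continuous_UNIV)
  let ?s = "y - x"
  have eq: "(lborel :: 'b measure) = distr lborel borel ((+) ?s)"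
    by (simp add: lborel_distr_plus)
  have i0: "integrable lborel (\<lambda>w. kern r (y - w) * f w)" using smooth_avg_integrable[OF r f, of y] by simp
  then have "integrable (distr lborel borel ((+) ?s)) (\<lambda>w. kern r (y - w) * f w)" using eq by metis
  then have i: "integrable lborel (\<lambda>w. kern r (x - w) * f (?s + w))"
    by (subst (asm) integrable_distr_eq) (auto simp: algebra_simps)
  have "smooth_avg r f y = (\<integral>w. kern r (y - w) * f w \<partial>distr lborel borel ((+) ?s))"
    using eq by (simp add: smooth_avg_def)
  also have "\<dots> = (\<integral>w. kern r (x - w) * f (?s + w) \<partial>lborel)"
    by (subst integral_distr) (auto simp: algebra_simps)
  finally have y: "smooth_avg r f y = \<dots>" .
  have ix: "integrable lborel (\<lambda>w. kern r (x - w) * f w)" using smooth_avg_integrable[OF r f, of x] by simp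
  have "smooth_avg r f x - smooth_avg r f y = (\<integral>w. kern r (x - w) * f w - kern r (x - w) * f (?s + w) \<partial>lborel)"
    unfolding y using i ix by (simp add: smooth_avg_def)
  also have "\<bar>\<dots>\<bar> \<le> (\<integral>w. kern r (x - w) * (L * dist x y) \<partial>lborel)"
    unfolding real_norm_def[symmetric]
  proof (rule integral_norm_le_integral)
    fix w
    have "kern r (x - w) * \<bar>f w - f (?s + w)\<bar> \<le> kern r (x - w) * (L * dist x y)"
      using L[of w "?s + w"] by (intro mult_left_mono kern_nonneg r) (simp add: dist_norm norm_minus_commute)
    then show "norm (kern r (x - w) * f w - kern r (x - w) * f (?s + w)) \<le> kern r (x - w) * (L * dist x y)"
      using kern_nonneg[OF r, of "x - w"] by (simp add: right_diff_distrib[symmetric] abs_mult)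
  qed (use i ix kern_reflect[OF r, of x] in auto)
  also have "\<dots> = L * dist x y" using kern_reflect[OF r, of x] by simp
  finally show ?thesis .
qed

lemma has_grad_norm_le_lipschitz:
  assumes g: "has_grad f g z" and L: "\<And>x y. \<bar>f x - f y\<bar> \<le> L * dist x y"
  shows "norm g \<le> L"
proof -
  have "((\<lambda>t. z + t *\<^sub>R g) has_derivative (\<lambda>t. t *\<^sub>R g)) (at 0)"
    by (auto intro!: derivative_eq_intros)
  from has_derivative_compose[OF this, of f "\<lambda>v. g \<bullet> v"]
  have "((\<lambda>t. f (z + t *\<^sub>R g)) has_derivative (\<lambda>t. t * (g \<bullet> g))) (at 0)"
    using g by (simp add: has_grad_def)
  then have "((\<lambda>t. f (z + t *\<^sub>R g)) has_real_derivative (g \<bullet> g)) (at 0)"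
    by (simp add: has_field_derivative_def mult_commute_abs)
  then have lim: "((\<lambda>h. (f (z + h *\<^sub>R g) - f z) / h) \<longlongrightarrow> g \<bullet> g) (at 0)"
    by (simp add: DERIV_def)
  have "g \<bullet> g \<le> L * norm g"
  proof (rule tendsto_upperbound[OF lim])
    have "(f (z + h *\<^sub>R g) - f z) / h \<le> L * norm g" if "h \<noteq> 0" for h
    proof -
      have "(f (z + h *\<^sub>R g) - f z) / h \<le> \<bar>f (z + h *\<^sub>R g) - f z\<bar> / \<bar>h\<bar>"
        using abs_ge_self[of "(f (z + h *\<^sub>R g) - f z) / h"] by (simp add: abs_divide)
      also have "\<dots> \<le> (L * dist (z + h *\<^sub>R g) z) / \<bar>h\<bar>"
        by (intro divide_right_mono L) simp
      also have "\<dots> = L * norm g" using that by (simp add: dist_norm)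
      finally show ?thesis .
    qed
    then show "eventually (\<lambda>h. (f (z + h *\<^sub>R g) - f z) / h \<le> L * norm g) (at 0)"
      by (simp add: eventually_at_filter)
  qed simp
  then have "norm g * norm g \<le> L * norm g" by (simp add: dot_square_norm power2_eq_square)
  moreover have "0 \<le> L"
  proof -
    obtain e :: 'a where e: "e \<in> Basis" using nonempty_Basis by blast
    have "0 \<le> \<bar>f (z + e) - f z\<bar>" by simp
    also have "\<dots> \<le> L * dist (z + e) z" by (rule L)
    finally show ?thesis using e by (simp add: dist_norm)
  qed
  ultimately show ?thesis by (cases "norm g = 0") auto
qed

text \<open>
  The distance to the boundary, extended by \<open>0\<close> to the complement. Unlike \<open>bdry_dist\<close>, it has
  bounded support, and it is still Lipschitz on the whole space, since a segment leaving \<open>\<Omega>\<close> meets the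
  boundary.
\<close>

definition inner_dist :: "'a::euclidean_space set \<Rightarrow> 'a \<Rightarrow> real" where
  "inner_dist \<Omega> x = (if x \<in> \<Omega> then infdist x (frontier \<Omega>) else 0)"

lemma inner_dist_lipschitz: "\<bar>inner_dist \<Omega> x - inner_dist \<Omega> y\<bar> \<le> 1 * dist x y"
proof -
  have cross: "infdist x (frontier \<Omega>) \<le> dist x y" if "x \<in> \<Omega>" "y \<notin> \<Omega>" for x y
  proof -
    have "closed_segment x y \<inter> frontier \<Omega> \<noteq> {}"
      using that by (intro connected_Int_frontier) auto
    then obtain w where w: "w \<in> closed_segment x y" "w \<in> frontier \<Omega>" by blast
    have "infdist x (frontier \<Omega>) \<le> dist x w" by (rule infdist_le[OF w(2)])
    also have "\<dots> \<le> dist x y" using dist_in_closed_segment[OF w(1)] by (simp add: dist_commute)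
    finally show ?thesis .
  qed
  show ?thesis
    using cross[of x y] cross[of y x] infdist_triangle_abs[of x "frontier \<Omega>" y]
      infdist_nonneg[of x "frontier \<Omega>"] infdist_nonneg[of y "frontier \<Omega>"]
    by (auto simp: inner_dist_def dist_commute)
qed

lemma inner_dist_pos:
  assumes "open \<Omega>" "bounded \<Omega>" "x \<in> \<Omega>"
  shows "inner_dist \<Omega> x > 0"
proof -
  have "frontier \<Omega> \<noteq> {}"
    using assms not_bounded_UNIV by (auto simp: frontier_eq_empty)
  moreover have "x \<notin> frontier \<Omega>" using assms by (simp add: frontier_def interior_open)
  ultimately show ?thesis
    using assms infdist_pos_not_in_closed[OF frontier_closed] by (simp add: inner_dist_def)
qed

lemma inner_dist_integrable:
  assumes "bounded \<Omega>" shows "integrable lborel (inner_dist \<Omega>)"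
proof -
  obtain B where B: "\<And>x. x \<in> \<Omega> \<Longrightarrow> norm x \<le> B" using assms unfolding bounded_iff by blast
  have "1-lipschitz_on UNIV (inner_dist \<Omega>)"
    using inner_dist_lipschitz[of \<Omega>] by (intro lipschitz_onI) (auto simp: dist_real_def)
  then have "continuous_on UNIV (inner_dist \<Omega>)" by (rule lipschitz_on_continuous_on)
  then show ?thesis
    by (rule integrable_continuous_compact_support[where S = "cball 0 B"])
       (use B in \<open>auto simp: inner_dist_def\<close>)
qed

text \<open>
  If \<open>D\<close> is the distance \<open>d\<close> up to an error \<open>c\<close> that is small compared with \<open>d\<close>, then
  \<open>D\<^sup>2 + c\<^sup>2\<close> and \<open>d\<^sup>2\<close> agree up to a factor \<open>2\<close>. The term \<open>c\<^sup>2\<close> makes the power a smooth function on the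
  whole space.
\<close>

lemma regularised_dist_comparison:
  fixes c d D \<theta> :: real
  assumes c: "c > 0" and d: "d \<ge> 8 * c" "\<bar>D - d\<bar> \<le> c" and \<theta>: "\<theta> > 0"
  shows "(D\<^sup>2 + c\<^sup>2) powr (- \<theta> / 2) \<le> 2 powr (\<theta> / 2) * d powr (- \<theta>)"
    "2 powr (- \<theta> / 2) * d powr (- \<theta>) \<le> (D\<^sup>2 + c\<^sup>2) powr (- \<theta> / 2)"
    "0 < D" "D / (D\<^sup>2 + c\<^sup>2) \<le> 3 / d"
proof -
  have d0: "d > 0" using c d by linarith
  have c8: "c \<le> d / 8" using d by simp
  have D: "7/8 * d \<le> D" "D \<le> 9/8 * d" using d c8 by (auto simp: abs_le_iff)
  then show D0: "0 < D" using d0 by linarith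
  have "(7/8 * d)\<^sup>2 \<le> D\<^sup>2" using D d0 by (intro power_mono) auto
  then have lo: "d\<^sup>2 / 2 \<le> D\<^sup>2 + c\<^sup>2" by (simp add: power2_eq_square) (smt (verit) zero_le_square)
  have "D\<^sup>2 \<le> (9/8 * d)\<^sup>2" using D D0 by (intro power_mono) auto
  moreover have "c\<^sup>2 \<le> (d / 8)\<^sup>2" using c c8 by (intro power_mono) auto
  moreover have "0 \<le> d * d" by simp
  ultimately have hi: "D\<^sup>2 + c\<^sup>2 \<le> 2 * d\<^sup>2" unfolding power_mult_distrib power_divide power2_eq_square by linarith
  have dp: "(d\<^sup>2) powr (- \<theta> / 2) = d powr (- \<theta>)"
    using d0 by (simp add: powr_numeral[symmetric] powr_powr del: powr_numeral)
  have "(D\<^sup>2 + c\<^sup>2) powr (- \<theta> / 2) \<le> (d\<^sup>2 / 2) powr (- \<theta> / 2)"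
    using lo d0 \<theta> by (intro powr_mono2') auto
  also have "\<dots> = 2 powr (\<theta> / 2) * d powr (- \<theta>)"
    using d0 powr_minus_divide[of 2 "\<theta> / 2"] by (simp add: powr_divide dp[symmetric])
  finally show "(D\<^sup>2 + c\<^sup>2) powr (- \<theta> / 2) \<le> 2 powr (\<theta> / 2) * d powr (- \<theta>)" .
  have "2 powr (- \<theta> / 2) * d powr (- \<theta>) = (2 * d\<^sup>2) powr (- \<theta> / 2)"
    by (simp add: powr_mult dp[symmetric])
  also have "\<dots> \<le> (D\<^sup>2 + c\<^sup>2) powr (- \<theta> / 2)"
  proof (rule powr_mono2'[OF _ _ hi])
    show "0 < D\<^sup>2 + c\<^sup>2" using D0 by (simp add: add_pos_nonneg)
  qed (use \<theta> in simp)
  finally show "2 powr (- \<theta> / 2) * d powr (- \<theta>) \<le> (D\<^sup>2 + c\<^sup>2) powr (- \<theta> / 2)" .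
  have "D / (D\<^sup>2 + c\<^sup>2) \<le> (9/8 * d) / (d\<^sup>2 / 2)"
    using D D0 lo d0 by (intro frac_le) auto
  also have "\<dots> = (9/4) / d" using d0 by (simp add: power2_eq_square)
  also have "\<dots> \<le> 3 / d" using d0 by (intro divide_right_mono) auto
  finally show "D / (D\<^sup>2 + c\<^sup>2) \<le> 3 / d" .
qed

text \<open>
  The same for the time variable, away from \<open>t = 0\<close>. The bound on \<open>c\<close> is chosen to give the same
  factor \<open>2 powr (\<kappa> / 2)\<close> as for the distance, although the exponents differ.
\<close>

lemma regularised_time_comparison:
  fixes c t \<tau> \<theta> \<kappa> :: real
  assumes \<tau>: "0 < \<tau>" "\<tau> \<le> t" and c: "c\<^sup>2 \<le> (2 powr (\<kappa> / \<theta>) - 1) * \<tau>\<^sup>2" and \<theta>: "\<theta> > 0"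
  shows "t powr \<theta> \<le> (t\<^sup>2 + c\<^sup>2) powr (\<theta> / 2)" "(t\<^sup>2 + c\<^sup>2) powr (\<theta> / 2) \<le> 2 powr (\<kappa> / 2) * t powr \<theta>"
    "t / (t\<^sup>2 + c\<^sup>2) \<le> 1 / t"
proof -
  have t: "t > 0" using \<tau> by linarith
  have tp: "(t\<^sup>2) powr (\<theta> / 2) = t powr \<theta>"
    using t by (simp add: powr_numeral[symmetric] powr_powr del: powr_numeral)
  show "t powr \<theta> \<le> (t\<^sup>2 + c\<^sup>2) powr (\<theta> / 2)"
    unfolding tp[symmetric] using \<theta> by (intro powr_mono2) auto
  have k1: "0 \<le> 2 powr (\<kappa> / \<theta>) - 1"
  proof -
    have "0 \<le> (2 powr (\<kappa> / \<theta>) - 1) * \<tau>\<^sup>2" using c zero_le_power2[of c] by linarith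
    then show ?thesis using \<tau>(1) by (simp add: zero_le_mult_iff)
  qed
  have "\<tau>\<^sup>2 \<le> t\<^sup>2" using \<tau> by (intro power_mono) auto
  then have "(2 powr (\<kappa> / \<theta>) - 1) * \<tau>\<^sup>2 \<le> (2 powr (\<kappa> / \<theta>) - 1) * t\<^sup>2"
    using k1 by (rule mult_left_mono)
  then have "t\<^sup>2 + c\<^sup>2 \<le> 2 powr (\<kappa> / \<theta>) * t\<^sup>2" using c by (simp add: algebra_simps)
  then have "(t\<^sup>2 + c\<^sup>2) powr (\<theta> / 2) \<le> (2 powr (\<kappa> / \<theta>) * t\<^sup>2) powr (\<theta> / 2)"
    using \<theta> by (intro powr_mono2) auto
  also have "\<dots> = 2 powr (\<kappa> / 2) * t powr \<theta>"
    using \<theta> by (simp add: powr_mult powr_powr tp)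
  finally show "(t\<^sup>2 + c\<^sup>2) powr (\<theta> / 2) \<le> 2 powr (\<kappa> / 2) * t powr \<theta>" .
  have "t / (t\<^sup>2 + c\<^sup>2) \<le> t / t\<^sup>2" using t by (intro divide_left_mono) (auto intro!: mult_pos_pos add_pos_nonneg)
  then show "t / (t\<^sup>2 + c\<^sup>2) \<le> 1 / t" using t by (simp add: power2_eq_square)
qed


lemma E_set_iff:
  assumes "\<delta> = 2 powr (- y)"
  shows "(x, t) \<in> E_set \<Omega> \<theta>1 \<theta>2 \<delta> \<longleftrightarrow> x \<in> \<Omega> \<and> 0 \<le> t \<and>
     bdry_dist \<Omega> x powr (- \<theta>2) + t powr \<theta>1 \<le> 2 powr (y * \<theta>2)"
  unfolding E_set_def assms by (simp add: powr_powr)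

text \<open>
  A transition in the logarithm of \<open>d(x) powr (- \<theta>2) + t powr \<theta>1\<close>, spread over all the levels between
  \<open>E_set\<close> at \<open>2 powr (- K)\<close> and at \<open>2 powr (- 2 * K)\<close>. On each of the \<open>K\<close> dyadic annuli in between the
  derivatives gain a factor \<open>1 / K\<close> compared with a cut-off living on that annulus alone; this gain is
  what the proof rests on. The distance is replaced by a mollification of it, to have a
  continuously differentiable function. This perturbs the level by at most one half, and the
  transition leaves a margin of one half at both ends.
\<close>

lemma logarithmic_cutoff:
  fixes \<Omega> :: "'a::euclidean_space set" and \<theta>1 \<theta>2 M :: real
  assumes \<Omega>: "open \<Omega>" "bounded \<Omega>" and \<theta>: "\<theta>1 \<ge> 1" "\<theta>2 \<ge> 1" and K: "K \<ge> 2"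
    and M: "M > 0" "\<And>x. smooth_step' x \<le> M"
  defines "m \<equiv> M * 2 * 2 powr \<theta>2 * (3 * \<theta>2 + \<theta>1) / (\<theta>2 * ln 2)"
  obtains \<phi> :: "'a \<times> real \<Rightarrow> real" and \<phi>' and S where
    "\<And>z. has_grad \<phi> (\<phi>' z) z" "continuous_on UNIV \<phi>'" "\<And>z. 0 \<le> \<phi> z" "\<And>z. \<phi> z \<le> 1"
    "compact S" "S \<subseteq> open_cyl \<Omega>"
    "\<And>z. z \<notin> S \<Longrightarrow> \<phi> z = 0 \<or> snd z < 1 / real K"
    "\<And>z. z \<in> E_set \<Omega> \<theta>1 \<theta>2 (2 powr - real K) \<Longrightarrow> 1 / real K \<le> snd z \<Longrightarrow> \<phi> z = 1"
    "\<And>x t. 1 / real K \<le> t \<Longrightarrow> \<phi>' (x, t) \<noteq> 0 \<Longrightarrow> \<exists>j. K \<le> j \<and> j < 2 * K \<and>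
        (x, t) \<in> E_set \<Omega> \<theta>1 \<theta>2 (2 powr - real (Suc j)) - E_set \<Omega> \<theta>1 \<theta>2 (2 powr - real j) \<and>
        norm (fst (\<phi>' (x, t))) \<le> (m / real K) * (bdry_dist \<Omega> x powr (- \<theta>2 - 1) * 2 powr (- (real j * \<theta>2))) \<and>
        \<bar>snd (\<phi>' (x, t))\<bar> \<le> (m / real K) * (t powr (\<theta>1 - 1) * 2 powr (- (real j * \<theta>2)))"
proof -
  define \<tau> where "\<tau> = 1 / real K"
  have \<tau>: "\<tau> > 0" using K by (simp add: \<tau>_def)
  define b where "b = sqrt (2 powr (\<theta>2 / \<theta>1) - 1) * \<tau>"
  have "2 powr (\<theta>2 / \<theta>1) > (2::real) powr 0" using \<theta> by (intro powr_less_mono) auto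
  then have b1: "2 powr (\<theta>2 / \<theta>1) - 1 > (0::real)" by simp
  then have b: "b > 0" using \<tau> by (simp add: b_def)
  define s where "s = (2::real) powr (- 2 * real K)"
  have s: "s > 0" by (simp add: s_def)
  \<comment> \<open>The first bound controls the perturbation in time for \<open>t \<ge> \<tau>\<close>, the second one that of the
    distance: \<open>s\<close> is a lower bound for the mollified distance on the support of the cut-off, so that
    the distance is at least \<open>8 * c\<close> there.\<close>
  define c where "c = min b (s / 9)"
  have c: "c > 0" "c \<le> s / 9" using b s by (auto simp: c_def)
  have cb: "c\<^sup>2 \<le> (2 powr (\<theta>2 / \<theta>1) - 1) * \<tau>\<^sup>2"
  proof -
    have "c\<^sup>2 \<le> b\<^sup>2" using c by (intro power_mono) (auto simp: c_def)
    then show ?thesis using b1 by (simp add: b_def power_mult_distrib)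
  qed
  define dd where "dd = inner_dist \<Omega>"
  have idd: "integrable lborel dd" unfolding dd_def by (rule inner_dist_integrable[OF \<Omega>(2)])
  define D where "D = smooth_avg c dd"
  define gD where "gD = smooth_avg_grad c dd"
  have gradD: "has_grad D (gD x) x" for x
    unfolding D_def gD_def by (rule smooth_avg_has_grad[OF c(1) idd])
  have cgD: "continuous_on UNIV gD" unfolding gD_def by (rule smooth_avg_grad_continuous[OF c(1) idd])
  have cD: "continuous_on UNIV D" by (rule has_grad_continuous[OF gradD])
  have ngD: "norm (gD x) \<le> 1" for x
    by (rule has_grad_norm_le_lipschitz[OF gradD], unfold D_def,
        rule smooth_avg_lipschitz[OF c(1) idd], unfold dd_def, rule inner_dist_lipschitz)
  have dd0: "0 \<le> dd x" for x by (simp add: dd_def inner_dist_def infdist_nonneg)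
  have D0: "0 \<le> D x" for x unfolding D_def by (rule smooth_avg_nonneg[OF c(1) dd0])
  have Dd: "\<bar>D x - dd x\<bar> \<le> c" for x
  proof -
    have "norm (smooth_avg c dd x - dd x) \<le> c"
    proof (rule smooth_avg_dist_le[OF c(1) idd])
      fix w assume "dist x w < c"
      then show "norm (dd w - dd x) \<le> c"
        using inner_dist_lipschitz[of \<Omega> w x] by (simp add: dd_def dist_commute)
    qed
    then show ?thesis by (simp add: D_def)
  qed
  define \<rho> where "\<rho> z = ((D (fst z))\<^sup>2 + c\<^sup>2) powr (- \<theta>2 / 2) + ((snd z)\<^sup>2 + c\<^sup>2) powr (\<theta>1 / 2)" for z :: "'a \<times> real"
  have pos: "y\<^sup>2 + c\<^sup>2 > 0" for y using c by (simp add: add_nonneg_pos)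
  have \<rho>0: "\<rho> z > 0" for z unfolding \<rho>_def using pos by (intro add_pos_pos) auto
  define P where "P x = (- \<theta>2 / 2) * ((D x)\<^sup>2 + c\<^sup>2) powr (- \<theta>2 / 2 - 1) * (2 * D x)" for x
  define T where "T t = (\<theta>1 / 2) * (t\<^sup>2 + c\<^sup>2) powr (\<theta>1 / 2 - 1) * (2 * t)" for t
  define \<rho>' where "\<rho>' z = P (fst z) *\<^sub>R (gD (fst z), 0 :: real) + T (snd z) *\<^sub>R (0, 1)" for z :: "'a \<times> real"
  have gfst: "has_grad (\<lambda>z::'a \<times> real. D (fst z)) (gD (fst z), 0) z" for z
    unfolding has_grad_def
    by (rule has_derivative_eq_rhs[OF has_derivative_compose[OF has_derivative_fst[OF has_derivative_ident]
          gradD[unfolded has_grad_def]]]) (auto simp: fun_eq_iff inner_prod_def)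
  have gsnd: "has_grad (\<lambda>z::'a \<times> real. snd z) (0, 1) z" for z
    unfolding has_grad_def
    by (rule has_derivative_eq_rhs[OF has_derivative_snd[OF has_derivative_ident]]) (auto simp: fun_eq_iff inner_prod_def)
  have dp: "((\<lambda>y. (y\<^sup>2 + c\<^sup>2) powr b) has_real_derivative b * (y\<^sup>2 + c\<^sup>2) powr (b - 1) * (2 * y)) (at y)" for b y
    using pos[of y] by (auto intro!: derivative_eq_intros)
  have g\<rho>: "has_grad \<rho> (\<rho>' z) z" for z
    unfolding \<rho>_def[abs_def] \<rho>'_def P_def T_def
    by (intro has_grad_add has_grad_compose[where h = "\<lambda>y. (y\<^sup>2 + c\<^sup>2) powr (- \<theta>2 / 2)", OF gfst dp]
          has_grad_compose[where h = "\<lambda>y. (y\<^sup>2 + c\<^sup>2) powr (\<theta>1 / 2)", OF gsnd dp])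
  have c\<rho>: "continuous_on UNIV \<rho>" by (rule has_grad_continuous[OF g\<rho>])
  have cP: "continuous_on UNIV P"
    unfolding P_def[abs_def] using pos
    by (intro continuous_intros cD) (auto simp: less_imp_neq[symmetric] dest: less_imp_neq)
  have cT: "continuous_on UNIV T"
    unfolding T_def[abs_def] using pos
    by (intro continuous_intros) (auto simp: less_imp_neq[symmetric] dest: less_imp_neq)
  have c\<rho>': "continuous_on UNIV \<rho>'"
    unfolding \<rho>'_def[abs_def]
    by (intro continuous_intros continuous_on_compose2[OF cP] continuous_on_compose2[OF cT] continuous_on_compose2[OF cgD]) auto
  have L2: "ln (2::real) > 0" by simp
  have K1: "real K - 1 > 0" "1 / (real K - 1) \<le> 2 / real K" using K by (auto simp: field_simps)
  define lev where "lev z = ln (\<rho> z) / (\<theta>2 * ln 2)" for z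
  define arg where "arg z = (2 * real K - 1/2 - lev z) / (real K - 1)" for z
  define \<phi> where "\<phi> z = smooth_step (arg z)" for z
  define h' where "h' y = - (1 / (y * (\<theta>2 * ln 2))) / (real K - 1)" for y
  define \<phi>' where "\<phi>' z = (smooth_step' (arg z) * h' (\<rho> z)) *\<^sub>R \<rho>' z" for z
  have dh: "((\<lambda>y. (2 * real K - 1/2 - ln y / (\<theta>2 * ln 2)) / (real K - 1)) has_real_derivative h' y) (at y)"
    if "y > 0" for y
    using that \<theta> K1 unfolding h'_def by (auto intro!: derivative_eq_intros)
  have g\<phi>: "has_grad \<phi> (\<phi>' z) z" for z
  proof -
    have "has_grad arg (h' (\<rho> z) *\<^sub>R \<rho>' z) z"
      unfolding arg_def[abs_def] lev_def
      by (rule has_grad_compose[where h = "\<lambda>y. (2 * real K - 1/2 - ln y / (\<theta>2 * ln 2)) / (real K - 1)", OF g\<rho> dh[OF \<rho>0]])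
    from has_grad_compose[where h = smooth_step, OF this smooth_step_has_derivative]
    show ?thesis unfolding \<phi>_def[abs_def] \<phi>'_def by simp
  qed
  have carg: "continuous_on UNIV arg"
    unfolding arg_def[abs_def] lev_def using \<rho>0 \<theta> K1
    by (intro continuous_intros c\<rho>) (auto simp: less_imp_neq[symmetric] dest: less_imp_neq)
  have c\<phi>': "continuous_on UNIV \<phi>'"
    unfolding \<phi>'_def[abs_def] h'_def using \<rho>0 \<theta> K1
    by (intro continuous_intros c\<rho> c\<rho>' continuous_on_compose2[OF smooth_step_props(7) carg])
       (auto simp: less_imp_neq[symmetric] dest: less_imp_neq)
  have \<phi>01: "0 \<le> \<phi> z" "\<phi> z \<le> 1" for z by (simp_all add: \<phi>_def smooth_step_props)

  have lev_less: "lev z < y \<longleftrightarrow> \<rho> z < 2 powr (y * \<theta>2)" and less_lev: "y < lev z \<longleftrightarrow> 2 powr (y * \<theta>2) < \<rho> z"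
    and lev_le: "lev z \<le> y \<longleftrightarrow> \<rho> z \<le> 2 powr (y * \<theta>2)" for y z
  proof -
    have e: "ln (2 powr (y * \<theta>2)) = y * (\<theta>2 * ln 2)" by (simp add: ln_powr)
    have p: "\<theta>2 * ln 2 > 0" using \<theta> by simp
    show "lev z < y \<longleftrightarrow> \<rho> z < 2 powr (y * \<theta>2)"
      unfolding lev_def pos_divide_less_eq[OF p] e[symmetric] by (rule ln_less_cancel_iff) (use \<rho>0 in auto)
    show "y < lev z \<longleftrightarrow> 2 powr (y * \<theta>2) < \<rho> z"
      unfolding lev_def pos_less_divide_eq[OF p] e[symmetric] by (rule ln_less_cancel_iff) (use \<rho>0 in auto)
    show "lev z \<le> y \<longleftrightarrow> \<rho> z \<le> 2 powr (y * \<theta>2)"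
      unfolding lev_def pos_divide_le_eq[OF p] e[symmetric] by (rule ln_le_cancel_iff) (use \<rho>0 in auto)
  qed
  have inner: "s < D (fst z)" "(snd z)\<^sup>2 + c\<^sup>2 < (2 powr (2 * real K * \<theta>2)) powr (2 / \<theta>1)" if "lev z < 2 * real K - 1/2" for z
  proof -
    have r: "\<rho> z < 2 powr ((2 * real K - 1/2) * \<theta>2)" using that lev_less by simp
    have "((D (fst z))\<^sup>2 + c\<^sup>2) powr (- \<theta>2 / 2) < 2 powr ((2 * real K - 1/2) * \<theta>2)"
      using r powr_ge_zero[of "(snd z)\<^sup>2 + c\<^sup>2" "\<theta>1 / 2"] unfolding \<rho>_def by linarith
    also have "\<dots> = (2 powr (- 4 * real K + 1)) powr (- \<theta>2 / 2)"
      by (simp add: powr_powr algebra_simps)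
    finally have "2 powr (- 4 * real K + 1) < (D (fst z))\<^sup>2 + c\<^sup>2"
      using powr_mono2'[of "- \<theta>2 / 2" "(D (fst z))\<^sup>2 + c\<^sup>2" "2 powr (- 4 * real K + 1)"] pos[of "D (fst z)"] \<theta>
      by (force simp: not_le[symmetric])
    moreover have "2 powr (- 4 * real K + 1) = 2 * s\<^sup>2"
    proof -
      have "s\<^sup>2 = 2 powr (- 4 * real K)" by (simp add: s_def power2_eq_square powr_add[symmetric])
      then show ?thesis by (simp only: powr_add) simp
    qed
    moreover have "c\<^sup>2 \<le> s\<^sup>2" using c s by (intro power_mono) auto
    ultimately have "s\<^sup>2 < (D (fst z))\<^sup>2" by linarith
    then show "s < D (fst z)" using D0 by (rule power_less_imp_less_base)
    have "((snd z)\<^sup>2 + c\<^sup>2) powr (\<theta>1 / 2) < 2 powr ((2 * real K - 1/2) * \<theta>2)"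
      using r powr_ge_zero[of "(D (fst z))\<^sup>2 + c\<^sup>2" "- \<theta>2 / 2"] unfolding \<rho>_def by linarith
    also have "\<dots> \<le> 2 powr (2 * real K * \<theta>2)" using \<theta> by (intro powr_mono mult_right_mono) auto
    finally have "(((snd z)\<^sup>2 + c\<^sup>2) powr (\<theta>1 / 2)) powr (2 / \<theta>1) < (2 powr (2 * real K * \<theta>2)) powr (2 / \<theta>1)"
      using \<theta> by (intro powr_less_mono2) auto
    also have "(((snd z)\<^sup>2 + c\<^sup>2) powr (\<theta>1 / 2)) powr (2 / \<theta>1) = (snd z)\<^sup>2 + c\<^sup>2"
      using \<theta> pos[of "snd z"] by (simp add: powr_powr)
    finally show "(snd z)\<^sup>2 + c\<^sup>2 < (2 powr (2 * real K * \<theta>2)) powr (2 / \<theta>1)" .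
  qed
  have \<phi>0: "lev z < 2 * real K - 1/2" if "\<phi> z \<noteq> 0" for z
  proof (rule ccontr)
    assume "\<not> ?thesis"
    then have "arg z \<le> 0" using K1 by (simp add: arg_def divide_le_0_iff)
    then show False using that by (simp add: \<phi>_def smooth_step_props)
  qed

  define TT where "TT = sqrt ((2 powr (2 * real K * \<theta>2)) powr (2 / \<theta>1))"
  define S where "S = {x. s \<le> D x} \<times> {1 / real K .. TT}"
  have SO: "x \<in> \<Omega>" if "s \<le> D x" for x
  proof -
    have "0 < dd x" using Dd[of x] c s that by linarith
    then show ?thesis by (auto simp: dd_def inner_dist_def split: if_splits)
  qed
  have "closed {x. s \<le> D x}"
    by (intro closed_Collect_le continuous_intros cD)
  moreover have "bounded {x. s \<le> D x}"
    using SO by (intro bounded_subset[OF \<Omega>(2)]) auto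
  ultimately have "compact S"
    unfolding S_def by (intro compact_Times compact_Icc) (simp add: compact_eq_bounded_closed)
  have "S \<subseteq> open_cyl \<Omega>"
    unfolding S_def using SO less_le_trans[OF \<tau>] by (force simp: \<tau>_def)
  have Soff: "\<phi> z = 0 \<or> snd z < 1 / real K" if "z \<notin> S" for z
  proof (rule ccontr)
    assume "\<not> ?thesis"
    then have z: "\<phi> z \<noteq> 0" "1 / real K \<le> snd z" by auto
    note i = inner[OF \<phi>0[OF z(1)]]
    have "(snd z)\<^sup>2 \<le> (2 powr (2 * real K * \<theta>2)) powr (2 / \<theta>1)" using i(2) zero_le_power2[of c] by linarith
    then have "\<bar>snd z\<bar> \<le> TT" unfolding TT_def by (metis real_sqrt_abs real_sqrt_le_mono)
    then have "z \<in> S" using i(1) z(2) unfolding S_def by (cases z) auto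
    with that show False by simp
  qed

  define r where "r x t = bdry_dist \<Omega> x powr (- \<theta>2) + t powr \<theta>1" for x t
  have cmp: "\<rho> (x, t) \<le> 2 powr (\<theta>2 / 2) * r x t" "2 powr (- \<theta>2 / 2) * r x t \<le> \<rho> (x, t)"
    "\<bar>P x\<bar> \<le> 3 * \<theta>2 * 2 powr (\<theta>2 / 2) * bdry_dist \<Omega> x powr (- \<theta>2 - 1)"
    "\<bar>T t\<bar> \<le> \<theta>1 * 2 powr (\<theta>2 / 2) * t powr (\<theta>1 - 1)"
    if x: "x \<in> \<Omega>" "8 * c \<le> bdry_dist \<Omega> x" and t: "1 / real K \<le> t" for x t
  proof -
    let ?d = "bdry_dist \<Omega> x"
    have "\<bar>D x - ?d\<bar> \<le> c" using Dd[of x] x by (simp add: dd_def inner_dist_def)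
    note cd = regularised_dist_comparison[OF c(1) x(2) this, of \<theta>2]
    note ct = regularised_time_comparison[OF \<tau> t[folded \<tau>_def] cb, of]
    have t0: "t > 0" using t \<tau> unfolding \<tau>_def by linarith
    have d0: "?d > 0" using x c by linarith
    have \<theta>0: "\<theta>1 > 0" "\<theta>2 > 0" using \<theta> by auto
    have two: "1 \<le> 2 powr (\<theta>2 / 2)" "2 powr (- \<theta>2 / 2) \<le> (1::real)"
      using \<theta>0 powr_mono[of 0 "\<theta>2 / 2" 2] powr_mono[of "- \<theta>2 / 2" 0 2] by auto
    show "\<rho> (x, t) \<le> 2 powr (\<theta>2 / 2) * r x t"
      using cd(1) ct(2) \<theta>0 by (simp add: \<rho>_def r_def distrib_left)
    have "2 powr (- \<theta>2 / 2) * t powr \<theta>1 \<le> 1 * t powr \<theta>1" using two(2) by (intro mult_right_mono) auto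
    also have "\<dots> \<le> (t\<^sup>2 + c\<^sup>2) powr (\<theta>1 / 2)" using ct(1) \<theta>0 by simp
    finally show "2 powr (- \<theta>2 / 2) * r x t \<le> \<rho> (x, t)"
      using cd(2) \<theta>0 by (simp add: \<rho>_def r_def distrib_left)
    have gen: "(k / 2) * A powr (e - 1) * (2 * y) = k * ((y / A) * A powr e)" if "A > 0" for k A e y :: real
      using that by (simp add: powr_diff)
    have "\<bar>P x\<bar> = \<theta>2 * ((D x / ((D x)\<^sup>2 + c\<^sup>2)) * ((D x)\<^sup>2 + c\<^sup>2) powr (- \<theta>2 / 2))"
      using \<theta>0 D0[of x] pos[of "D x"] unfolding P_def gen[OF pos] by (simp add: abs_mult)
    also have "\<dots> \<le> \<theta>2 * ((3 / ?d) * (2 powr (\<theta>2 / 2) * ?d powr (- \<theta>2)))"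
      using cd \<theta>0 D0[of x] d0 by (intro mult_left_mono mult_mono) auto
    also have "\<dots> = 3 * \<theta>2 * 2 powr (\<theta>2 / 2) * ?d powr (- \<theta>2 - 1)"
      using d0 by (simp add: powr_diff)
    finally show "\<bar>P x\<bar> \<le> 3 * \<theta>2 * 2 powr (\<theta>2 / 2) * bdry_dist \<Omega> x powr (- \<theta>2 - 1)" .
    have "\<bar>T t\<bar> = \<theta>1 * ((t / (t\<^sup>2 + c\<^sup>2)) * (t\<^sup>2 + c\<^sup>2) powr (\<theta>1 / 2))"
      using \<theta>0 t0 pos[of t] unfolding T_def gen[OF pos] by (simp add: abs_mult)
    also have "\<dots> \<le> \<theta>1 * ((1 / t) * (2 powr (\<theta>2 / 2) * t powr \<theta>1))"
      using ct \<theta>0 t0 by (intro mult_left_mono mult_mono) auto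
    also have "\<dots> = \<theta>1 * 2 powr (\<theta>2 / 2) * t powr (\<theta>1 - 1)"
      using t0 by (simp add: powr_diff)
    finally show "\<bar>T t\<bar> \<le> \<theta>1 * 2 powr (\<theta>2 / 2) * t powr (\<theta>1 - 1)" .
  qed
  have one: "\<phi> z = 1" if z: "z \<in> E_set \<Omega> \<theta>1 \<theta>2 (2 powr - real K)" "1 / real K \<le> snd z" for z
  proof -
    obtain x t where zx: "z = (x, t)" by (cases z)
    have E: "x \<in> \<Omega>" "r x t \<le> 2 powr (real K * \<theta>2)"
      using z(1) unfolding zx E_set_iff[OF refl] r_def by auto
    have d0: "bdry_dist \<Omega> x > 0"
      using inner_dist_pos[OF \<Omega> E(1)] E(1) by (simp add: inner_dist_def)
    have "bdry_dist \<Omega> x powr (- \<theta>2) \<le> (2 powr (- real K)) powr (- \<theta>2)"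
    proof -
      have "bdry_dist \<Omega> x powr (- \<theta>2) \<le> 2 powr (real K * \<theta>2)"
        using E(2) powr_ge_zero[of t \<theta>1] unfolding r_def by linarith
      then show ?thesis by (simp add: powr_powr)
    qed
    then have "2 powr (- real K) \<le> bdry_dist \<Omega> x"
      using powr_less_mono2_neg[of "- \<theta>2" "bdry_dist \<Omega> x" "2 powr (- real K)"] d0 \<theta> by (force simp: not_le[symmetric])
    moreover have "s \<le> 2 powr (- real K)" unfolding s_def by (intro powr_mono) auto
    ultimately have "8 * c \<le> bdry_dist \<Omega> x" using c s by linarith
    from cmp(1)[OF E(1) this, of t] z(2)
    have "\<rho> z \<le> 2 powr (\<theta>2 / 2) * r x t" by (simp add: zx)
    also have "\<dots> \<le> 2 powr (\<theta>2 / 2) * 2 powr (real K * \<theta>2)" using E(2) by (intro mult_left_mono) auto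
    also have "\<dots> = 2 powr ((real K + 1/2) * \<theta>2)" by (simp add: powr_add[symmetric] algebra_simps)
    finally have "lev z \<le> real K + 1/2" using lev_le by simp
    then have "1 \<le> arg z" using K1 by (simp add: arg_def le_divide_eq)
    then show ?thesis by (simp add: \<phi>_def smooth_step_props)
  qed
  have annulus: "\<exists>j. K \<le> j \<and> j < 2 * K \<and>
        (x, t) \<in> E_set \<Omega> \<theta>1 \<theta>2 (2 powr - real (Suc j)) - E_set \<Omega> \<theta>1 \<theta>2 (2 powr - real j) \<and>
        norm (fst (\<phi>' (x, t))) \<le> (m / real K) * (bdry_dist \<Omega> x powr (- \<theta>2 - 1) * 2 powr (- (real j * \<theta>2))) \<and>
        \<bar>snd (\<phi>' (x, t))\<bar> \<le> (m / real K) * (t powr (\<theta>1 - 1) * 2 powr (- (real j * \<theta>2)))"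
    if t: "1 / real K \<le> t" and nz: "\<phi>' (x, t) \<noteq> 0" for x t
  proof -
    let ?z = "(x, t)"
    have "smooth_step' (arg ?z) \<noteq> 0" using nz by (auto simp: \<phi>'_def)
    then have "0 < arg ?z" "arg ?z < 1" using smooth_step_props(6)[of "arg ?z"] by (auto simp: not_le[symmetric])
    then have lev: "lev ?z < 2 * real K - 1/2" "real K + 1/2 < lev ?z"
      using K1 by (auto simp: arg_def zero_less_divide_iff divide_less_eq)
    have D: "s < D x" using inner(1)[OF lev(1)] by simp
    have xO: "x \<in> \<Omega>" using SO D by (simp add: less_imp_le)
    have d8: "8 * c \<le> bdry_dist \<Omega> x"
      using Dd[of x] xO D c by (simp add: dd_def inner_dist_def)
    note C = cmp[OF xO d8 t]
    have d0: "bdry_dist \<Omega> x > 0" using d8 c by linarith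
    have r0: "r x t > 0" unfolding r_def using d0 by (intro add_pos_nonneg) auto
    have t0: "t > 0" using t \<tau> unfolding \<tau>_def by linarith
    have half_pow: "2 powr (\<theta>2 / 2) * 2 powr (- \<theta>2 / 2) = (1::real)"
      by (simp add: powr_add[symmetric])
    have hi: "r x t < 2 powr (2 * real K * \<theta>2)"
    proof -
      have "2 powr (- \<theta>2 / 2) * r x t < 2 powr ((2 * real K - 1/2) * \<theta>2)"
        using C(2) lev(1) lev_less by (metis le_less_trans)
      then have "2 powr (\<theta>2 / 2) * (2 powr (- \<theta>2 / 2) * r x t) < 2 powr (\<theta>2 / 2) * 2 powr ((2 * real K - 1/2) * \<theta>2)"
        by (intro mult_strict_left_mono) auto
      also have "2 powr (\<theta>2 / 2) * 2 powr ((2 * real K - 1/2) * \<theta>2) = 2 powr (2 * real K * \<theta>2)"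
        by (subst powr_add[symmetric], rule arg_cong[where f = "\<lambda>e. 2 powr e"]) (simp add: algebra_simps)
      finally show ?thesis unfolding mult.assoc[symmetric] half_pow by simp
    qed
    have lo: "2 powr (real K * \<theta>2) < r x t"
    proof -
      have "2 powr ((real K + 1/2) * \<theta>2) < 2 powr (\<theta>2 / 2) * r x t"
        using C(1) lev(2) less_lev by (metis less_le_trans)
      then have "2 powr (- \<theta>2 / 2) * 2 powr ((real K + 1/2) * \<theta>2) < 2 powr (- \<theta>2 / 2) * (2 powr (\<theta>2 / 2) * r x t)"
        by (intro mult_strict_left_mono) auto
      also have "2 powr (- \<theta>2 / 2) * (2 powr (\<theta>2 / 2) * r x t) = r x t"
        unfolding mult.assoc[symmetric] by (subst mult.commute[of "2 powr (- \<theta>2 / 2)"]) (simp only: half_pow mult_1)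
      also have "2 powr (- \<theta>2 / 2) * 2 powr ((real K + 1/2) * \<theta>2) = 2 powr (real K * \<theta>2)"
        by (subst powr_add[symmetric], rule arg_cong[where f = "\<lambda>e. 2 powr e"]) (simp add: algebra_simps)
      finally show ?thesis .
    qed
    \<comment> \<open>The index of the annulus is the integer part of the level, rounded so that the upper bound is
      attained, as in the difference of the two sets.\<close>
    define j where "j = (GREATEST j. 2 powr (real j * \<theta>2) < r x t)"
    have bnd: "j \<le> 2 * K" if "2 powr (real j * \<theta>2) < r x t" for j
    proof (rule ccontr)
      assume "\<not> ?thesis"
      then have "2 powr (2 * real K * \<theta>2) \<le> 2 powr (real j * \<theta>2)"
        using \<theta> by (intro powr_mono mult_right_mono) auto
      with hi that show False by linarith
    qed
    have jl: "2 powr (real j * \<theta>2) < r x t" unfolding j_def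
      by (rule GreatestI_nat[where P = "\<lambda>j. 2 powr (real j * \<theta>2) < r x t", OF lo bnd])
    have ju: "r x t \<le> 2 powr (real (Suc j) * \<theta>2)"
    proof (rule ccontr)
      assume "\<not> ?thesis"
      then have "Suc j \<le> j" unfolding j_def
        by (intro Greatest_le_nat[where P = "\<lambda>j. 2 powr (real j * \<theta>2) < r x t", OF _ bnd]) auto
      then show False by simp
    qed
    have jK: "K \<le> j" unfolding j_def
      by (rule Greatest_le_nat[where P = "\<lambda>j. 2 powr (real j * \<theta>2) < r x t", OF lo bnd])
    have j2: "j < 2 * K"
    proof (rule ccontr)
      assume "\<not> ?thesis"
      then have "2 powr (2 * real K * \<theta>2) \<le> 2 powr (real j * \<theta>2)"
        using \<theta> by (intro powr_mono mult_right_mono) auto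
      with hi jl show False by linarith
    qed
    have mem: "(x, t) \<in> E_set \<Omega> \<theta>1 \<theta>2 (2 powr - real (Suc j)) - E_set \<Omega> \<theta>1 \<theta>2 (2 powr - real j)"
      using ju jl xO t0 unfolding Diff_iff E_set_iff[OF refl] r_def by auto
    have r1: "1 / r x t \<le> 2 powr (- (real j * \<theta>2))"
      using jl r0 by (simp add: powr_minus_divide frac_le)
    have rho1: "1 / \<rho> ?z \<le> 2 powr (\<theta>2 / 2) * 2 powr (- (real j * \<theta>2))"
    proof -
      have "1 / \<rho> ?z \<le> 1 / (2 powr (- \<theta>2 / 2) * r x t)"
        using C(2) r0 by (intro frac_le) auto
      also have "\<dots> = 2 powr (\<theta>2 / 2) * (1 / r x t)" by (simp add: powr_minus_divide)
      also have "\<dots> \<le> 2 powr (\<theta>2 / 2) * 2 powr (- (real j * \<theta>2))"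
        using r1 by (intro mult_left_mono) auto
      finally show ?thesis .
    qed
    define w where "w = smooth_step' (arg ?z) * h' (\<rho> ?z)"
    have w: "\<bar>w\<bar> \<le> M * ((2 powr (\<theta>2 / 2) * 2 powr (- (real j * \<theta>2))) * (1 / (\<theta>2 * ln 2)) * (2 / real K))"
    proof -
      have "\<bar>h' (\<rho> ?z)\<bar> = (1 / \<rho> ?z) * (1 / (\<theta>2 * ln 2)) * (1 / (real K - 1))"
        using \<rho>0[of ?z] \<theta> K1 by (simp add: h'_def abs_mult)
      also have "\<dots> \<le> (2 powr (\<theta>2 / 2) * 2 powr (- (real j * \<theta>2))) * (1 / (\<theta>2 * ln 2)) * (2 / real K)"
        using rho1 K1 \<theta> \<rho>0[of ?z] by (intro mult_mono) auto
      finally have h: "\<bar>h' (\<rho> ?z)\<bar> \<le> \<dots>" .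
      show ?thesis
        unfolding w_def abs_mult using h M smooth_step_props(5)[of "arg ?z"]
        by (intro mult_mono) auto
    qed
    have pow2: "2 powr (\<theta>2 / 2) * 2 powr (\<theta>2 / 2) = (2::real) powr \<theta>2" by (simp add: powr_add[symmetric])
    have fin: "\<bar>w\<bar> * (k * 2 powr (\<theta>2 / 2) * y) \<le> (m / real K) * (y * 2 powr (- (real j * \<theta>2)))"
      if k: "0 \<le> k" "k \<le> 3 * \<theta>2 + \<theta>1" and y: "0 \<le> y" for k y
    proof -
      have "\<bar>w\<bar> * (k * 2 powr (\<theta>2 / 2) * y) \<le>
         (M * ((2 powr (\<theta>2 / 2) * 2 powr (- (real j * \<theta>2))) * (1 / (\<theta>2 * ln 2)) * (2 / real K))) *
         ((3 * \<theta>2 + \<theta>1) * 2 powr (\<theta>2 / 2) * y)"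
        using k y w M(1) \<theta> by (intro mult_mono) auto
      also have "\<dots> = (M * 2 * (2 powr (\<theta>2 / 2) * 2 powr (\<theta>2 / 2)) * (3 * \<theta>2 + \<theta>1) / (\<theta>2 * ln 2) / real K)
          * (y * 2 powr (- (real j * \<theta>2)))"
        by (simp add: field_simps)
      finally show ?thesis unfolding pow2 m_def .
    qed
    have "norm (fst (\<phi>' ?z)) = \<bar>w\<bar> * \<bar>P x\<bar> * norm (gD x)"
      by (simp add: \<phi>'_def \<rho>'_def w_def abs_mult)
    also have "\<dots> \<le> \<bar>w\<bar> * (3 * \<theta>2 * 2 powr (\<theta>2 / 2) * bdry_dist \<Omega> x powr (- \<theta>2 - 1)) * 1"
      using C(3) ngD[of x] by (intro mult_mono mult_left_mono) auto
    also have "\<dots> \<le> (m / real K) * (bdry_dist \<Omega> x powr (- \<theta>2 - 1) * 2 powr (- (real j * \<theta>2)))"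
      using fin[of "3 * \<theta>2" "bdry_dist \<Omega> x powr (- \<theta>2 - 1)"] \<theta> by simp
    finally have F: "norm (fst (\<phi>' ?z)) \<le> \<dots>" .
    have "\<bar>snd (\<phi>' ?z)\<bar> = \<bar>w\<bar> * \<bar>T t\<bar>"
      by (simp add: \<phi>'_def \<rho>'_def w_def abs_mult)
    also have "\<dots> \<le> \<bar>w\<bar> * (\<theta>1 * 2 powr (\<theta>2 / 2) * t powr (\<theta>1 - 1))"
      using C(4) by (intro mult_left_mono) auto
    also have "\<dots> \<le> (m / real K) * (t powr (\<theta>1 - 1) * 2 powr (- (real j * \<theta>2)))"
      using fin[of \<theta>1 "t powr (\<theta>1 - 1)"] \<theta> by simp
    finally have "\<bar>snd (\<phi>' ?z)\<bar> \<le> \<dots>" .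
    with F mem jK j2 show ?thesis by blast
  qed
  show thesis
    by (rule that[OF g\<phi> c\<phi>' \<phi>01 \<open>compact S\<close> \<open>S \<subseteq> open_cyl \<Omega>\<close> Soff one annulus])
qed

section \<open>Summation over dyadic annuli\<close>

lemma weighted_power_bound:
  fixes x c k Y W V e w g :: real
  assumes x: "0 \<le> x" "x \<le> (c / k) * (Y * W)" and nn: "0 \<le> c" "0 < k" "0 \<le> Y" "0 \<le> W" "0 < V"
    and e: "0 \<le> e" and w: "w \<le> g"
  shows "x powr e * (V / 4) powr (- w) \<le> ((c / k) powr e * W powr e * 4 powr g) * (Y powr e * V powr (- w))"
proof -
  have "x powr e \<le> ((c / k) * (Y * W)) powr e" using x e by (intro powr_mono2) auto
  also have "\<dots> = (c / k) powr e * (Y powr e * W powr e)"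
    using nn by (simp only: powr_mult)
  finally have 1: "x powr e \<le> (c / k) powr e * (Y powr e * W powr e)" .
  have "(V / 4) powr (- w) = 4 powr w * V powr (- w)"
    using nn by (simp add: powr_divide powr_minus_divide)
  also have "\<dots> \<le> 4 powr g * V powr (- w)" using w by (intro mult_right_mono powr_mono) auto
  finally have 2: "(V / 4) powr (- w) \<le> 4 powr g * V powr (- w)" .
  have "x powr e * (V / 4) powr (- w) \<le> ((c / k) powr e * (Y powr e * W powr e)) * (4 powr g * V powr (- w))"
    by (intro mult_mono 1 2) auto
  then show ?thesis by (simp only: mult_ac)
qed

text \<open>
  The loss \<open>\<delta> powr (- C0 * \<epsilon>)\<close> and the loss from lowering the exponent \<open>Q\<close> by \<open>\<epsilon>\<close> remain bounded,
  because \<open>\<epsilon> = 1 / (K * D)\<close> while \<open>\<delta> = 2 powr (- j)\<close> with \<open>j < 2 * K\<close>. What is left is the factor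
  \<open>K powr (- Q)\<close> from the derivatives of the cut-off and the factor \<open>K powr s\<close> from the logarithm.
\<close>

lemma annulus_term_bound:
  fixes c D Q s l \<theta> C0 C g :: real and j K :: nat
  assumes K: "K \<ge> 1" and j: "j < 2 * K" and c: "c \<ge> 1" and D: "D > 0" and Q: "1 / (real K * D) \<le> Q"
    and nn: "0 \<le> s" "0 \<le> l" "0 \<le> \<theta>" "0 \<le> C0" "0 \<le> C" "0 \<le> g"
  defines "e \<equiv> Q - 1 / (real K * D)"
  shows "((c / real K) powr e * (2 powr (- (real j * \<theta>) * l)) powr e * g)
        * (C * (2 powr - real j) powr (- (l * Q) * \<theta> - C0 * (1 / (real K * D))) * \<bar>ln (2 powr - real j)\<bar> powr s)
     \<le> (g * c powr Q * exp (1 / D) * C * 2 powr (2 * (C0 + \<theta> * l) / D) * 2 powr s) * real K powr (s - Q)"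
proof -
  define \<epsilon> where "\<epsilon> = 1 / (real K * D)"
  have k: "real K \<ge> 1" "real K > 0" using K by auto
  have \<epsilon>: "0 \<le> \<epsilon>" "\<epsilon> \<le> Q" using k D Q by (auto simp: \<epsilon>_def)
  have e: "e = Q - \<epsilon>" by (simp add: e_def \<epsilon>_def)
  have "(c / real K) powr e = c powr (Q - \<epsilon>) * (real K powr (- Q) * real K powr \<epsilon>)"
    using c k by (simp add: e powr_divide powr_diff powr_minus_divide)
  also have "\<dots> \<le> c powr Q * (real K powr (- Q) * exp (1 / D))"
  proof (intro mult_mono)
    show "c powr (Q - \<epsilon>) \<le> c powr Q" using c \<epsilon> by (intro powr_mono) auto
    have "ln (real K) \<le> real K" using ln_le_minus_one[of "real K"] k by linarith
    then have "\<epsilon> * ln (real K) \<le> \<epsilon> * real K" using \<epsilon> by (intro mult_left_mono)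
    also have "\<dots> = 1 / D" using k by (simp add: \<epsilon>_def)
    finally show "real K powr \<epsilon> \<le> exp (1 / D)" using k by (simp add: powr_def)
  qed auto
  finally have 1: "(c / real K) powr e \<le> c powr Q * (real K powr (- Q) * exp (1 / D))" .
  have "(2 powr (- (real j * \<theta>) * l)) powr e * (2 powr - real j) powr (- (l * Q) * \<theta> - C0 * \<epsilon>)
      = 2 powr ((real j * \<epsilon>) * (C0 + \<theta> * l))"
    by (simp add: powr_powr powr_add[symmetric] e algebra_simps)
  also have "\<dots> \<le> 2 powr (2 * (C0 + \<theta> * l) / D)"
  proof (intro powr_mono)
    have "real j * \<epsilon> \<le> (2 * real K) * \<epsilon>" using j \<epsilon> by (intro mult_right_mono) auto
    also have "\<dots> = 2 / D" using k by (simp add: \<epsilon>_def)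
    finally have "(real j * \<epsilon>) * (C0 + \<theta> * l) \<le> (2 / D) * (C0 + \<theta> * l)"
      using nn by (intro mult_right_mono) auto
    then show "(real j * \<epsilon>) * (C0 + \<theta> * l) \<le> 2 * (C0 + \<theta> * l) / D" by simp
  qed simp
  finally have 2: "(2 powr (- (real j * \<theta>) * l)) powr e * (2 powr - real j) powr (- (l * Q) * \<theta> - C0 * \<epsilon>)
      \<le> 2 powr (2 * (C0 + \<theta> * l) / D)" .
  have "\<bar>ln (2 powr - real j)\<bar> = real j * ln 2" by (simp add: ln_powr abs_mult)
  also have "\<dots> \<le> (2 * real K) * 1" using j ln_2_less_1 by (intro mult_mono) auto
  finally have "\<bar>ln (2 powr - real j)\<bar> powr s \<le> (2 * real K) powr s" using nn by (intro powr_mono2) auto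
  also have "\<dots> = 2 powr s * real K powr s" by (simp add: powr_mult)
  finally have 3: "\<bar>ln (2 powr - real j)\<bar> powr s \<le> 2 powr s * real K powr s" .
  have "((c / real K) powr e * (2 powr (- (real j * \<theta>) * l)) powr e * g)
        * (C * (2 powr - real j) powr (- (l * Q) * \<theta> - C0 * \<epsilon>) * \<bar>ln (2 powr - real j)\<bar> powr s)
     = (g * C) * ((c / real K) powr e * (((2 powr (- (real j * \<theta>) * l)) powr e
          * (2 powr - real j) powr (- (l * Q) * \<theta> - C0 * \<epsilon>)) * \<bar>ln (2 powr - real j)\<bar> powr s))"
    by (simp only: mult_ac)
  also have "\<dots> \<le> (g * C) * ((c powr Q * (real K powr (- Q) * exp (1 / D))) *
       (2 powr (2 * (C0 + \<theta> * l) / D) * (2 powr s * real K powr s)))"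
    using nn by (intro mult_left_mono mult_mono 1 2 3) auto
  also have "\<dots> = (g * c powr Q * exp (1 / D) * C * 2 powr (2 * (C0 + \<theta> * l) / D) * 2 powr s)
      * (real K powr s * real K powr (- Q))"
    by (simp only: mult_ac)
  also have "real K powr s * real K powr (- Q) = real K powr (s - Q)" by (simp add: powr_add[symmetric])
  finally show ?thesis by (simp only: \<epsilon>_def)
qed

lemma AE_lborel_time_nonzero: "AE z in (lborel :: ('a::euclidean_space \<times> real) measure). snd z \<noteq> 0"
proof -
  have "negligible {z :: 'a \<times> real. (0, 1) \<bullet> z = 0}"
    by (rule negligible_hyperplane) (simp add: zero_prod_def)
  then have "{z :: 'a \<times> real. snd z = 0} \<in> null_sets lebesgue"
    by (simp add: negligible_iff_null_sets inner_prod_def)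
  then have "AE z in lebesgue. (z :: 'a \<times> real) \<notin> {z. snd z = 0}" by (rule AE_not_in)
  then show ?thesis by (simp add: AE_completion_iff)
qed

lemma E_set_measurable:
  fixes \<Omega> :: "'a::euclidean_space set"
  assumes "open \<Omega>" shows "E_set \<Omega> \<theta>1 \<theta>2 \<delta> \<in> sets borel"
proof -
  have [measurable]: "(\<lambda>z :: 'a \<times> real. bdry_dist \<Omega> (fst z)) \<in> borel_measurable borel"
    by (intro borel_measurable_continuous_onI continuous_intros)
  have [measurable]: "(snd :: 'a \<times> real \<Rightarrow> real) \<in> borel_measurable borel"
    by (intro borel_measurable_continuous_onI continuous_intros)
  have "open ((fst :: 'a \<times> real \<Rightarrow> 'a) -` \<Omega>)" using assms by (rule open_vimage_fst)
  then have [measurable]: "(fst :: 'a \<times> real \<Rightarrow> 'a) -` \<Omega> \<in> sets borel" by simp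
  have "E_set \<Omega> \<theta>1 \<theta>2 \<delta> = (fst -` \<Omega>) \<inter> {z \<in> space borel. 0 \<le> snd z \<and>
      bdry_dist \<Omega> (fst z) powr (- \<theta>2) + snd z powr \<theta>1 \<le> \<delta> powr (- \<theta>2)}"
    by (auto simp: E_set_def)
  also have "\<dots> \<in> sets borel" by measurable
  finally show ?thesis .
qed

text \<open>
  The set \<open>A\<close> may contain points with \<open>t = 0\<close>, where the two potentials are not compared; these
  form a null set.
\<close>

lemma annulus_hypothesis:
  fixes \<Omega> :: "'a::euclidean_space set" and V VB :: "'a \<times> real \<Rightarrow> real"
  assumes ae: "AE z in lborel. z \<in> open_cyl \<Omega> \<longrightarrow> V z = VB z" and A: "A \<subseteq> cyl \<Omega>"
    and le: "(\<integral>\<^sup>+(x, t)\<in>A. ennreal (F x t * V (x, t) powr b) \<partial>lebesgue) \<le> B"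
  shows "(\<integral>\<^sup>+z. ennreal (F (fst z) (snd z) * VB z powr b) * indicator A z \<partial>lborel) \<le> B"
proof -
  have "(\<integral>\<^sup>+z. ennreal (F (fst z) (snd z) * VB z powr b) * indicator A z \<partial>lborel)
     = (\<integral>\<^sup>+z. (case z of (x, t) \<Rightarrow> ennreal (F x t * V (x, t) powr b)) * indicator A z \<partial>lborel)"
  proof (rule nn_integral_cong_AE)
    show "AE z in lborel. ennreal (F (fst z) (snd z) * VB z powr b) * indicator A z
        = (case z of (x, t) \<Rightarrow> ennreal (F x t * V (x, t) powr b)) * indicator A z"
      using ae AE_lborel_time_nonzero
    proof eventually_elim
      case (elim z)
      show ?case
      proof (cases "z \<in> A")
        case True
        then have "z \<in> cyl \<Omega>" using A by blast
        then have "z \<in> open_cyl \<Omega>" using elim(2) by auto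
        then have "V z = VB z" using elim(1) by blast
        then show ?thesis by (simp add: split_beta)
      qed simp
    qed
  qed
  then show ?thesis using le by (simp add: nn_integral_completion)
qed

text \<open>
  The capacity estimate for the logarithmic cut-off, summed over the \<open>K\<close> annuli that carry its
  derivatives. The exponent is \<open>a = 1 / K\<close>: then \<open>a powr (1 - p)\<close> times the factor
  \<open>(1 / K) powr p\<close> from the \<open>p\<close>-th power of the gradient is \<open>1 / K\<close>, the same gain as in the time
  derivative.
\<close>

lemma cutoff_estimate:
  fixes \<Omega> :: "'a::euclidean_space set" and u V :: "'a \<times> real \<Rightarrow> real" and X :: "'a \<times> real \<Rightarrow> 'a"
    and p q \<theta>1 \<theta>2 C0 C s1 s2 D1 D2 Q1 Q2 M :: real and n K :: nat
  assumes sup: "regular_supersolution p q (open_cyl \<Omega>) u V X"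
    and \<Omega>: "open \<Omega>" "bounded \<Omega>" and p: "p > 1" and q: "q > p - 1" "q > 1"
    and \<theta>: "\<theta>1 \<ge> 1" "\<theta>2 \<ge> 1" and C: "0 \<le> C0" "0 \<le> C" and s: "0 \<le> s1" "0 \<le> s2"
    and D: "D1 = q - p + 1" "D2 = q - 1" and Q: "Q1 = q / D1" "Q2 = q / D2"
    and M: "M > 0" "\<And>x. smooth_step' x \<le> M"
    and n: "real n > p" "real n \<ge> p * Q1" "real n \<ge> Q2"
    and K: "K \<ge> 2" "1 / real K < p - 1"
    and H1: "\<And>j. K \<le> j \<Longrightarrow>
      (\<integral>\<^sup>+z. ennreal (bdry_dist \<Omega> (fst z) powr (- (\<theta>2 + 1) * p * (Q1 - 1 / (real K * D1)))
            * V z powr (- (p - 1) / D1 + 1 / (real K * D1)))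
          * indicator (E_set \<Omega> \<theta>1 \<theta>2 (2 powr - real (Suc j)) - E_set \<Omega> \<theta>1 \<theta>2 (2 powr - real j)) z \<partial>lborel)
      \<le> ennreal (C * (2 powr - real j) powr (- (p * Q1) * \<theta>2 - C0 * (1 / (real K * D1))) * \<bar>ln (2 powr - real j)\<bar> powr s1)"
    and H2: "\<And>j. K \<le> j \<Longrightarrow>
      (\<integral>\<^sup>+z. ennreal (snd z powr ((\<theta>1 - 1) * (Q2 - 1 / (real K * D2)))
            * V z powr (- 1 / D2 + 1 / (real K * D2)))
          * indicator (E_set \<Omega> \<theta>1 \<theta>2 (2 powr - real (Suc j)) - E_set \<Omega> \<theta>1 \<theta>2 (2 powr - real j)) z \<partial>lborel)
      \<le> ennreal (C * (2 powr - real j) powr (- (1 * Q2) * \<theta>2 - C0 * (1 / (real K * D2))) * \<bar>ln (2 powr - real j)\<bar> powr s2)"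
  defines "m \<equiv> M * 2 * 2 powr \<theta>2 * (3 * \<theta>2 + \<theta>1) / (\<theta>2 * ln 2)"
  defines "c1 \<equiv> max 1 ((real n * m) powr p)" and "c2 \<equiv> max 1 (2 * real n * m)"
  defines "G1 \<equiv> 4 powr ((p - 1) / D1) * c1 powr Q1 * exp (1 / D1) * C * 2 powr (2 * (C0 + \<theta>2 * p) / D1) * 2 powr s1"
    and "G2 \<equiv> 4 powr (1 / D2) * c2 powr Q2 * exp (1 / D2) * C * 2 powr (2 * (C0 + \<theta>2 * 1) / D2) * 2 powr s2"
  shows "\<exists>\<psi>\<in>borel_measurable borel. (\<forall>z. 0 \<le> \<psi> z) \<and>
     (\<forall>z\<in>E_set \<Omega> \<theta>1 \<theta>2 (2 powr - real K). 2 / real K \<le> snd z \<longrightarrow> \<psi> z = 1) \<and>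
     (\<integral>\<^sup>+z. ennreal (V z * u z powr (q - 1 / real K) * \<psi> z) \<partial>lborel)
       \<le> 2 * (ennreal (real K * (G1 * real K powr (s1 - Q1))) + ennreal (real K * (G2 * real K powr (s2 - Q2))))"
proof -
  obtain \<phi> :: "'a \<times> real \<Rightarrow> real" and \<phi>' S where
    \<phi>: "\<And>z. has_grad \<phi> (\<phi>' z) z" "continuous_on UNIV \<phi>'" "\<And>z. 0 \<le> \<phi> z" "\<And>z. \<phi> z \<le> 1"
    and S: "compact S" "S \<subseteq> open_cyl \<Omega>" "\<And>z. z \<notin> S \<Longrightarrow> \<phi> z = 0 \<or> snd z < 1 / real K"
    and \<phi>1: "\<And>z. z \<in> E_set \<Omega> \<theta>1 \<theta>2 (2 powr - real K) \<Longrightarrow> 1 / real K \<le> snd z \<Longrightarrow> \<phi> z = 1"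
    and ann: "\<And>x t. 1 / real K \<le> t \<Longrightarrow> \<phi>' (x, t) \<noteq> 0 \<Longrightarrow> \<exists>j. K \<le> j \<and> j < 2 * K \<and>
        (x, t) \<in> E_set \<Omega> \<theta>1 \<theta>2 (2 powr - real (Suc j)) - E_set \<Omega> \<theta>1 \<theta>2 (2 powr - real j) \<and>
        norm (fst (\<phi>' (x, t))) \<le> (m / real K) * (bdry_dist \<Omega> x powr (- \<theta>2 - 1) * 2 powr (- (real j * \<theta>2))) \<and>
        \<bar>snd (\<phi>' (x, t))\<bar> \<le> (m / real K) * (t powr (\<theta>1 - 1) * 2 powr (- (real j * \<theta>2)))"
    using logarithmic_cutoff[OF \<Omega> \<theta> K(1) M, folded m_def] by blast
  define a where "a = 1 / real K"
  have k: "real K \<ge> 2" "real K > 0" using K by auto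
  have a: "0 < a" "a < 1" "a < p - 1" "a \<le> 1/2" using k K by (auto simp: a_def field_simps)
  have D0: "D1 > 0" "D2 > 0" using q D by auto
  have m0: "0 \<le> m" unfolding m_def using M \<theta> by (intro divide_nonneg_nonneg mult_nonneg_nonneg) auto
  define \<eta> where "\<eta> t = smooth_step (real K * t - 1)" for t
  define \<eta>' where "\<eta>' t = real K * smooth_step' (real K * t - 1)" for t
  have \<eta>: "(\<eta> has_real_derivative \<eta>' t) (at t)" "0 \<le> \<eta> t" "\<eta> t \<le> 1" "0 \<le> \<eta>' t" for t
  proof -
    show "(\<eta> has_real_derivative \<eta>' t) (at t)"
      unfolding \<eta>_def[abs_def] \<eta>'_def
      by (rule DERIV_cong[OF DERIV_chain2[where g = "\<lambda>t. real K * t - 1", OF smooth_step_has_derivative]])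
         (auto intro!: derivative_eq_intros)
  qed (simp_all add: \<eta>_def \<eta>'_def smooth_step_props)
  have c\<eta>': "continuous_on UNIV \<eta>'"
    unfolding \<eta>'_def[abs_def]
    by (intro continuous_intros continuous_on_compose2[OF smooth_step_props(7)]) auto
  have \<eta>0: "\<eta> t = 0" if "t \<le> 1 / real K" for t
    using that k by (simp add: \<eta>_def smooth_step_props(3) field_simps)
  have \<eta>1: "\<eta> t = 1" if "2 / real K \<le> t" for t
    using that k by (simp add: \<eta>_def smooth_step_props(4) field_simps)
  have S': "\<phi> z = 0 \<or> \<eta> (snd z) = 0" if "z \<notin> S" for z
    using S(3)[OF that] \<eta>0[of "snd z"] by auto
  have n': "real n \<ge> p * (q / (q - p + 1))" "real n \<ge> q / (q - 1)"
    using n unfolding Q D by auto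
  define R where "R z = (a powr (1 - p) * (real n * norm (fst (\<phi>' z))) powr p) powr ((q - a) / (q - p + 1))
           * (V z / 4) powr (- ((p - 1 - a) / (q - p + 1)))
         + (real n * \<bar>snd (\<phi>' z)\<bar> / (1 - a)) powr ((q - a) / (q - 1)) * (V z / 4) powr (- ((1 - a) / (q - 1)))" for z
  define \<psi> where "\<psi> z = \<phi> z ^ n * \<eta> (snd z)" for z
  have est: "(\<integral>\<^sup>+z. ennreal (V z * u z powr (q - a) * \<psi> z) \<partial>lborel)
       \<le> 2 * (\<integral>\<^sup>+z. ennreal (\<eta> (snd z) * R z) \<partial>lborel)"
    unfolding R_def \<psi>_def
    by (rule capacity_estimate[OF sup p q _ \<phi> \<eta>(1) c\<eta>' \<eta>(2,3,4) S(1,2) S' n(1) n' a(1-3)])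
       (auto intro!: open_Times \<Omega>)
  have V0: "0 < V z" for z by (rule regular_supersolution.V_pos[OF sup])
  have [measurable]: "V \<in> borel_measurable borel" by (rule regular_supersolution.V_borel[OF sup])
  define AA where "AA j = E_set \<Omega> \<theta>1 \<theta>2 (2 powr - real (Suc j)) - E_set \<Omega> \<theta>1 \<theta>2 (2 powr - real j)" for j
  have [measurable]: "AA j \<in> sets borel" for j unfolding AA_def by (intro sets.Diff E_set_measurable \<Omega>)
  define e1 e2 where "e1 = Q1 - 1 / (real K * D1)" and "e2 = Q2 - 1 / (real K * D2)"
  define F1 where "F1 z = bdry_dist \<Omega> (fst z) powr (- (\<theta>2 + 1) * p * e1) * V z powr (- (p - 1) / D1 + 1 / (real K * D1))" for z
  define F2 where "F2 z = snd z powr ((\<theta>1 - 1) * e2) * V z powr (- 1 / D2 + 1 / (real K * D2))" for z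
  define k1 where "k1 j = (c1 / real K) powr e1 * (2 powr (- (real j * \<theta>2) * p)) powr e1 * 4 powr ((p - 1) / D1)" for j
  define k2 where "k2 j = (c2 / real K) powr e2 * (2 powr (- (real j * \<theta>2) * 1)) powr e2 * 4 powr (1 / D2)" for j
  have k0: "0 \<le> k1 j" "0 \<le> k2 j" for j by (simp_all add: k1_def k2_def)
  have F0: "0 \<le> F1 z" "0 \<le> F2 z" for z by (simp_all add: F1_def F2_def)
  have "(\<lambda>z :: 'a \<times> real. bdry_dist \<Omega> (fst z)) \<in> borel_measurable borel"
    "(snd :: 'a \<times> real \<Rightarrow> real) \<in> borel_measurable borel"
    by (intro borel_measurable_continuous_onI continuous_intros)+
  note [measurable] = this
  have [measurable]: "F1 \<in> borel_measurable borel" "F2 \<in> borel_measurable borel"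
    unfolding F1_def[abs_def] F2_def[abs_def] by measurable
  have aD: "a / d = 1 / (real K * d)" for d by (simp add: a_def)
  have e: "(q - a) / (q - p + 1) = e1" "(q - a) / (q - 1) = e2"
    unfolding e1_def e2_def Q D(1)[symmetric] D(2)[symmetric] diff_divide_distrib[of q a] aD by (rule refl)+
  have sp: "- ((x - y) / d) = - x / d + y / d" for x y d :: real
    by (simp add: diff_divide_distrib)
  have w: "- ((p - 1 - a) / (q - p + 1)) = - (p - 1) / D1 + 1 / (real K * D1)"
    "- ((1 - a) / (q - 1)) = - 1 / D2 + 1 / (real K * D2)"
    unfolding D(1)[symmetric] D(2)[symmetric] sp aD by (rule refl)+
  have wg: "(p - 1 - a) / (q - p + 1) \<le> (p - 1) / D1" "(1 - a) / (q - 1) \<le> 1 / D2"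
    unfolding D(1)[symmetric] D(2)[symmetric] using a D0 by (auto intro!: divide_right_mono)
  have e0: "0 \<le> e1" "0 \<le> e2" unfolding e[symmetric] using a q by auto
  have aQ: "1 / (real K * D1) \<le> Q1" "1 / (real K * D2) \<le> Q2" using e0 by (auto simp: e1_def e2_def)
  have R0: "0 \<le> R z" for z by (simp add: R_def)

  have Rj: "R z \<le> k1 j * F1 z + k2 j * F2 z"
    if g1: "norm (fst (\<phi>' z)) \<le> (m / real K) * (bdry_dist \<Omega> (fst z) powr (- \<theta>2 - 1) * 2 powr (- (real j * \<theta>2)))"
      and g2: "\<bar>snd (\<phi>' z)\<bar> \<le> (m / real K) * (snd z powr (\<theta>1 - 1) * 2 powr (- (real j * \<theta>2)))" for z j
  proof -
    let ?y = "bdry_dist \<Omega> (fst z) powr (- \<theta>2 - 1)" and ?w = "2 powr (- (real j * \<theta>2)) :: real"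
    have b1: "a powr (1 - p) * (real n * norm (fst (\<phi>' z))) powr p \<le> (c1 / real K) * (?y powr p * ?w powr p)"
    proof -
      have "(real n * norm (fst (\<phi>' z))) powr p \<le> (real n * ((m / real K) * (?y * ?w))) powr p"
        using p by (intro powr_mono2 mult_left_mono g1) auto
      also have "real n * ((m / real K) * (?y * ?w)) = (real n * m) * (a * (?y * ?w))"
        by (simp add: a_def)
      also have "\<dots> powr p = (real n * m) powr p * (a powr p * (?y powr p * ?w powr p))"
        using m0 a by (simp add: powr_mult)
      finally have "a powr (1 - p) * (real n * norm (fst (\<phi>' z))) powr p \<le>
          a powr (1 - p) * ((real n * m) powr p * (a powr p * (?y powr p * ?w powr p)))"
        by (intro mult_left_mono) auto
      also have "\<dots> = ((real n * m) powr p * (a powr (1 - p) * a powr p)) * (?y powr p * ?w powr p)"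
        by (simp only: mult_ac)
      also have "a powr (1 - p) * a powr p = a" using a by (simp add: powr_add[symmetric])
      also have "(real n * m) powr p * a * (?y powr p * ?w powr p) \<le> c1 * a * (?y powr p * ?w powr p)"
        using a by (intro mult_right_mono) (auto simp: c1_def)
      finally show ?thesis by (simp add: a_def)
    qed
    have 1: "(a powr (1 - p) * (real n * norm (fst (\<phi>' z))) powr p) powr e1 * (V z / 4) powr (- ((p - 1 - a) / (q - p + 1)))
       \<le> ((c1 / real K) powr e1 * (?w powr p) powr e1 * 4 powr ((p - 1) / D1))
           * ((?y powr p) powr e1 * V z powr (- ((p - 1 - a) / (q - p + 1))))"
      by (rule weighted_power_bound[OF _ b1 _ k(2) _ _ V0 e0(1) wg(1)]) (simp_all add: c1_def)
    have Y1: "(?y powr p) powr e1 = bdry_dist \<Omega> (fst z) powr (- (\<theta>2 + 1) * p * e1)"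
      unfolding powr_powr by (rule arg_cong[where f = "\<lambda>e. _ powr e"]) (simp add: algebra_simps)
    have W1: "?w powr p = 2 powr (- (real j * \<theta>2) * p)" by (simp add: powr_powr)
    have b2: "real n * \<bar>snd (\<phi>' z)\<bar> / (1 - a) \<le> (c2 / real K) * (snd z powr (\<theta>1 - 1) * ?w)"
    proof -
      have "real n * \<bar>snd (\<phi>' z)\<bar> / (1 - a) \<le> real n * ((m / real K) * (snd z powr (\<theta>1 - 1) * ?w)) / (1 / 2)"
        using a by (intro frac_le mult_left_mono g2 mult_nonneg_nonneg divide_nonneg_nonneg m0) auto
      also have "\<dots> = (2 * real n * m) / real K * (snd z powr (\<theta>1 - 1) * ?w)" by simp
      also have "\<dots> \<le> (c2 / real K) * (snd z powr (\<theta>1 - 1) * ?w)"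
        using k by (intro mult_right_mono divide_right_mono) (auto simp: c2_def)
      finally show ?thesis .
    qed
    have 2: "(real n * \<bar>snd (\<phi>' z)\<bar> / (1 - a)) powr e2 * (V z / 4) powr (- ((1 - a) / (q - 1)))
       \<le> ((c2 / real K) powr e2 * ?w powr e2 * 4 powr (1 / D2))
           * ((snd z powr (\<theta>1 - 1)) powr e2 * V z powr (- ((1 - a) / (q - 1))))"
      by (rule weighted_power_bound[OF _ b2 _ k(2) _ _ V0 e0(2) wg(2)]) (use a in \<open>simp_all add: c2_def\<close>)
    have Y2: "(snd z powr (\<theta>1 - 1)) powr e2 = snd z powr ((\<theta>1 - 1) * e2)" by (simp add: powr_powr)
    have W2: "?w = 2 powr (- (real j * \<theta>2) * 1)" by simp
    show ?thesis
      using add_mono[OF 1 2] unfolding R_def e w Y1 W1 Y2 F1_def F2_def k1_def k2_def W2[symmetric] .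
  qed
  have pt: "ennreal (\<eta> (snd z) * R z) \<le> (\<Sum>j\<in>{K..<2*K}.
       ennreal (k1 j) * (ennreal (F1 z) * indicator (AA j) z) + ennreal (k2 j) * (ennreal (F2 z) * indicator (AA j) z))" for z
  proof (cases "\<phi>' z = 0 \<or> \<eta> (snd z) = 0")
    case True
    then have z0: "\<eta> (snd z) * R z = 0" by (auto simp: R_def)
    show ?thesis unfolding z0 by simp
  next
    case False
    obtain x t where z: "z = (x, t)" by (cases z)
    have "1 / real K \<le> t" using \<eta>0[of t] False by (simp add: z) (metis linear)
    then obtain j where j: "K \<le> j" "j < 2 * K" "z \<in> AA j" and R: "R z \<le> k1 j * F1 z + k2 j * F2 z"
      using ann[of t x] False Rj[of z] unfolding z fst_conv snd_conv AA_def by blast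
    have "\<eta> (snd z) * R z \<le> 1 * R z" using \<eta> R0 by (intro mult_right_mono)
    then have "ennreal (\<eta> (snd z) * R z) \<le> ennreal (k1 j * F1 z + k2 j * F2 z)"
      using R by (intro ennreal_leI) simp
    also have "\<dots> = ennreal (k1 j) * (ennreal (F1 z) * indicator (AA j) z) + ennreal (k2 j) * (ennreal (F2 z) * indicator (AA j) z)"
      using k0 F0 j(3) by (simp add: ennreal_plus ennreal_mult)
    also have "\<dots> \<le> (\<Sum>j\<in>{K..<2*K}.
       ennreal (k1 j) * (ennreal (F1 z) * indicator (AA j) z) + ennreal (k2 j) * (ennreal (F2 z) * indicator (AA j) z))"
      by (rule member_le_sum) (use j in auto)
    finally show ?thesis .
  qed
  have "(\<integral>\<^sup>+z. ennreal (\<eta> (snd z) * R z) \<partial>lborel) \<le> (\<integral>\<^sup>+z. (\<Sum>j\<in>{K..<2*K}.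
       ennreal (k1 j) * (ennreal (F1 z) * indicator (AA j) z) + ennreal (k2 j) * (ennreal (F2 z) * indicator (AA j) z)) \<partial>lborel)"
    by (rule nn_integral_mono) (rule pt)
  also have "\<dots> = (\<Sum>j\<in>{K..<2*K}. ennreal (k1 j) * (\<integral>\<^sup>+z. ennreal (F1 z) * indicator (AA j) z \<partial>lborel)
       + ennreal (k2 j) * (\<integral>\<^sup>+z. ennreal (F2 z) * indicator (AA j) z \<partial>lborel))"
    by (subst nn_integral_sum, measurable, intro sum.cong refl, subst nn_integral_add, measurable)
       (subst (1 2) nn_integral_cmult; measurable)
  also have "\<dots> \<le> (\<Sum>j\<in>{K..<2*K}. ennreal (G1 * real K powr (s1 - Q1)) + ennreal (G2 * real K powr (s2 - Q2)))"
  proof (intro sum_mono add_mono)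
    fix j assume j: "j \<in> {K..<2*K}"
    have K1: "K \<ge> 1" "j < 2 * K" using K j by auto
    have "ennreal (k1 j) * (\<integral>\<^sup>+z. ennreal (F1 z) * indicator (AA j) z \<partial>lborel) \<le>
       ennreal (k1 j) * ennreal (C * (2 powr - real j) powr (- (p * Q1) * \<theta>2 - C0 * (1 / (real K * D1))) * \<bar>ln (2 powr - real j)\<bar> powr s1)"
      unfolding F1_def e1_def AA_def using H1[of j] j by (intro mult_left_mono) auto
    also have "\<dots> \<le> ennreal (G1 * real K powr (s1 - Q1))"
      unfolding ennreal_mult'[OF k0(1), symmetric]
      unfolding k1_def e1_def G1_def
      by (rule ennreal_leI, rule annulus_term_bound[OF K1 _ D0(1) aQ(1)])
         (use s p \<theta> C in \<open>auto simp: c1_def\<close>)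
    finally show "ennreal (k1 j) * (\<integral>\<^sup>+z. ennreal (F1 z) * indicator (AA j) z \<partial>lborel) \<le> ennreal (G1 * real K powr (s1 - Q1))" .
    have "ennreal (k2 j) * (\<integral>\<^sup>+z. ennreal (F2 z) * indicator (AA j) z \<partial>lborel) \<le>
       ennreal (k2 j) * ennreal (C * (2 powr - real j) powr (- (1 * Q2) * \<theta>2 - C0 * (1 / (real K * D2))) * \<bar>ln (2 powr - real j)\<bar> powr s2)"
      unfolding F2_def e2_def AA_def using H2[of j] j by (intro mult_left_mono) auto
    also have "\<dots> \<le> ennreal (G2 * real K powr (s2 - Q2))"
      unfolding ennreal_mult'[OF k0(2), symmetric]
      unfolding k2_def e2_def G2_def
      by (rule ennreal_leI, rule annulus_term_bound[OF K1 _ D0(2) aQ(2)])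
         (use s p \<theta> C in \<open>auto simp: c2_def\<close>)
    finally show "ennreal (k2 j) * (\<integral>\<^sup>+z. ennreal (F2 z) * indicator (AA j) z \<partial>lborel) \<le> ennreal (G2 * real K powr (s2 - Q2))" .
  qed
  also have "\<dots> = ennreal (real K * (G1 * real K powr (s1 - Q1))) + ennreal (real K * (G2 * real K powr (s2 - Q2)))"
  proof -
    have "card {K..<2*K} = K" by simp
    then show ?thesis by (simp add: distrib_left ennreal_mult' ennreal_of_nat_eq_real_of_nat)
  qed
  finally have "(\<integral>\<^sup>+z. ennreal (V z * u z powr (q - a) * \<psi> z) \<partial>lborel)
     \<le> 2 * (ennreal (real K * (G1 * real K powr (s1 - Q1))) + ennreal (real K * (G2 * real K powr (s2 - Q2))))"
    using est by (meson mult_left_mono order_trans zero_le)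
  moreover have "\<psi> \<in> borel_measurable borel"
  proof -
    have c1: "continuous_on UNIV \<phi>" by (rule has_grad_continuous[OF \<phi>(1)])
    have c2: "continuous_on UNIV \<eta>"
      by (intro continuous_at_imp_continuous_on ballI DERIV_isCont[OF \<eta>(1)])
    have c3: "continuous_on UNIV (\<lambda>z::'a \<times> real. \<eta> (snd z))"
      by (rule continuous_on_compose2[OF c2 continuous_on_snd[OF continuous_on_id]]) simp
    show ?thesis unfolding \<psi>_def[abs_def]
      by (intro borel_measurable_continuous_onI continuous_on_mult continuous_on_power c1 c3)
  qed
  moreover have "\<psi> z = 1" if "z \<in> E_set \<Omega> \<theta>1 \<theta>2 (2 powr - real K)" "2 / real K \<le> snd z" for z
  proof -
    have "1 / real K \<le> snd z" using that(2) k by (simp add: field_simps)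
    then show ?thesis using \<phi>1[OF that(1)] \<eta>1[OF that(2)] by (simp add: \<psi>_def)
  qed
  ultimately show ?thesis
    using \<phi>(3) \<eta>(2) unfolding a_def by (intro bexI[of _ \<psi>]) (auto simp: \<psi>_def)
qed

section \<open>Vanishing of weak solutions\<close>

theorem theorem2p1:
  fixes \<Omega> :: "'a::euclidean_space set"
    and p q \<theta>1 \<theta>2 C0 C \<delta>0 \<epsilon>0 :: real
    and V u :: "'a \<times> real \<Rightarrow> real"
    and u0 :: "'a \<Rightarrow> real"
  assumes dim: "DIM('a) \<ge> 3"
    and domain: "open \<Omega>" "bounded \<Omega>" "connected \<Omega>"
    and exponents: "p > 1" "q > max (p - 1) 1"
    and V_loc: "Lp_loc 1 (cyl \<Omega>) V"
    and V_pos: "AE z\<in>open_cyl \<Omega> in lebesgue. V z > 0"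
    and u0_loc: "Lp_loc 1 \<Omega> u0"
    and u0_nonneg: "AE x\<in>\<Omega> in lebesgue. u0 x \<ge> 0"
    and constants: "\<theta>1 \<ge> 1" "\<theta>2 \<ge> 1" "C0 \<ge> 0" "C > 0" "0 < \<delta>0" "\<delta>0 < 1" "\<epsilon>0 > 0"
    and HP_i: "\<exists>s2. 0 < s2 \<and> s2 < 1 / (q - 1) \<and>
      (\<forall>\<delta> \<epsilon>. 0 < \<delta> \<and> \<delta> < \<delta>0 \<and> 0 < \<epsilon> \<and> \<epsilon> < \<epsilon>0 \<longrightarrow>
        (\<integral>\<^sup>+(x, t)\<in>E_set \<Omega> \<theta>1 \<theta>2 (\<delta> / 2) - E_set \<Omega> \<theta>1 \<theta>2 \<delta>.
            ennreal (t powr ((\<theta>1 - 1) * (q / (q - 1) - \<epsilon>)) *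
                     V (x, t) powr (- 1 / (q - 1) + \<epsilon>)) \<partial>lebesgue)
        \<le> ennreal (C * \<delta> powr (- (q / (q - 1)) * \<theta>2 - C0 * \<epsilon>) * \<bar>ln \<delta>\<bar> powr s2))"
    and HP_ii: "\<exists>s4. 0 < s4 \<and> s4 < (p - 1) / (q - p + 1) \<and>
      (\<forall>\<delta> \<epsilon>. 0 < \<delta> \<and> \<delta> < \<delta>0 \<and> 0 < \<epsilon> \<and> \<epsilon> < \<epsilon>0 \<longrightarrow>
        (\<integral>\<^sup>+(x, t)\<in>E_set \<Omega> \<theta>1 \<theta>2 (\<delta> / 2) - E_set \<Omega> \<theta>1 \<theta>2 \<delta>.
            ennreal (bdry_dist \<Omega> x powr (- (\<theta>2 + 1) * p * (q / (q - p + 1) - \<epsilon>)) *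
                     V (x, t) powr (- (p - 1) / (q - p + 1) + \<epsilon>)) \<partial>lebesgue)
        \<le> ennreal (C * \<delta> powr (- (p * q / (q - p + 1)) * \<theta>2 - C0 * \<epsilon>) * \<bar>ln \<delta>\<bar> powr s4))"
    and sol: "weak_solution p q \<Omega> V u0 u"
  shows "AE z\<in>cyl \<Omega> in lebesgue. u z = 0"
proof -
  have p: "p > 1" and q: "q > p - 1" "q > 1" using exponents by auto
  define D1 D2 where "D1 = q - p + 1" and "D2 = q - 1"
  define Q1 Q2 where "Q1 = q / D1" and "Q2 = q / D2"
  have D: "D1 > 0" "D2 > 0" using q by (auto simp: D1_def D2_def)
  have Q: "Q1 > 0" "Q2 > 0" using D q by (auto simp: Q1_def Q2_def)
  obtain s2 where s2: "0 < s2" "s2 < 1 / D2" and HPi: "\<And>\<delta> \<epsilon>. 0 < \<delta> \<Longrightarrow> \<delta> < \<delta>0 \<Longrightarrow> 0 < \<epsilon> \<Longrightarrow> \<epsilon> < \<epsilon>0 \<Longrightarrow>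
        (\<integral>\<^sup>+(x, t)\<in>E_set \<Omega> \<theta>1 \<theta>2 (\<delta> / 2) - E_set \<Omega> \<theta>1 \<theta>2 \<delta>.
            ennreal (t powr ((\<theta>1 - 1) * (Q2 - \<epsilon>)) * V (x, t) powr (- 1 / D2 + \<epsilon>)) \<partial>lebesgue)
        \<le> ennreal (C * \<delta> powr (- Q2 * \<theta>2 - C0 * \<epsilon>) * \<bar>ln \<delta>\<bar> powr s2)"
    using HP_i unfolding D2_def Q2_def by blast
  obtain s4 where s4: "0 < s4" "s4 < (p - 1) / D1" and HPii: "\<And>\<delta> \<epsilon>. 0 < \<delta> \<Longrightarrow> \<delta> < \<delta>0 \<Longrightarrow> 0 < \<epsilon> \<Longrightarrow> \<epsilon> < \<epsilon>0 \<Longrightarrow>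
        (\<integral>\<^sup>+(x, t)\<in>E_set \<Omega> \<theta>1 \<theta>2 (\<delta> / 2) - E_set \<Omega> \<theta>1 \<theta>2 \<delta>.
            ennreal (bdry_dist \<Omega> x powr (- (\<theta>2 + 1) * p * (Q1 - \<epsilon>)) * V (x, t) powr (- (p - 1) / D1 + \<epsilon>)) \<partial>lebesgue)
        \<le> ennreal (C * \<delta> powr (- (p * q / D1) * \<theta>2 - C0 * \<epsilon>) * \<bar>ln \<delta>\<bar> powr s4)"
    using HP_ii unfolding D1_def Q1_def by blast
  obtain uB VB :: "'a \<times> real \<Rightarrow> real" and X :: "'a \<times> real \<Rightarrow> 'a" where
    sup: "regular_supersolution p q (open_cyl \<Omega>) uB VB X"
    and uae: "AE z in lborel. z \<in> open_cyl \<Omega> \<longrightarrow> u z = uB z"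
    and Vae: "AE z in lborel. z \<in> open_cyl \<Omega> \<longrightarrow> V z = VB z"
    by (rule weak_solution_regularised[OF p V_loc V_pos sol])
  note [measurable] = regular_supersolution.u_borel[OF sup] regular_supersolution.V_borel[OF sup]
  have V0: "0 < VB z" for z by (rule regular_supersolution.V_pos[OF sup])
  obtain M where M: "M > 0" "\<And>x. smooth_step' x \<le> M" using smooth_step'_bounded by blast
  define m where "m = M * 2 * 2 powr \<theta>2 * (3 * \<theta>2 + \<theta>1) / (\<theta>2 * ln 2)"
  \<comment> \<open>The power of the cut-off must be large enough for both applications of Young's inequality.\<close>
  obtain n :: nat where "p + 1 + p * Q1 + Q2 \<le> real n" using real_arch_simple by blast
  then have n: "real n > p" "real n \<ge> p * Q1" "real n \<ge> Q2"
    using p Q mult_nonneg_nonneg[of p Q1] by linarith+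
  \<comment> \<open>For \<open>1 / K < \<mu>\<close> all the parameters \<open>\<delta> = 2 powr (- j)\<close> with \<open>j \<ge> K\<close> and \<open>\<epsilon> = 1 / (K * D)\<close> are
    admissible in the hypotheses.\<close>
  define \<mu> where "\<mu> = min (min 1 (p - 1)) (min (min (\<epsilon>0 * D1) (\<epsilon>0 * D2)) \<delta>0)"
  have "\<mu> > 0" using p D constants by (simp add: \<mu>_def)
  then obtain N where N: "inverse (real (Suc N)) < \<mu>" using reals_Archimedean by blast
  define K where "K k = k + Suc N + 1" for k :: nat
  have K: "K k \<ge> 2" "1 / real (K k) < \<mu>" for k
  proof -
    show "K k \<ge> 2" by (simp add: K_def)
    have "1 / real (K k) \<le> inverse (real (Suc N))"
      unfolding inverse_eq_divide by (intro divide_left_mono) (auto simp: K_def)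
    then show "1 / real (K k) < \<mu>" using N by linarith
  qed
  have Klim: "filterlim (\<lambda>k. real (K k)) at_top sequentially"
    unfolding K_def by (intro filterlim_compose[OF filterlim_real_sequentially] filterlim_at_top_mono[OF filterlim_ident]) auto
  have pq: "p * q / D1 = p * Q1" by (simp add: Q1_def)
  have half: "2 powr - real j / 2 = (2 powr - real (Suc j) :: real)" for j
    by (simp add: powr_diff powr_minus_divide powr_add field_simps)
  have small: "2 powr - real j < \<delta>0" "0 < 1 / (real (K k) * D1)" "1 / (real (K k) * D1) < \<epsilon>0"
    "0 < 1 / (real (K k) * D2)" "1 / (real (K k) * D2) < \<epsilon>0" "1 / real (K k) < p - 1" if "K k \<le> j" for j k
  proof -
    have k: "real (K k) > 0" using K(1)[of k] by simp
    have \<mu>: "1 / real (K k) < p - 1" "1 / real (K k) < \<epsilon>0 * D1" "1 / real (K k) < \<epsilon>0 * D2" "1 / real (K k) < \<delta>0"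
      using K(2)[of k] by (auto simp: \<mu>_def)
    show "1 / real (K k) < p - 1" by (rule \<mu>)
    show "0 < 1 / (real (K k) * D1)" "0 < 1 / (real (K k) * D2)" using k D by auto
    show "1 / (real (K k) * D1) < \<epsilon>0" "1 / (real (K k) * D2) < \<epsilon>0"
      using \<mu> D k by (auto simp: field_simps)
    have "2 powr - real j \<le> 2 powr - real (K k)" using that by simp
    also have "\<dots> = 1 / 2 ^ K k" by (simp add: powr_minus_divide powr_realpow)
    also have "\<dots> \<le> 1 / real (K k)"
      using k less_imp_le[OF of_nat_less_two_power[of "K k", where 'a = real]] by (intro divide_left_mono) simp_all
    finally show "2 powr - real j < \<delta>0" using \<mu>(4) by linarith
  qed
  have Asub: "E_set \<Omega> \<theta>1 \<theta>2 \<delta> - E_set \<Omega> \<theta>1 \<theta>2 \<delta>' \<subseteq> cyl \<Omega>" for \<delta> \<delta>' by (auto simp: E_set_def)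
  define c1 c2 where "c1 = max 1 ((real n * m) powr p)" and "c2 = max 1 (2 * real n * m)"
  define G1 where "G1 = 4 powr ((p - 1) / D1) * c1 powr Q1 * exp (1 / D1) * C * 2 powr (2 * (C0 + \<theta>2 * p) / D1) * 2 powr s4"
  define G2 where "G2 = 4 powr (1 / D2) * c2 powr Q2 * exp (1 / D2) * C * 2 powr (2 * (C0 + \<theta>2 * 1) / D2) * 2 powr s2"
  define B where "B k = 2 * (ennreal (real (K k) * (G1 * real (K k) powr (s4 - Q1)))
      + ennreal (real (K k) * (G2 * real (K k) powr (s2 - Q2))))" for k
  define admissible where "admissible k \<psi> \<longleftrightarrow> (\<forall>z. 0 \<le> \<psi> z) \<and>
     (\<forall>z\<in>E_set \<Omega> \<theta>1 \<theta>2 (2 powr - real (K k)). 2 / real (K k) \<le> snd z \<longrightarrow> \<psi> z = 1) \<and>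
     (\<integral>\<^sup>+z. ennreal (VB z * uB z powr (q - 1 / real (K k)) * \<psi> z) \<partial>lborel) \<le> B k" for k \<psi>
  have "\<exists>\<psi>\<in>borel_measurable borel. admissible k \<psi>" for k
    unfolding admissible_def
    unfolding B_def G1_def G2_def c1_def c2_def m_def
  proof (rule cutoff_estimate[OF sup domain(1,2) p q constants(1,2,3) less_imp_le[OF constants(4)]
        less_imp_le[OF s4(1)] less_imp_le[OF s2(1)] D1_def D2_def Q1_def Q2_def M n K(1) small(6)[OF order_refl]])
    fix j assume j: "K k \<le> j"
    show "(\<integral>\<^sup>+z. ennreal (bdry_dist \<Omega> (fst z) powr (- (\<theta>2 + 1) * p * (Q1 - 1 / (real (K k) * D1)))
            * VB z powr (- (p - 1) / D1 + 1 / (real (K k) * D1)))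
          * indicator (E_set \<Omega> \<theta>1 \<theta>2 (2 powr - real (Suc j)) - E_set \<Omega> \<theta>1 \<theta>2 (2 powr - real j)) z \<partial>lborel)
      \<le> ennreal (C * (2 powr - real j) powr (- (p * Q1) * \<theta>2 - C0 * (1 / (real (K k) * D1))) * \<bar>ln (2 powr - real j)\<bar> powr s4)"
      by (rule annulus_hypothesis[OF Vae Asub, where F = "\<lambda>x t. bdry_dist \<Omega> x powr (- (\<theta>2 + 1) * p * (Q1 - 1 / (real (K k) * D1)))"])
         (rule HPii[of "2 powr - real j" "1 / (real (K k) * D1)", unfolded half pq, OF _ small(1)[OF j] small(2,3)[OF j]], simp)
    show "(\<integral>\<^sup>+z. ennreal (snd z powr ((\<theta>1 - 1) * (Q2 - 1 / (real (K k) * D2)))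
            * VB z powr (- 1 / D2 + 1 / (real (K k) * D2)))
          * indicator (E_set \<Omega> \<theta>1 \<theta>2 (2 powr - real (Suc j)) - E_set \<Omega> \<theta>1 \<theta>2 (2 powr - real j)) z \<partial>lborel)
      \<le> ennreal (C * (2 powr - real j) powr (- (1 * Q2) * \<theta>2 - C0 * (1 / (real (K k) * D2))) * \<bar>ln (2 powr - real j)\<bar> powr s2)"
      unfolding mult_1
      by (rule annulus_hypothesis[OF Vae Asub, where F = "\<lambda>x t. t powr ((\<theta>1 - 1) * (Q2 - 1 / (real (K k) * D2)))"])
         (rule HPi[of "2 powr - real j" "1 / (real (K k) * D2)", unfolded half, OF _ small(1)[OF j] small(4,5)[OF j]], simp)
  qed
  then obtain \<psi> where ad: "\<And>k. \<psi> k \<in> borel_measurable borel" "\<And>k. admissible k (\<psi> k)"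
    by metis
  have \<psi>: "\<And>k. \<psi> k \<in> borel_measurable borel"
    "\<And>k z. z \<in> E_set \<Omega> \<theta>1 \<theta>2 (2 powr - real (K k)) \<Longrightarrow> 2 / real (K k) \<le> snd z \<Longrightarrow> \<psi> k z = 1"
    "\<And>k. (\<integral>\<^sup>+z. ennreal (VB z * uB z powr (q - 1 / real (K k)) * \<psi> k z) \<partial>lborel) \<le> B k"
    using ad unfolding admissible_def by auto
  note [measurable] = \<psi>(1)
  have Blim: "B \<longlonglongrightarrow> 0"
  proof -
    have lim: "(\<lambda>k. real (K k) * (G * real (K k) powr (s - Q))) \<longlonglongrightarrow> 0" if "1 + s - Q < 0" for G s Q
    proof -
      have "(\<lambda>k. G * real (K k) powr (1 + s - Q)) \<longlonglongrightarrow> G * 0"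
        by (intro tendsto_mult tendsto_const tendsto_neg_powr[OF that Klim])
      moreover have "G * real (K k) powr (1 + s - Q) = real (K k) * (G * real (K k) powr (s - Q))" for k
        using K(1)[of k] by (simp add: powr_add powr_diff)
      ultimately show ?thesis by simp
    qed
    \<comment> \<open>Here the strict upper bounds on the powers of the logarithm enter.\<close>
    have e1: "1 + s4 - Q1 < 0" and e2: "1 + s2 - Q2 < 0"
    proof -
      have "Q1 = 1 + (p - 1) / D1" "Q2 = 1 + 1 / D2"
        using D by (simp_all add: Q1_def Q2_def D1_def D2_def field_simps)
      then show "1 + s4 - Q1 < 0" "1 + s2 - Q2 < 0" using s4 s2 by auto
    qed
    have "B \<longlonglongrightarrow> 2 * (ennreal 0 + ennreal 0)"
      unfolding B_def[abs_def]
      by (intro ennreal_tendsto_cmult tendsto_add tendsto_ennrealI lim e1 e2) simp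
    then show ?thesis by simp
  qed
  have "(\<integral>\<^sup>+z. ennreal (VB z * uB z powr q) * indicator (open_cyl \<Omega>) z \<partial>lborel)
     \<le> (\<integral>\<^sup>+z. liminf (\<lambda>k. ennreal (VB z * uB z powr (q - 1 / real (K k)) * \<psi> k z)) \<partial>lborel)"
  proof (rule nn_integral_mono)
    fix z :: "'a \<times> real"
    show "ennreal (VB z * uB z powr q) * indicator (open_cyl \<Omega>) z
        \<le> liminf (\<lambda>k. ennreal (VB z * uB z powr (q - 1 / real (K k)) * \<psi> k z))"
    proof (cases "z \<in> open_cyl \<Omega>")
      case True
      obtain x t where z: "z = (x, t)" "x \<in> \<Omega>" "t > 0" using True by (cases z) auto
      define r where "r = bdry_dist \<Omega> x powr (- \<theta>2) + t powr \<theta>1"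
      have "filterlim (\<lambda>k. 2 powr (real (K k) * \<theta>2) :: real) at_top sequentially"
      proof (rule filterlim_at_top_mono[OF Klim], intro always_eventually allI)
        fix k
        have "real (K k) \<le> 2 ^ K k" by (rule less_imp_le[OF of_nat_less_two_power])
        also have "\<dots> = 2 powr real (K k)" by (simp add: powr_realpow)
        also have "\<dots> \<le> 2 powr (real (K k) * \<theta>2)"
          using mult_left_mono[OF constants(2), of "real (K k)"] by (intro powr_mono) auto
        finally show "real (K k) \<le> 2 powr (real (K k) * \<theta>2)" .
      qed
      then have ev1: "eventually (\<lambda>k. r \<le> 2 powr (real (K k) * \<theta>2)) sequentially"
        by (simp add: filterlim_at_top)
      have inv: "(\<lambda>k. 1 / real (K k)) \<longlonglongrightarrow> 0"
        using tendsto_inverse_0_at_top[OF Klim] by (simp add: inverse_eq_divide)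
      have "(\<lambda>k. 2 / real (K k)) \<longlonglongrightarrow> 0" using tendsto_mult_right_zero[OF inv, of 2] by simp
      then have ev2: "eventually (\<lambda>k. 2 / real (K k) < t) sequentially"
        using z(3) by (rule order_tendstoD)
      have "(\<lambda>k. VB z * uB z powr (q - 1 / real (K k))) \<longlonglongrightarrow> VB z * uB z powr q"
      proof (cases "uB z = 0")
        case False
        have "(\<lambda>k. VB z * uB z powr (q - 1 / real (K k))) \<longlonglongrightarrow> VB z * uB z powr (q - 0)"
          using False by (intro tendsto_mult tendsto_const tendsto_powr tendsto_diff inv)
        then show ?thesis by simp
      qed simp
      moreover have "eventually (\<lambda>k. VB z * uB z powr (q - 1 / real (K k))
          = VB z * uB z powr (q - 1 / real (K k)) * \<psi> k z) sequentially"
        using ev1 ev2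
      proof eventually_elim
        case (elim k)
        have "z \<in> E_set \<Omega> \<theta>1 \<theta>2 (2 powr - real (K k))"
          using elim z unfolding z(1) E_set_iff[OF refl] r_def by simp
        then have "\<psi> k z = 1" using elim z by (intro \<psi>(2)) auto
        then show ?case by simp
      qed
      ultimately have "(\<lambda>k. VB z * uB z powr (q - 1 / real (K k)) * \<psi> k z) \<longlonglongrightarrow> VB z * uB z powr q"
        by (rule Lim_transform_eventually)
      from lim_imp_Liminf[OF sequentially_bot tendsto_ennrealI[OF this]] show ?thesis
        using True by simp
    qed simp
  qed
  also have "\<dots> \<le> liminf (\<lambda>k. \<integral>\<^sup>+z. ennreal (VB z * uB z powr (q - 1 / real (K k)) * \<psi> k z) \<partial>lborel)"
    by (intro nn_integral_liminf) measurable
  also have "\<dots> \<le> liminf B"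
    by (intro Liminf_mono always_eventually allI \<psi>(3))
  also have "\<dots> = 0" by (rule lim_imp_Liminf[OF sequentially_bot Blim])
  finally have zero: "(\<integral>\<^sup>+z. ennreal (VB z * uB z powr q) * indicator (open_cyl \<Omega>) z \<partial>lborel) = 0"
    by simp
  have [measurable]: "open_cyl \<Omega> \<in> sets borel"
    by (intro borel_open open_Times domain) simp
  have "AE z in lborel. ennreal (VB z * uB z powr q) * indicator (open_cyl \<Omega>) z = 0"
    using zero by (subst (asm) nn_integral_0_iff_AE) measurable
  then have "AE z in lborel. z \<in> cyl \<Omega> \<longrightarrow> u z = 0"
    using uae AE_lborel_time_nonzero
  proof eventually_elim
    case (elim z)
    show ?case
    proof
      assume "z \<in> cyl \<Omega>"
      then have z: "z \<in> open_cyl \<Omega>" using elim(3) by auto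
      then have "VB z * uB z powr q \<le> 0" using elim(1) by (simp add: ennreal_eq_0_iff)
      then have "uB z powr q \<le> 0" using V0[of z] by (simp add: mult_le_0_iff)
      then have "uB z = 0" using powr_gt_zero[of "uB z" q] by (metis not_less)
      then show "u z = 0" using elim(2) z by simp
    qed
  qed
  then show ?thesis by (simp add: AE_completion_iff)
qed

end
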